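(* Let $\mathcal{C}_n(\boldsymbol\eta,\boldsymbol\gamma,\boldsymbol\tau)$ be the generalized product code with parameters $\boldsymbol\eta,\boldsymbol\gamma,\boldsymbol\tau$ and $n$ constraint nodes, transmitted over the binary erasure channel with erasure probability $p=c/n$ for fixed $c>0$, and decoded with a fixed number $\ell\ge1$ of iterations of the iterative decoder. Let $W_k$, $k\in\{1,\dots,n\}$, be the indicator random variable of the event that the $k$-th component code declares a decoding failure after $\ell$ iterations of decoding, and let $W=\frac1n\sum_{k=1}^nW_k$. Let $z^{(\ell)}$ be the probability that the root vertex of the first $\ell$ generations of the multi-type branching process $\mathfrak{X}$ survives $\ell$ iterations of the peeling procedure. Then $$\lim_{n\to\infty}\mathbb{E}[W]=z^{(\ell)}.$$ Furthermore, for any $\varepsilon>0$ there exist $\delta>0$, $\beta>0$ and $n_0\in\mathbb{N}$ such that for all $n>n_0$ $$\mathbb{P}\big(|W-\mathbb{E}[W]|>\varepsilon\big)\le e^{-\beta n^{\delta}}.$$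
   Context: Parameters: $L\ge1$ and $\mathsf{t}_{\max}\ge1$ are fixed integers. $\boldsymbol\eta=(\eta_{i,j})$ is a binary symmetric $L\times L$ matrix such that every row contains at least one entry equal to 1 and which is irreducible (the graph on $\{1,\dots,L\}$ joining $i,j$ when $\eta_{i,j}=1$ is connected). $\boldsymbol\gamma=(\gamma_1,\dots,\gamma_L)$ is a probability vector. $\boldsymbol\tau=(\boldsymbol\tau(i))_{i=1}^L$, where each $\boldsymbol\tau(i)=(\tau_1(i),\dots,\tau_{\mathsf{t}_{\max}}(i))$ is a probability vector. All these, together with $c$ and $\ell$, are fixed, independent of $n$. Code: place $n_i=\gamma_i n$ constraint nodes (CNs) at each position $i\in\{1,\dots,L\}$ (only $n$ for which all $n_i$ are integers are considered; there are assumed to be infinitely many such $n$, and $n\to\infty$ along them, with $n>c$). Each CN at position $i$ is connected to each (other) CN at position $j$ through one variable node (code bit) if and only if $\eta_{i,j}=1$ (a CN is never connected to itself). Each CN is a component code with an erasure-correcting capability $\mathsf{t}\in\{1,\dots,\mathsf{t}_{\max}\}$: it corrects every erasure pattern of weight at most $\mathsf{t}$ and declares a failure otherwise. The capabilities are assigned either deterministically, so that exactly $\tau_{\mathsf{t}}(i)n_i$ of the CNs at position $i$ have capability $\mathsf{t}$ (assuming these numbers are integers), or independently at random (and independently of the channel), each CN at position $i$ having capability $\mathsf{t}$ with probability $\tau_{\mathsf{t}}(i)$. Channel and decoding: each code bit is erased independently with probability $c/n$. The residual graph is the graph on the $n$ CNs whose edges are the erased bits. Iterative decoding is equivalent to the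 peeling procedure: in each iteration, all vertices whose degree in the current graph is at most their own erasure-correcting capability are removed simultaneously, together with all adjacent edges. $W_k=1$ if and only if vertex $k$ has not been removed in the first $\ell$ iterations. Branching process $\mathfrak{X}$: a random rooted tree whose vertices have types $(i,\mathsf{t})\in\{1,\dots,L\}\times\{1,\dots,\mathsf{t}_{\max}\}$. The root (depth 0) has type $(i,\mathsf{t})$ with probability $\gamma_i\tau_{\mathsf{t}}(i)$. A vertex of type $(i,\mathsf{t})$ has, for every type $(j,\mathsf{t}')$, a Poisson-distributed number of offspring of type $(j,\mathsf{t}')$ with mean $c\,\eta_{i,j}\gamma_j\tau_{\mathsf{t}'}(j)$, independently over types $(j,\mathsf{t}')$ and independently of all other vertices. The first $\ell$ generations form the subtree of vertices at depth at most $\ell$; the same peeling procedure is applied to it (a vertex of type $(i,\mathsf{t})$ is removed in an iteration if its current degree, counting the edge to its parent if present, is at most $\mathsf{t}$), and the root survives if it is not removed during $\ell$ iterations. *)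

theory Defs
  imports "HOL-Probability.Probability"
begin

text \<open>Conventions: constraint nodes are \<open>1, \<dots>, n\<close> and \<open>pos k\<close> is the position of constraint
  node \<open>k\<close>. A probability vector with entries indexed by \<open>{1..m}\<close> is a \<^typ>\<open>nat pmf\<close> whose support
  is contained in \<open>{1..m}\<close>. A graph is a pair (vertices, edges) with edges two-element sets.\<close>

subsection \<open>Peeling\<close>

definition vertex_degree :: "'v set set \<Rightarrow> 'v \<Rightarrow> nat" where
  "vertex_degree E v = card {e \<in> E. v \<in> e}"

definition peel_step :: "('v \<Rightarrow> nat) \<Rightarrow> 'v set \<times> 'v set set \<Rightarrow> 'v set \<times> 'v set set" where
  "peel_step cap = (\<lambda>(V, E). let R = {v \<in> V. vertex_degree E v \<le> cap v}
                              in (V - R, {e \<in> E. e \<inter> R = {}}))"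

definition survives :: "('v \<Rightarrow> nat) \<Rightarrow> 'v set \<times> 'v set set \<Rightarrow> nat \<Rightarrow> 'v \<Rightarrow> bool" where
  "survives cap G l v \<longleftrightarrow> v \<in> fst ((peel_step cap ^^ l) G)"

subsection \<open>Generalized product codes\<close>

definition valid_placement :: "nat \<Rightarrow> nat pmf \<Rightarrow> nat \<Rightarrow> (nat \<Rightarrow> nat) \<Rightarrow> bool" where
  "valid_placement L \<gamma> n pos \<longleftrightarrow>
     pos ` {1..n} \<subseteq> {1..L} \<and>
     (\<forall>i\<in>{1..L}. real (card {k \<in> {1..n}. pos k = i}) = pmf \<gamma> i * real n)"

text \<open>A code bit is identified with the pair of constraint nodes that it connects.\<close>

definition code_bits :: "(nat \<Rightarrow> nat \<Rightarrow> nat) \<Rightarrow> nat \<Rightarrow> (nat \<Rightarrow> nat) \<Rightarrow> nat set set" where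
  "code_bits \<eta> n pos =
     {{k, m} | k m. k \<in> {1..n} \<and> m \<in> {1..n} \<and> k \<noteq> m \<and> \<eta> (pos k) (pos m) = 1}"

definition erasures :: "(nat \<Rightarrow> nat \<Rightarrow> nat) \<Rightarrow> real \<Rightarrow> nat \<Rightarrow> (nat \<Rightarrow> nat) \<Rightarrow> (nat set \<Rightarrow> bool) pmf" where
  "erasures \<eta> p n pos = Pi_pmf (code_bits \<eta> n pos) False (\<lambda>_. bernoulli_pmf p)"

definition residual_graph ::
    "(nat \<Rightarrow> nat \<Rightarrow> nat) \<Rightarrow> nat \<Rightarrow> (nat \<Rightarrow> nat) \<Rightarrow> (nat set \<Rightarrow> bool) \<Rightarrow> nat set \<times> nat set set" where
  "residual_graph \<eta> n pos x = ({1..n}, {e \<in> code_bits \<eta> n pos. x e})"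

text \<open>The two ways of assigning the erasure-correcting capabilities, as laws \<open>K\<close> of the
  function that maps a constraint node to its capability.\<close>

definition deterministic_caps ::
    "nat \<Rightarrow> nat \<Rightarrow> nat pmf \<Rightarrow> (nat \<Rightarrow> nat pmf) \<Rightarrow> nat \<Rightarrow> (nat \<Rightarrow> nat) \<Rightarrow> (nat \<Rightarrow> nat) pmf \<Rightarrow> bool" where
  "deterministic_caps L tmax \<gamma> \<tau> n pos K \<longleftrightarrow>
     (\<exists>cap. K = return_pmf cap \<and> cap ` {1..n} \<subseteq> {1..tmax} \<and>
        (\<forall>i\<in>{1..L}. \<forall>t\<in>{1..tmax}.
           real (card {k \<in> {1..n}. pos k = i \<and> cap k = t}) = pmf (\<tau> i) t * (pmf \<gamma> i * real n)))"

definition random_caps ::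
    "(nat \<Rightarrow> nat pmf) \<Rightarrow> nat \<Rightarrow> (nat \<Rightarrow> nat) \<Rightarrow> (nat \<Rightarrow> nat) pmf \<Rightarrow> bool" where
  "random_caps \<tau> n pos K \<longleftrightarrow> K = Pi_pmf {1..n} 0 (\<lambda>k. \<tau> (pos k))"

definition code_space ::
    "(nat \<Rightarrow> nat \<Rightarrow> nat) \<Rightarrow> real \<Rightarrow> nat \<Rightarrow> (nat \<Rightarrow> nat) \<Rightarrow> (nat \<Rightarrow> nat) pmf
       \<Rightarrow> ((nat \<Rightarrow> nat) \<times> (nat set \<Rightarrow> bool)) pmf" where
  "code_space \<eta> c n pos K = pair_pmf K (erasures \<eta> (c / real n) n pos)"

definition failure ::
    "(nat \<Rightarrow> nat \<Rightarrow> nat) \<Rightarrow> nat \<Rightarrow> nat \<Rightarrow> (nat \<Rightarrow> nat) \<Rightarrow> nat \<Rightarrow> (nat \<Rightarrow> nat) \<times> (nat set \<Rightarrow> bool) \<Rightarrow> real" where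
  "failure \<eta> l n pos k = (\<lambda>(cap, x). of_bool (survives cap (residual_graph \<eta> n pos x) l k))"

definition failure_fraction ::
    "(nat \<Rightarrow> nat \<Rightarrow> nat) \<Rightarrow> nat \<Rightarrow> nat \<Rightarrow> (nat \<Rightarrow> nat) \<Rightarrow> (nat \<Rightarrow> nat) \<times> (nat set \<Rightarrow> bool) \<Rightarrow> real" where
  "failure_fraction \<eta> l n pos \<omega> = (1 / real n) * (\<Sum>k = 1..n. failure \<eta> l n pos k \<omega>)"

subsection \<open>The multi-type branching process\<close>

text \<open>A type is a pair (position, capability). A vertex of the tree is the path from it up to the
  root: the root of type \<open>s\<close> is \<open>[(s, 0)]\<close>, and \<open>(s', m) # v\<close> is the \<open>m\<close>-th child of type \<open>s'\<close>
  of \<open>v\<close>. So a vertex of depth \<open>d\<close> is a list of length \<open>Suc d\<close>.\<close>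

type_synonym vtype = "nat \<times> nat"
type_synonym tree_vertex = "(vtype \<times> nat) list"

definition vertex_type :: "tree_vertex \<Rightarrow> vtype" where
  "vertex_type v = fst (hd v)"

text \<open>The case distinction is needed because the library's \<open>poisson_pmf\<close> is only specified
  for a positive rate.\<close>

definition poisson :: "real \<Rightarrow> nat pmf" where
  "poisson r = (if r > 0 then poisson_pmf r else return_pmf 0)"

definition offspring_mean ::
    "(nat \<Rightarrow> nat \<Rightarrow> nat) \<Rightarrow> nat pmf \<Rightarrow> (nat \<Rightarrow> nat pmf) \<Rightarrow> real \<Rightarrow> vtype \<Rightarrow> vtype \<Rightarrow> real" where
  "offspring_mean \<eta> \<gamma> \<tau> c = (\<lambda>(i, t) (j, t'). c * real (\<eta> i j) * pmf \<gamma> j * pmf (\<tau> j) t')"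

definition root_type :: "nat pmf \<Rightarrow> (nat \<Rightarrow> nat pmf) \<Rightarrow> vtype pmf" where
  "root_type \<gamma> \<tau> = bind_pmf \<gamma> (\<lambda>i. map_pmf (Pair i) (\<tau> i))"

text \<open>\<open>generations L tmax \<eta> \<gamma> \<tau> c s d\<close> is the law of the set of vertices at depth at most \<open>d\<close>
  given that the root has type \<open>s\<close>. The table \<open>N\<close> holds the independent offspring numbers of
  the vertices at depth exactly \<open>d\<close>.\<close>

primrec generations ::
    "nat \<Rightarrow> nat \<Rightarrow> (nat \<Rightarrow> nat \<Rightarrow> nat) \<Rightarrow> nat pmf \<Rightarrow> (nat \<Rightarrow> nat pmf) \<Rightarrow> real \<Rightarrow> vtype \<Rightarrow> nat
       \<Rightarrow> tree_vertex set pmf" where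
  "generations L tmax \<eta> \<gamma> \<tau> c s 0 = return_pmf {[(s, 0)]}"
| "generations L tmax \<eta> \<gamma> \<tau> c s (Suc d) =
     bind_pmf (generations L tmax \<eta> \<gamma> \<tau> c s d) (\<lambda>T.
       let F = {v \<in> T. length v = Suc d}; S = {1..L} \<times> {1..tmax} in
       map_pmf (\<lambda>N. T \<union> {(s', m) # v | s' m v. v \<in> F \<and> s' \<in> S \<and> m < N (v, s')})
         (Pi_pmf (F \<times> S) 0 (\<lambda>(v, s'). poisson (offspring_mean \<eta> \<gamma> \<tau> c (vertex_type v) s'))))"

definition branching_process ::
    "nat \<Rightarrow> nat \<Rightarrow> (nat \<Rightarrow> nat \<Rightarrow> nat) \<Rightarrow> nat pmf \<Rightarrow> (nat \<Rightarrow> nat pmf) \<Rightarrow> real \<Rightarrow> nat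
       \<Rightarrow> (vtype \<times> tree_vertex set) pmf" where
  "branching_process L tmax \<eta> \<gamma> \<tau> c d =
     bind_pmf (root_type \<gamma> \<tau>) (\<lambda>s. map_pmf (Pair s) (generations L tmax \<eta> \<gamma> \<tau> c s d))"

definition tree_graph :: "tree_vertex set \<Rightarrow> tree_vertex set \<times> tree_vertex set set" where
  "tree_graph T = (T, {{v, tl v} | v. v \<in> T \<and> tl v \<noteq> []})"

definition root_survival_prob ::
    "nat \<Rightarrow> nat \<Rightarrow> (nat \<Rightarrow> nat \<Rightarrow> nat) \<Rightarrow> nat pmf \<Rightarrow> (nat \<Rightarrow> nat pmf) \<Rightarrow> real \<Rightarrow> nat \<Rightarrow> real" where
  "root_survival_prob L tmax \<eta> \<gamma> \<tau> c l =
     measure_pmf.prob (branching_process L tmax \<eta> \<gamma> \<tau> c l)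
       {(s, T). survives (\<lambda>v. snd (vertex_type v)) (tree_graph T) l [(s, 0)]}"

end

theory Submission
  imports Defs "HOL-Real_Asymp.Real_Asymp"
begin

text \<open>
  The limit is obtained by the cavity method instead of a coupling with the branching process.
  A vertex \<open>v\<close> survives \<open>k + 1\<close> rounds iff enough of its neighbours survive \<open>k\<close> rounds in the graph
  without \<open>v\<close> with their thresholds lowered by one. The neighbourhood of \<open>v\<close> is independent of that
  graph, and neighbours rarely influence each other; so the number of surviving neighbours is
  binomial given the number of eligible vertices, hence close to Poisson once this number is
  concentrated. Induction on \<open>k\<close> gives the recursion (density evolution) that the survival
  probabilities in the tree satisfy by thinning and superposition of Poisson variables.

  For the concentration, vertices of degree above a cutoff \<open>D\<close> are made unable to survive a single
  round. Then flipping one erased bit changes the state of at most \<open>2 (D + 2)\<^sup>k\<close> vertices, and since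
  a bit is erased with probability only \<open>c / n\<close>, a variance-sensitive bounded difference inequality
  applies to the \<open>O(n\<^sup>2)\<close> bits. With \<open>D\<close> a small power of \<open>n\<close>, the truncation has no effect outside an
  event of stretched exponentially small probability.
\<close>

subsection \<open>Threshold form of peeling\<close>

text \<open>Two obstacles shape the argument. Deleting \<open>v\<close> lowers the thresholds of all
  its neighbours at once, so the modified system depends on the very neighbourhood it should be
  independent of. Every other vertex \<open>u\<close> is therefore tested with only its own
  threshold lowered; these tests are fixed before the neighbourhood is drawn, and they agree with
  the exact ones unless one neighbour of \<open>v\<close> influences another. A lowered threshold
  equals the capability, just as a non-root tree vertex gets one unit from its parent; only the root
  and the vertex finally observed keep capability plus one.

  Concentration is needed twice: to replace a random binomial parameter by a constant in each step
  of the recursion, and for the final tail. The cutoff, of order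
  \<open>n powr (1 / (4 * (l + 1)))\<close>, keeps the squared influence of one bit at order sqrt n
  at most, yet makes larger degrees stretched exponentially unlikely.

  Capabilities are frozen first: the estimates hold uniformly over assignments with nearly the
  prescribed type counts, and random assignments are averaged only at the end.\<close>

definition nbrs :: "'v set set \<Rightarrow> 'v \<Rightarrow> 'v set" where
  "nbrs E v = {u. {v, u} \<in> E}"

text \<open>Survival of the previous round is not part of the recursion: it is automatic by
  \<open>alive_antimono_Suc\<close>. A capability \<open>t\<close> becomes the threshold
  \<open>Suc t\<close>, since a vertex stays exactly when its degree exceeds
  \<open>t\<close>.\<close>

primrec alive :: "'v set set \<Rightarrow> ('v \<Rightarrow> nat) \<Rightarrow> nat \<Rightarrow> 'v \<Rightarrow> bool" where
  "alive E \<theta> 0 v = True"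
| "alive E \<theta> (Suc k) v = (\<theta> v \<le> card {u \<in> nbrs E v. alive E \<theta> k u})"

lemmas alive_Suc = alive.simps(2)
declare alive_Suc [simp del]

lemma finite_nbrs: "finite E \<Longrightarrow> finite (nbrs E v)"
  unfolding nbrs_def
  by (rule finite_imageD[where f = "\<lambda>u. {v, u}"], rule finite_subset[where B = E])
    (auto simp: inj_on_def doubleton_eq_iff)

text \<open>The recursion iterates a monotone operator from its greatest element, so the iterates
  decrease.\<close>

lemma alive_antimono_Suc: "finite E \<Longrightarrow> alive E \<theta> (Suc k) v \<Longrightarrow> alive E \<theta> k v"
proof (induction k arbitrary: v)
  case (Suc k)
  have "card {u \<in> nbrs E v. alive E \<theta> (Suc k) u} \<le> card {u \<in> nbrs E v. alive E \<theta> k u}"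
    using Suc.IH[OF Suc.prems(1)] finite_nbrs[OF Suc.prems(1)] by (intro card_mono) (simp, blast)
  then show ?case using Suc.prems(2) unfolding alive_Suc[of E \<theta> _ v] by (rule le_trans[rotated])
qed simp

lemma alive_antimono: "finite E \<Longrightarrow> j \<le> k \<Longrightarrow> alive E \<theta> k v \<Longrightarrow> alive E \<theta> j v"
proof (induction "k - j" arbitrary: k)
  case (Suc d)
  then obtain k' where k: "k = Suc k'" by (cases k) auto
  have "alive E \<theta> k' v" using alive_antimono_Suc[of E \<theta> k' v] Suc.prems k by blast
  then show ?case using Suc.hyps(1)[of k'] Suc.hyps(2) Suc.prems(1,2) k by force
qed simp

lemma survives_iff_alive:
  assumes E: "finite E" "\<And>e. e \<in> E \<Longrightarrow> \<exists>u w. u \<noteq> w \<and> e = {u, w} \<and> u \<in> V \<and> w \<in> V"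
    and "v \<in> V"
  shows "survives cap (V, E) k v \<longleftrightarrow> alive E (\<lambda>v. Suc (cap v)) k v"
proof -
  let ?a = "alive E (\<lambda>v. Suc (cap v))"
  \<comment> \<open>The whole peeling state is tracked: after \<open>k\<close> rounds it is the
    subgraph induced by the vertices alive at round \<open>k\<close>. Degrees in it count alive
    neighbours, so the next round removes exactly the vertices that miss their threshold.\<close>
  have "(peel_step cap ^^ k) (V, E) = ({v \<in> V. ?a k v}, {e \<in> E. \<forall>v\<in>e. ?a k v})"
  proof (induction k)
    case (Suc k)
    have deg: "vertex_degree {e \<in> E. \<forall>v\<in>e. ?a k v} v = card {u \<in> nbrs E v. ?a k u}"
      if "?a k v" for v
    proof -
      have "bij_betw (\<lambda>u. {v, u}) {u \<in> nbrs E v. ?a k u} {e \<in> {e \<in> E. \<forall>v\<in>e. ?a k v}. v \<in> e}"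
        unfolding bij_betw_def
      proof
        show "inj_on (\<lambda>u. {v, u}) {u \<in> nbrs E v. ?a k u}"
          by (auto simp: inj_on_def doubleton_eq_iff)
        show "(\<lambda>u. {v, u}) ` {u \<in> nbrs E v. ?a k u} = {e \<in> {e \<in> E. \<forall>v\<in>e. ?a k v}. v \<in> e}"
        proof (intro equalityI subsetI)
          fix e assume e: "e \<in> {e \<in> {e \<in> E. \<forall>v\<in>e. ?a k v}. v \<in> e}"
          then obtain u w where "e = {u, w}" using E(2) by blast
          moreover have "v \<in> e" using e by simp
          ultimately obtain u' where "e = {v, u'}" by blast
          then show "e \<in> (\<lambda>u. {v, u}) ` {u \<in> nbrs E v. ?a k u}"
            using e by (auto simp: nbrs_def)
        qed (use that in \<open>auto simp: nbrs_def\<close>)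
      qed
      then show ?thesis unfolding vertex_degree_def by (simp add: bij_betw_same_card)
    qed
    have R: "{v \<in> {v \<in> V. ?a k v}. vertex_degree {e \<in> E. \<forall>v\<in>e. ?a k v} v \<le> cap v}
        = {v \<in> V. ?a k v \<and> \<not> ?a (Suc k) v}"
      using deg by (auto simp: alive_Suc)
    have anti: "?a (Suc k) v \<Longrightarrow> ?a k v" for v
      using alive_antimono_Suc[OF E(1)] by blast
    have V: "e \<in> E \<Longrightarrow> e \<subseteq> V" for e using E(2) by blast
    show ?case
    proof -
      have "(peel_step cap ^^ Suc k) (V, E)
          = peel_step cap ({v \<in> V. ?a k v}, {e \<in> E. \<forall>v\<in>e. ?a k v})"
        by (simp add: Suc.IH)
      also have "\<dots> = ({v \<in> V. ?a k v} - {v \<in> V. ?a k v \<and> \<not> ?a (Suc k) v},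
          {e \<in> {e \<in> E. \<forall>v\<in>e. ?a k v}. e \<inter> {v \<in> V. ?a k v \<and> \<not> ?a (Suc k) v} = {}})"
        unfolding peel_step_def Let_def prod.case R ..
      also have "\<dots> = ({v \<in> V. ?a (Suc k) v}, {e \<in> E. \<forall>v\<in>e. ?a (Suc k) v})"
        using anti V by (intro arg_cong2[of _ _ _ _ Pair]) blast+
      finally show ?thesis .
    qed
  qed simp
  then show ?thesis using \<open>v \<in> V\<close> by (simp add: survives_def)
qed

text \<open>As long as \<open>v\<close> is present, its neighbours behave as in the graph without \<open>v\<close> with their
  thresholds lowered by one; antitonicity in the number of rounds makes this exact.\<close>

lemma alive_cavity:
  fixes E :: "'v set set" and \<theta> :: "'v \<Rightarrow> nat" and v :: 'v
  assumes fin: "finite E" and loop: "{v} \<notin> E"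
  defines "E' \<equiv> {e \<in> E. v \<notin> e}"
    and "\<theta>' \<equiv> \<lambda>u. if u \<in> nbrs E v then \<theta> u - 1 else \<theta> u"
  shows "alive E \<theta> (Suc k) v \<longleftrightarrow> \<theta> v \<le> card {u \<in> nbrs E v. alive E' \<theta>' k u}"
proof -
  have fin': "finite E'" using fin by (simp add: E'_def)
  have \<theta>'_app: "\<theta>' u = (if u \<in> nbrs E v then \<theta> u - 1 else \<theta> u)" for u
    by (simp add: \<theta>'_def)
  have nv: "v \<notin> nbrs E v" using loop by (simp add: nbrs_def)
  have nb: "nbrs E' u = nbrs E u - {v}" if "u \<noteq> v" for u
    using that by (auto simp: nbrs_def E'_def)
  have nbv: "v \<in> nbrs E u \<longleftrightarrow> u \<in> nbrs E v" for u
    by (simp add: nbrs_def insert_commute)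
  have fn: "finite {w \<in> nbrs E u. P w}" "finite {w \<in> nbrs E' u. P w}" for u P
    using finite_nbrs[OF fin] finite_nbrs[OF fin'] by auto
  have split: "card {w \<in> nbrs E u. P w} =
      card {w \<in> nbrs E' u. P w} + (if u \<in> nbrs E v \<and> P v then 1 else 0)" if "u \<noteq> v" for u P
  proof (cases "u \<in> nbrs E v \<and> P v")
    case True
    then have "{w \<in> nbrs E u. P w} = insert v {w \<in> nbrs E' u. P w}"
      using nb[OF that] nbv[of u] by auto
    moreover have "v \<notin> {w \<in> nbrs E' u. P w}" using nb[OF that] by auto
    ultimately show ?thesis using True fn by simp
  next
    case False
    then have "{w \<in> nbrs E u. P w} = {w \<in> nbrs E' u. P w}"
      using nb[OF that] nbv[of u] by auto
    then show ?thesis using False by simp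
  qed
  \<comment> \<open>This direction holds at every round: the absence of \<open>v\<close> costs a
    vertex at most one neighbour, and only a vertex whose threshold was lowered too.\<close>
  have le: "alive E' \<theta>' j u" if "alive E \<theta> j u" "u \<noteq> v" for j u
    using that
  proof (induction j arbitrary: u)
    case (Suc j)
    have "card {w \<in> nbrs E' u. alive E \<theta> j w} \<le> card {w \<in> nbrs E' u. alive E' \<theta>' j w}"
      using Suc.IH nb[OF Suc.prems(2)] by (intro card_mono fn) auto
    then show ?case
      using Suc.prems split[OF Suc.prems(2), of "alive E \<theta> j"] by (auto simp: alive_Suc \<theta>'_app[of u] split: if_splits)
  qed simp
  show ?thesis
  proof
    assume "alive E \<theta> (Suc k) v"
    moreover have "card {u \<in> nbrs E v. alive E \<theta> k u} \<le> card {u \<in> nbrs E v. alive E' \<theta>' k u}"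
      using le nv by (intro card_mono fn) auto
    ultimately show "\<theta> v \<le> card {u \<in> nbrs E v. alive E' \<theta>' k u}" by (simp add: alive_Suc)
  next
    assume v: "\<theta> v \<le> card {u \<in> nbrs E v. alive E' \<theta>' k u}"
    \<comment> \<open>Both claims must be proved together. \<open>v\<close> being alive at round
      \<open>j\<close> makes up for the lowered thresholds of its neighbours; conversely the count
      assumed at round \<open>k\<close> bounds the count at the earlier round \<open>j\<close> by
      antitonicity, which keeps \<open>v\<close> alive.\<close>
    have "alive E \<theta> j v \<and> (\<forall>u. u \<noteq> v \<longrightarrow> alive E' \<theta>' j u \<longrightarrow> alive E \<theta> j u)" if "j \<le> k" for j
      using that
    proof (induction j)
      case (Suc j)
      then have IH: "alive E \<theta> j v" "\<And>u. u \<noteq> v \<Longrightarrow> alive E' \<theta>' j u \<Longrightarrow> alive E \<theta> j u"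
        by auto
      have "card {u \<in> nbrs E v. alive E' \<theta>' k u} \<le> card {u \<in> nbrs E v. alive E \<theta> j u}"
        using alive_antimono[OF fin', of j k \<theta>'] Suc.prems IH(2) nv by (intro card_mono fn) force
      then have "alive E \<theta> (Suc j) v" using v by (simp add: alive_Suc)
      moreover have "alive E \<theta> (Suc j) u" if u: "u \<noteq> v" "alive E' \<theta>' (Suc j) u" for u
      proof -
        have "card {w \<in> nbrs E' u. alive E' \<theta>' j w} \<le> card {w \<in> nbrs E' u. alive E \<theta> j w}"
          using IH(2) nb[OF u(1)] by (intro card_mono fn) auto
        then show ?thesis
          using u(2) split[OF u(1), of "alive E \<theta> j"] IH(1) by (auto simp: alive_Suc \<theta>'_app[of u] split: if_splits)
      qed
      ultimately show ?case by blast
    qed simp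
    then have k: "\<And>u. u \<noteq> v \<Longrightarrow> alive E' \<theta>' k u \<Longrightarrow> alive E \<theta> k u" by blast
    have "card {u \<in> nbrs E v. alive E' \<theta>' k u} \<le> card {u \<in> nbrs E v. alive E \<theta> k u}"
      using k nv by (intro card_mono fn) force
    then show "alive E \<theta> (Suc k) v" using v by (simp add: alive_Suc)
  qed
qed

subsection \<open>Range of influence\<close>

text \<open>Vertices reached from \<open>A\<close> by paths with fewer than \<open>k\<close> edges
  whose vertices before the last lie in \<open>H\<close>. Level 0 is empty because round 0 sees
  neither thresholds nor edges, so a change at \<open>A\<close> shows from round 1 on.\<close>

primrec infl :: "'v set \<Rightarrow> 'v set set \<Rightarrow> 'v set \<Rightarrow> nat \<Rightarrow> 'v set" where
  "infl H E A 0 = {}"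
| "infl H E A (Suc k) = A \<union> (\<Union>w \<in> infl H E A k \<inter> H. nbrs E w)"

lemma infl_singletons: "u \<in> infl H E A k \<Longrightarrow> \<exists>a\<in>A. u \<in> infl H E {a} k"
proof (induction k arbitrary: u)
  case (Suc k)
  show ?case
  proof (cases "u \<in> A")
    case False
    then obtain w where "w \<in> infl H E A k" "w \<in> H" "u \<in> nbrs E w" using Suc.prems by auto
    then show ?thesis using Suc.IH[of w] by auto
  qed auto
qed simp

text \<open>Each level multiplies by at most \<open>Suc D\<close> and adds \<open>A\<close> once
  more, which the base \<open>D + 2\<close> absorbs. The degree bound is \<open>Suc D\<close> to
  leave room for one additional edge in \<open>alive_trunc_edge_change\<close>.\<close>

lemma card_infl:
  assumes "finite E" "finite A" and H: "\<And>w. w \<in> H \<Longrightarrow> card (nbrs E w) \<le> Suc D"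
  shows "finite (infl H E A k) \<and> card (infl H E A k) \<le> card A * (D + 2) ^ k"
proof (induction k)
  case (Suc k)
  let ?I = "infl H E A k"
  have fin: "finite ?I" using Suc by simp
  have "card (\<Union>w \<in> ?I \<inter> H. nbrs E w) \<le> (\<Sum>w \<in> ?I \<inter> H. card (nbrs E w))"
    using fin by (intro card_UN_le) simp
  also have "\<dots> \<le> card (?I \<inter> H) * Suc D"
    using sum_bounded_above[of "?I \<inter> H" "\<lambda>w. card (nbrs E w)" "Suc D"] H by simp
  also have "\<dots> \<le> card ?I * Suc D"
    using fin by (intro mult_right_mono card_mono) auto
  also have "\<dots> \<le> card A * (D + 2) ^ k * Suc D"
    using Suc by (intro mult_right_mono) auto
  finally have "card (infl H E A (Suc k)) \<le> card A + card A * (D + 2) ^ k * Suc D"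
    using card_Un_le[of A "\<Union>w \<in> ?I \<inter> H. nbrs E w"] by simp
  also have "\<dots> \<le> card A * (D + 2) ^ k + card A * (D + 2) ^ k * Suc D"
    by simp
  also have "\<dots> = card A * (D + 2) ^ Suc k" by (simp add: algebra_simps)
  finally show ?case using fin assms finite_nbrs by auto
qed simp

text \<open>A discrepancy outside \<open>A\<close> needs a discrepancy at a neighbour one round
  earlier. A vertex outside \<open>H\<close> is dead in both systems from round 1 on and agrees at
  round 0, so it never passes a discrepancy on.\<close>

lemma alive_neq_infl:
  assumes agree: "\<And>u. u \<notin> A \<Longrightarrow> \<theta> u = \<theta>' u" "\<And>u. u \<notin> A \<Longrightarrow> nbrs E u = nbrs E' u"
    and H: "\<And>u j. u \<notin> H \<Longrightarrow> \<not> alive E \<theta> (Suc j) u" "\<And>u j. u \<notin> H \<Longrightarrow> \<not> alive E' \<theta>' (Suc j) u"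
    and "alive E \<theta> k u \<noteq> alive E' \<theta>' k u"
  shows "u \<in> infl H E' A k"
  using assms(5)
proof (induction k arbitrary: u)
  case (Suc k)
  show ?case
  proof (cases "u \<in> A")
    case False
    have "\<exists>w \<in> nbrs E' u. alive E \<theta> k w \<noteq> alive E' \<theta>' k w"
    proof (rule ccontr)
      assume "\<not> ?thesis"
      then have "{w \<in> nbrs E' u. alive E \<theta> k w} = {w \<in> nbrs E' u. alive E' \<theta>' k w}" by auto
      then show False using Suc.prems agree[OF False] by (simp add: alive_Suc)
    qed
    then obtain w where w: "w \<in> nbrs E' u" "alive E \<theta> k w \<noteq> alive E' \<theta>' k w" by blast
    have "w \<in> H" using w(2) H[of w] by (cases k) auto
    moreover have "u \<in> nbrs E' w" using w(1) by (simp add: nbrs_def insert_commute)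
    ultimately show ?thesis using Suc.IH[OF w(2)] by auto
  qed simp
qed simp

text \<open>A vertex of degree above \<open>D\<close> is given a threshold that it can never reach, so it
  transmits no influence.\<close>

definition trunc :: "nat \<Rightarrow> 'v set set \<Rightarrow> ('v \<Rightarrow> nat) \<Rightarrow> 'v \<Rightarrow> nat" where
  "trunc D E \<theta> v = (if card (nbrs E v) \<le> D then \<theta> v else Suc (card (nbrs E v)))"

lemma trunc_id: "(\<And>v. card (nbrs E v) \<le> D) \<Longrightarrow> trunc D E \<theta> = \<theta>"
  by (auto simp: trunc_def)

lemma not_alive_trunc:
  assumes "finite E" "card (nbrs E v) > D"
  shows "\<not> alive E (trunc D E \<theta>) (Suc k) v"
proof -
  have "card {u \<in> nbrs E v. alive E (trunc D E \<theta>) k u} \<le> card (nbrs E v)"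
    using finite_nbrs[OF assms(1)] by (intro card_mono) auto
  then show ?thesis using assms(2) by (simp add: alive_Suc trunc_def)
qed

lemma alive_trunc_cap_change:
  assumes "finite E" "\<And>u. u \<notin> A \<Longrightarrow> \<theta> u = \<theta>' u"
    and "alive E (trunc D E \<theta>) k u \<noteq> alive E (trunc D E \<theta>') k u"
  shows "u \<in> infl {w. card (nbrs E w) \<le> D} E A k"
proof (rule alive_neq_infl[OF _ refl _ _ assms(3)])
  show "trunc D E \<theta> w = trunc D E \<theta>' w" if "w \<notin> A" for w
    using assms(2)[OF that] by (simp add: trunc_def)
qed (auto intro!: not_alive_trunc[OF assms(1)])

text \<open>Adding an edge alters degrees, hence truncated thresholds, only at its endpoints, which
  seed the influence. The influence set does not depend on thresholds, so one bound serves all the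
  functions \<open>\<theta> u\<close> simultaneously.\<close>

lemma alive_trunc_edge_change:
  fixes E :: "'v set set" and \<theta> :: "'v \<Rightarrow> 'v \<Rightarrow> nat"
    and a b :: 'v and D k :: nat
  assumes fin: "finite E"
  defines "X \<equiv> {u. alive E (trunc D E (\<theta> u)) k u \<noteq>
                  alive (insert {a, b} E) (trunc D (insert {a, b} E) (\<theta> u)) k u}"
  shows "finite X \<and> card X \<le> 2 * (D + 2) ^ k"
proof -
  let ?E = "insert {a, b} E"
  let ?H = "{w. card (nbrs ?E w) \<le> Suc D}"
  have fin': "finite ?E" using fin by simp
  have nb: "nbrs E u = nbrs ?E u" if "u \<notin> {a, b}" for u
    using that by (auto simp: nbrs_def doubleton_eq_iff)
  have deg: "card (nbrs ?E u) \<le> Suc (card (nbrs E u))" for u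
  proof (cases "u \<in> {a, b}")
    case True
    have "nbrs ?E u \<subseteq> insert (if u = a then b else a) (nbrs E u)"
      using True by (auto simp: nbrs_def doubleton_eq_iff)
    then have "card (nbrs ?E u) \<le> card (insert (if u = a then b else a) (nbrs E u))"
      using finite_nbrs[OF fin] by (intro card_mono) auto
    then show ?thesis using finite_nbrs[OF fin, of u] by (simp add: card_insert_if split: if_splits)
  qed (use nb in auto)
  have "X \<subseteq> infl ?H ?E {a, b} k" unfolding X_def
  proof
    fix u assume "u \<in> {u. alive E (trunc D E (\<theta> u)) k u \<noteq> alive ?E (trunc D ?E (\<theta> u)) k u}"
    then have u: "alive E (trunc D E (\<theta> u)) k u \<noteq> alive ?E (trunc D ?E (\<theta> u)) k u" by simp
    show "u \<in> infl ?H ?E {a, b} k"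
    proof (rule alive_neq_infl[OF _ nb _ _ u])
      \<comment> \<open>A degree above \<open>Suc D\<close> with the new edge is a degree above
        \<open>D\<close> without it, so \<open>w\<close> is cut off by the truncation in both
        graphs.\<close>
      fix w j assume w: "w \<notin> ?H"
      then show "\<not> alive E (trunc D E (\<theta> u)) (Suc j) w"
        using deg[of w] by (intro not_alive_trunc fin) auto
      show "\<not> alive ?E (trunc D ?E (\<theta> u)) (Suc j) w"
        using w by (intro not_alive_trunc fin') auto
    qed (auto simp: trunc_def nb)
  qed
  moreover have "finite (infl ?H ?E {a, b} k) \<and>
      card (infl ?H ?E {a, b} k) \<le> card {a, b} * (D + 2) ^ k"
    using fin' by (intro card_infl) auto
  moreover have "card {a, b} \<le> 2" by (simp add: card_insert_if)
  ultimately show ?thesis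
    using card_mono[of "infl ?H ?E {a, b} k" X] mult_le_mono1[of "card {a, b}" 2 "(D + 2) ^ k"]
      finite_subset[of X "infl ?H ?E {a, b} k"] by (meson le_trans)
qed

text \<open>Edges are added one at a time, with the truncation recomputed for each intermediate
  graph.\<close>

lemma alive_trunc_edges_change:
  fixes E F :: "'v set set" and \<theta> :: "'v \<Rightarrow> 'v \<Rightarrow> nat"
    and D k :: nat
  assumes "finite E" "finite F" "\<And>e. e \<in> F \<Longrightarrow> \<exists>a b. e = {a, b}"
  defines "X \<equiv> \<lambda>F. {u. alive E (trunc D E (\<theta> u)) k u \<noteq> alive (E \<union> F) (trunc D (E \<union> F) (\<theta> u)) k u}"
  shows "finite (X F) \<and> card (X F) \<le> card F * (2 * (D + 2) ^ k)"
  using assms(2,3)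
proof (induction F rule: finite_induct)
  case empty
  then show ?case by (simp add: X_def)
next
  case (insert e F)
  let ?E = "E \<union> F"
  define Y where "Y = {u. alive ?E (trunc D ?E (\<theta> u)) k u \<noteq>
    alive (insert e ?E) (trunc D (insert e ?E) (\<theta> u)) k u}"
  obtain a b where e: "e = {a, b}" using insert.prems by blast
  have Y: "finite Y \<and> card Y \<le> 2 * (D + 2) ^ k"
    unfolding Y_def e using assms(1) insert.hyps by (intro alive_trunc_edge_change) auto
  have IH: "finite (X F) \<and> card (X F) \<le> card F * (2 * (D + 2) ^ k)"
    using insert by auto
  have "X (insert e F) \<subseteq> X F \<union> Y" by (auto simp: X_def Y_def)
  moreover have "card (X F \<union> Y) \<le> card (insert e F) * (2 * (D + 2) ^ k)"
    using card_Un_le[of "X F" Y] IH Y insert.hyps by simp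
  ultimately show ?case
    using IH Y by (meson card_mono finite_Un finite_subset le_trans)
qed

lemma infl_isolated: "nbrs E v = {} \<Longrightarrow> infl H E {v} k \<subseteq> {v}"
  by (induction k) auto

subsection \<open>Concentration for functions of independent bits\<close>

lemma finite_set_Pi_pmf_bool:
  "finite A \<Longrightarrow> finite (set_pmf (Pi_pmf A (d :: bool) q))"
  by (rule finite_subset[OF set_Pi_pmf_subset'], assumption) (auto intro: finite_PiE_dflt)

lemma integrable_Pi_pmf_bool [intro, simp]:
  fixes f :: "_ \<Rightarrow> real"
  shows "finite A \<Longrightarrow> integrable (measure_pmf (Pi_pmf A (d :: bool) q)) f"
  by (intro integrable_measure_pmf_finite finite_set_Pi_pmf_bool)

lemma expectation_Pi_pmf_insert:
  fixes f :: "('a \<Rightarrow> bool) \<Rightarrow> real"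
  assumes "finite A" "e \<notin> A" "0 \<le> p" "p \<le> 1"
  shows "measure_pmf.expectation (Pi_pmf (insert e A) False (\<lambda>_. bernoulli_pmf p)) f
       = measure_pmf.expectation (Pi_pmf A False (\<lambda>_. bernoulli_pmf p))
           (\<lambda>x. p * f (x(e := True)) + (1 - p) * f (x(e := False)))"
proof -
  let ?P = "Pi_pmf A False (\<lambda>_. bernoulli_pmf p)"
  have eq: "Pi_pmf (insert e A) False (\<lambda>_. bernoulli_pmf p)
      = bind_pmf ?P (\<lambda>x. map_pmf (\<lambda>b. x(e := b)) (bernoulli_pmf p))"
    using assms by (subst Pi_pmf_insert)
      (auto simp: map_pmf_def pair_pmf_def bind_assoc_pmf bind_return_pmf intro: bind_commute_pmf)
  show ?thesis unfolding eq
    using assms by (subst pmf_expectation_bind[where A = "set_pmf ?P"])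
      (auto simp: finite_set_Pi_pmf_bool integral_measure_pmf_real[OF finite_set_Pi_pmf_bool, of A]
        integral_map_pmf sum_distrib_left sum.distrib sum_subtractf algebra_simps)
qed

lemma exp_le_quadratic:
  fixes x :: real
  assumes "\<bar>x\<bar> \<le> 1"
  shows "exp x \<le> 1 + x + x\<^sup>2"
proof (cases "x \<ge> 0")
  case True
  then show ?thesis using exp_bound assms by simp
next
  case False
  define y where "y = - x"
  have y: "y > 0" using False by (simp add: y_def)
  have "exp (- y) \<le> 1 / (1 + y)"
    using exp_ge_add_one_self[of y] y by (simp add: exp_minus divide_simps)
  also have "\<dots> \<le> 1 - y + y\<^sup>2"
  proof -
    have "(1 + y) * (1 - y + y\<^sup>2) = 1 + y ^ 3" by (simp add: algebra_simps power2_eq_square power3_eq_cube)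
    then show ?thesis using y by (simp add: divide_simps mult.commute)
  qed
  finally show ?thesis by (simp add: y_def)
qed

text \<open>The point is the factor \<open>p\<close> in the exponent, which comes from the variance
  \<open>p * (1 - p) * d\<^sup>2\<close> of one bit. With about n^2 bits and
  \<open>p = c / n\<close> the total exponent is of order n; Hoeffding's bound, which ignores the
  variance, would give order n^2. The condition \<open>\<bar>s\<bar> * B \<le> 1\<close> permits the
  quadratic bound on \<open>exp\<close>.\<close>

lemma bernoulli_mgf_bound:
  fixes a b p B s :: real
  assumes "0 \<le> p" "p \<le> 1" "\<bar>a - b\<bar> \<le> B" "\<bar>s\<bar> * B \<le> 1"
  defines "m \<equiv> p * a + (1 - p) * b"
  shows "p * exp (s * (a - m)) + (1 - p) * exp (s * (b - m)) \<le> exp (p * s\<^sup>2 * B\<^sup>2)"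
proof -
  define d where "d = a - b"
  have am: "a - m = (1 - p) * d" and bm: "b - m = - p * d"
    by (simp_all add: m_def d_def algebra_simps)
  have sd: "\<bar>s * d\<bar> \<le> 1"
    using assms(3,4) mult_left_mono[of "\<bar>d\<bar>" B "\<bar>s\<bar>"] by (simp add: d_def abs_mult)
  have "\<bar>s * (a - m)\<bar> \<le> 1" "\<bar>s * (b - m)\<bar> \<le> 1"
    using mult_mono[of "\<bar>s * d\<bar>" 1 "1 - p" 1] mult_mono[of "\<bar>s * d\<bar>" 1 p 1] sd assms(1,2)
    by (simp_all add: am bm abs_mult mult_ac)
  then have "p * exp (s * (a - m)) + (1 - p) * exp (s * (b - m))
      \<le> p * (1 + s * (a - m) + (s * (a - m))\<^sup>2) + (1 - p) * (1 + s * (b - m) + (s * (b - m))\<^sup>2)"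
    using assms(1,2) by (intro add_mono mult_left_mono exp_le_quadratic) auto
  also have "\<dots> = 1 + p * (s\<^sup>2 * d\<^sup>2) * (1 - p)"
    unfolding am bm by (simp add: algebra_simps power2_eq_square)
  also have "\<dots> \<le> 1 + p * (s\<^sup>2 * d\<^sup>2)"
    using assms(1,2) by (intro add_left_mono mult_left_le) auto
  also have "\<dots> \<le> 1 + p * s\<^sup>2 * B\<^sup>2"
    using assms(1,3) abs_le_square_iff[of d B] by (auto simp: d_def mult.assoc intro!: mult_left_mono)
  also have "\<dots> \<le> exp (p * s\<^sup>2 * B\<^sup>2)" by (rule exp_ge_add_one_self)
  finally show ?thesis .
qed

text \<open>A martingale argument by induction on the set of bits: averaging over one bit turns
  \<open>f\<close> into \<open>F\<close>, which has the same mean and inherits the bounded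
  differences. The sign of \<open>s\<close> is free so that both tails can be treated.\<close>

lemma bounded_differences_mgf:
  fixes f :: "('a \<Rightarrow> bool) \<Rightarrow> real"
  assumes "finite A" "0 \<le> p" "p \<le> 1" "\<bar>s\<bar> * B \<le> 1"
    and "\<And>x e. e \<in> A \<Longrightarrow> \<bar>f (x(e := True)) - f (x(e := False))\<bar> \<le> B"
  defines "P \<equiv> \<lambda>A. Pi_pmf A False (\<lambda>_. bernoulli_pmf p)"
  shows "measure_pmf.expectation (P A) (\<lambda>x. exp (s * (f x - measure_pmf.expectation (P A) f)))
           \<le> exp (real (card A) * (p * s\<^sup>2 * B\<^sup>2))"
  using assms(1,5)
proof (induction A arbitrary: f rule: finite_induct)
  case empty
  then show ?case by (simp add: P_def)
next
  case (insert e A)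
  define F where "F x = p * f (x(e := True)) + (1 - p) * f (x(e := False))" for x
  define \<mu> where "\<mu> = measure_pmf.expectation (P (insert e A)) f"
  have E: "measure_pmf.expectation (P (insert e A)) g = measure_pmf.expectation (P A)
      (\<lambda>x. p * g (x(e := True)) + (1 - p) * g (x(e := False)))" for g :: "_ \<Rightarrow> real"
    unfolding P_def using insert.hyps assms(2,3) by (intro expectation_Pi_pmf_insert)
  have \<mu>: "\<mu> = measure_pmf.expectation (P A) F"
    unfolding \<mu>_def E F_def ..
  have int: "integrable (measure_pmf (P A)) g" for g :: "_ \<Rightarrow> real"
    unfolding P_def using insert.hyps by auto
  have F: "\<bar>F (x(e' := True)) - F (x(e' := False))\<bar> \<le> B" if "e' \<in> A" for x e'
  proof -
    have ne: "e \<noteq> e'" using insert.hyps that by auto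
    have 1: "\<bar>f (x(e' := True, e := b)) - f (x(e' := False, e := b))\<bar> \<le> B" for b
      using insert.prems[of e' "x(e := b)"] that
      by (simp only: fun_upd_twist[OF ne] insertI2)
    have "F (x(e' := True)) - F (x(e' := False))
        = p * (f (x(e' := True, e := True)) - f (x(e' := False, e := True)))
        + (1 - p) * (f (x(e' := True, e := False)) - f (x(e' := False, e := False)))"
      by (simp add: F_def algebra_simps)
    also have "\<bar>\<dots>\<bar> \<le> p * B + (1 - p) * B"
      using 1 assms(2,3)
      by (intro order_trans[OF abs_triangle_ineq] add_mono) (auto simp: abs_mult intro!: mult_left_mono)
    finally show ?thesis by (simp add: algebra_simps)
  qed
  \<comment> \<open>Split \<open>f x - \<mu>\<close> into \<open>F x - \<mu>\<close> and the
    fluctuation of the single bit \<open>e\<close>, whose conditional moment is bounded uniformly in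
    the other bits.\<close>
  have "measure_pmf.expectation (P (insert e A)) (\<lambda>x. exp (s * (f x - \<mu>)))
      = measure_pmf.expectation (P A) (\<lambda>x. exp (s * (F x - \<mu>)) *
          (p * exp (s * (f (x(e := True)) - F x)) + (1 - p) * exp (s * (f (x(e := False)) - F x))))"
    unfolding E by (rule arg_cong[where f = "measure_pmf.expectation _"])
      (auto simp: fun_eq_iff algebra_simps simp flip: exp_add)
  also have "\<dots> \<le> measure_pmf.expectation (P A) (\<lambda>x. exp (s * (F x - \<mu>)) * exp (p * s\<^sup>2 * B\<^sup>2))"
    using insert.prems[OF insertI1] assms(2-4) unfolding F_def
    by (intro integral_mono int mult_left_mono bernoulli_mgf_bound) (auto simp del: fun_upd_apply)
  also have "\<dots> = measure_pmf.expectation (P A) (\<lambda>x. exp (s * (F x - \<mu>))) * exp (p * s\<^sup>2 * B\<^sup>2)"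
    by simp
  also have "\<dots> \<le> exp (real (card A) * (p * s\<^sup>2 * B\<^sup>2)) * exp (p * s\<^sup>2 * B\<^sup>2)"
    unfolding \<mu> by (intro mult_right_mono insert.IH F) auto
  also have "\<dots> = exp (real (card (insert e A)) * (p * s\<^sup>2 * B\<^sup>2))"
    using insert.hyps by (simp add: algebra_simps flip: exp_add)
  finally show ?case unfolding \<mu>_def .
qed

text \<open>Exponential Markov inequality at \<open>s\<close> and at \<open>- s\<close>; the
  optimisation over \<open>s\<close> is left to the applications.\<close>

lemma bounded_differences_tail:
  fixes f :: "('a \<Rightarrow> bool) \<Rightarrow> real"
  assumes "finite A" "0 \<le> p" "p \<le> 1" "0 \<le> s" "s * B \<le> 1"
    and "\<And>x e. e \<in> A \<Longrightarrow> \<bar>f (x(e := True)) - f (x(e := False))\<bar> \<le> B"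
  defines "P \<equiv> Pi_pmf A False (\<lambda>_. bernoulli_pmf p)"
  shows "measure_pmf.prob P {x. \<bar>f x - measure_pmf.expectation P f\<bar> > t}
           \<le> 2 * exp (real (card A) * (p * s\<^sup>2 * B\<^sup>2) - s * t)"
proof -
  let ?\<mu> = "measure_pmf.expectation P f"
  have int: "integrable (measure_pmf P) g" for g :: "_ \<Rightarrow> real"
    unfolding P_def using assms by auto
  have "measure_pmf.prob P {x. \<bar>f x - ?\<mu>\<bar> > t} =
      measure_pmf.expectation P (indicator {x. \<bar>f x - ?\<mu>\<bar> > t})"
    by simp
  also have "\<dots> \<le> measure_pmf.expectation P (\<lambda>x. exp (- s * t) * exp (s * (f x - ?\<mu>))
      + exp (- s * t) * exp ((- s) * (f x - ?\<mu>)))"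
  proof (intro integral_mono int)
    fix x
    show "indicator {x. \<bar>f x - ?\<mu>\<bar> > t} x \<le> exp (- s * t) * exp (s * (f x - ?\<mu>))
      + exp (- s * t) * exp ((- s) * (f x - ?\<mu>))"
    proof (cases "\<bar>f x - ?\<mu>\<bar> > t")
      case True
      then have "f x - ?\<mu> > t \<or> - (f x - ?\<mu>) > t" by linarith
      then have "s * t \<le> s * (f x - ?\<mu>) \<or> s * t \<le> s * (- (f x - ?\<mu>))"
        using assms(4) by (meson less_imp_le mult_left_mono)
      then have "0 \<le> - s * t + s * (f x - ?\<mu>) \<or> 0 \<le> - s * t + (- s) * (f x - ?\<mu>)"
        by (auto simp: algebra_simps)
      then have "1 \<le> exp (- s * t + s * (f x - ?\<mu>)) \<or> 1 \<le> exp (- s * t + (- s) * (f x - ?\<mu>))"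
        by (simp only: one_le_exp_iff)
      then show ?thesis using True
        unfolding exp_add by (auto intro: add_increasing add_increasing2)
    qed (simp add: add_nonneg_nonneg)
  qed
  also have "\<dots> = exp (- s * t) * measure_pmf.expectation P (\<lambda>x. exp (s * (f x - ?\<mu>)))
      + exp (- s * t) * measure_pmf.expectation P (\<lambda>x. exp ((- s) * (f x - ?\<mu>)))"
    by (subst Bochner_Integration.integral_add[OF int int]) simp
  also have "\<dots> \<le> exp (- s * t) * exp (real (card A) * (p * s\<^sup>2 * B\<^sup>2))
      + exp (- s * t) * exp (real (card A) * (p * (- s)\<^sup>2 * B\<^sup>2))"
    unfolding P_def using assms(1-6)
    by (intro add_mono mult_left_mono bounded_differences_mgf) auto
  also have "\<dots> = 2 * exp (real (card A) * (p * s\<^sup>2 * B\<^sup>2) - s * t)"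
    by (simp add: exp_diff exp_minus field_simps)
  finally show ?thesis .
qed

text \<open>Chernoff bound with exponential parameter 1: a bit contributes
  \<open>1 + p * (exp 1 - 1)\<close>, and the constant 2 stems from
  \<open>exp 1 \<le> 3\<close>.\<close>

lemma card_bits_tail:
  assumes "finite A" "S \<subseteq> A" "0 \<le> p" "p \<le> 1"
  shows "measure_pmf.prob (Pi_pmf A False (\<lambda>_. bernoulli_pmf p)) {x. card {e \<in> S. x e} > D}
           \<le> exp (2 * p * real (card S) - real D)"
proof -
  let ?P = "Pi_pmf A False (\<lambda>_. bernoulli_pmf p)"
  let ?g = "\<lambda>e b. if e \<in> S \<and> b then exp 1 else (1 :: real)"
  have S: "finite S" using assms finite_subset by blast
  have prod: "(\<Prod>e\<in>A. ?g e (x e)) = exp (real (card {e \<in> S. x e}))" for x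
  proof -
    have "(\<Prod>e\<in>A. ?g e (x e)) = (\<Prod>e\<in>{e \<in> A. e \<in> S \<and> x e}. exp 1)"
      using assms(1) by (subst prod.inter_filter) auto
    also have "{e \<in> A. e \<in> S \<and> x e} = {e \<in> S. x e}" using assms(2) by auto
    finally show ?thesis by (simp flip: exp_of_nat_mult)
  qed
  have "measure_pmf.prob ?P {x. card {e \<in> S. x e} > D} =
      measure_pmf.expectation ?P (indicator {x. card {e \<in> S. x e} > D})"
    by simp
  also have "\<dots> \<le> measure_pmf.expectation ?P (\<lambda>x. exp (- real D) * (\<Prod>e\<in>A. ?g e (x e)))"
    unfolding prod using assms(1)
    by (intro integral_mono integrable_Pi_pmf_bool) (auto simp: indicator_def simp flip: exp_add)
  also have "\<dots> = exp (- real D) * (\<Prod>e\<in>A. measure_pmf.expectation (bernoulli_pmf p) (?g e))"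
    using assms(1) by (subst integral_mult_right_zero, subst expectation_prod_Pi_pmf)
      (auto intro!: integrable_measure_pmf_finite)
  also have "(\<Prod>e\<in>A. measure_pmf.expectation (bernoulli_pmf p) (?g e))
      = (\<Prod>e\<in>A. if e \<in> S then 1 + p * (exp 1 - 1) else 1)"
    using assms(3,4) by (intro prod.cong) (auto simp: algebra_simps)
  also have "\<dots> = (\<Prod>e\<in>{e \<in> A. e \<in> S}. 1 + p * (exp 1 - 1))"
    using assms(1) by (subst prod.inter_filter) auto
  also have "{e \<in> A. e \<in> S} = S" using assms(2) by auto
  also have "(\<Prod>e\<in>S. 1 + p * (exp 1 - 1)) \<le> (\<Prod>e\<in>S. exp (2 * p))"
  proof (intro prod_mono conjI)
    have "p * (exp 1 - 1) \<le> p * 2"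
      using exp_le assms(3) by (intro mult_left_mono) auto
    then show "1 + p * (exp 1 - 1) \<le> exp (2 * p)"
      using exp_ge_add_one_self[of "2 * p"] by linarith
    show "0 \<le> 1 + p * (exp 1 - 1)"
      using assms(3) by (intro add_nonneg_nonneg mult_nonneg_nonneg) auto
  qed
  also have "(\<Prod>e\<in>S. exp (2 * p)) = exp (2 * p * real (card S))"
    by (simp add: mult.commute flip: exp_of_nat_mult)
  finally show ?thesis by (simp add: exp_diff exp_minus field_simps)
qed

subsection \<open>Poisson approximation\<close>

lemma measure_bind_pmf:
  "measure_pmf.prob (bind_pmf M N) A = measure_pmf.expectation M (\<lambda>x. measure_pmf.prob (N x) A)"
proof -
  have "ennreal (measure_pmf.prob (bind_pmf M N) A) = (\<integral>\<^sup>+x. ennreal (measure_pmf.prob (N x) A) \<partial>M)"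
    by (simp flip: measure_pmf.emeasure_eq_measure)
  also have "\<dots> = ennreal (measure_pmf.expectation M (\<lambda>x. measure_pmf.prob (N x) A))"
    by (intro nn_integral_eq_integral measure_pmf.integrable_const_bound[where B = 1]) auto
  finally show ?thesis by (simp add: integral_nonneg_AE)
qed

lemma pmf_poisson_nonneg: "r \<ge> 0 \<Longrightarrow> pmf (poisson r) j = r ^ j / fact j * exp (- r)"
  by (auto simp: poisson_def indicator_def power_0_left)

text \<open>The probability of a value strictly below \<open>r\<close>, complementary to reaching a
  threshold \<open>r\<close>. It is an explicit function of every real \<open>x\<close>, so that it
  can be differentiated; the link with \<open>poisson\<close> is made for \<open>x \<ge> 0\<close>
  in \<open>prob_poisson_less\<close>.\<close>

definition poisson_cdf :: "nat \<Rightarrow> real \<Rightarrow> real" where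
  "poisson_cdf r x = (\<Sum>j<r. x ^ j / fact j * exp (- x))"

lemma prob_poisson_less:
  assumes "x \<ge> 0"
  shows "measure_pmf.prob (poisson x) {..<r} = poisson_cdf r x"
proof -
  have "measure_pmf.prob (poisson x) {..<r} = (\<Sum>j<r. pmf (poisson x) j)"
    by (simp add: measure_measure_pmf_finite)
  also have "\<dots> = poisson_cdf r x"
    unfolding poisson_cdf_def using assms
    by (intro sum.cong refl) (simp add: pmf_poisson_nonneg)
  finally show ?thesis .
qed

text \<open>The tail of the binomial law follows the Euler scheme of this system of differential
  equations, which gives the Poisson limit with an error bound.\<close>

lemma poisson_cdf_deriv:
  "(poisson_cdf r has_real_derivative (case r of 0 \<Rightarrow> 0 | Suc s \<Rightarrow> poisson_cdf s x - poisson_cdf r x)) (at x)"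
proof (induction r)
  case 0
  have "poisson_cdf 0 = (\<lambda>_. 0)" by (auto simp: poisson_cdf_def)
  then show ?case by simp
next
  case (Suc r)
  have eq: "poisson_cdf (Suc r) = (\<lambda>x. poisson_cdf r x + x ^ r / fact r * exp (- x))"
    by (simp add: poisson_cdf_def fun_eq_iff)
  have "((\<lambda>x. poisson_cdf r x + x ^ r / fact r * exp (- x)) has_real_derivative
      (case r of 0 \<Rightarrow> 0 | Suc s \<Rightarrow> poisson_cdf s x - poisson_cdf r x)
        + (of_nat r * x ^ (r - 1) / fact r * exp (- x) - x ^ r / fact r * exp (- x))) (at x)"
    by (auto intro!: derivative_eq_intros Suc.IH simp: field_simps)
  also have "(case r of 0 \<Rightarrow> 0 | Suc s \<Rightarrow> poisson_cdf s x - poisson_cdf r x)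
        + (of_nat r * x ^ (r - 1) / fact r * exp (- x) - x ^ r / fact r * exp (- x))
      = poisson_cdf r x - poisson_cdf (Suc r) x"
  proof (cases r)
    case (Suc s)
    have "real (Suc s) * x ^ s / fact (Suc s) = x ^ s / fact s"
      by (simp add: fact_Suc divide_simps)
    then show ?thesis by (simp add: Suc poisson_cdf_def)
  qed (simp add: poisson_cdf_def)
  finally show ?case unfolding eq by simp
qed

lemma poisson_cdf_bounds:
  assumes "x \<ge> 0"
  shows "0 \<le> poisson_cdf r x" "poisson_cdf r x \<le> 1"
  by (simp_all flip: prob_poisson_less[OF assms])

text \<open>The derivative is a difference of two probabilities, hence bounded by 1 in absolute
  value.\<close>

lemma poisson_cdf_lipschitz:
  assumes "x \<ge> 0" "y \<ge> 0"
  shows "\<bar>poisson_cdf r x - poisson_cdf r y\<bar> \<le> \<bar>x - y\<bar>"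
proof -
  have "\<bar>poisson_cdf r a - poisson_cdf r b\<bar> \<le> \<bar>a - b\<bar>" if "0 \<le> b" "b < a" for a b
  proof -
    obtain z where z: "b < z" "poisson_cdf r a - poisson_cdf r b
        = (a - b) * (case r of 0 \<Rightarrow> 0 | Suc s \<Rightarrow> poisson_cdf s z - poisson_cdf r z)"
      using MVT2[OF \<open>b < a\<close> poisson_cdf_deriv] by blast
    have "\<bar>case r of 0 \<Rightarrow> 0 | Suc s \<Rightarrow> poisson_cdf s z - poisson_cdf r z\<bar> \<le> 1"
      using poisson_cdf_bounds[of z r] poisson_cdf_bounds[of z "r - 1"] z(1) \<open>0 \<le> b\<close>
      by (auto split: nat.split)
    then show ?thesis unfolding z(2) abs_mult by (intro mult_left_le) auto
  qed
  from this[of x y] this[of y x] assms show ?thesis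
    by (cases x y rule: linorder_cases) (auto simp: abs_minus_commute)
qed

text \<open>By the mean value theorem the error is \<open>p\<close> times the change of the
  derivative over a distance at most \<open>p\<close>; the derivative is a difference of two
  1-Lipschitz functions, whence the 2.\<close>

lemma poisson_cdf_step:
  assumes "x \<ge> 0" "p \<ge> 0"
  shows "\<bar>poisson_cdf (Suc r) (x + p) - ((1 - p) * poisson_cdf (Suc r) x + p * poisson_cdf r x)\<bar> \<le> 2 * p\<^sup>2"
proof (cases "p = 0")
  case False
  then have "x < x + p" using assms by simp
  then obtain z where z: "x < z" "z < x + p" "poisson_cdf (Suc r) (x + p) - poisson_cdf (Suc r) x
        = (x + p - x) * (poisson_cdf r z - poisson_cdf (Suc r) z)"
    using MVT2[OF _ poisson_cdf_deriv[of "Suc r", simplified]] by blast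
  have "poisson_cdf (Suc r) (x + p) - ((1 - p) * poisson_cdf (Suc r) x + p * poisson_cdf r x)
      = p * ((poisson_cdf r z - poisson_cdf r x) - (poisson_cdf (Suc r) z - poisson_cdf (Suc r) x))"
    using z(3) by (simp add: algebra_simps)
  also have "\<bar>\<dots>\<bar> \<le> p * (2 * p)"
    using poisson_cdf_lipschitz[of z x r] poisson_cdf_lipschitz[of z x "Suc r"] z(1,2) assms
    unfolding abs_mult by (intro mult_mono) auto
  finally show ?thesis by (simp add: power2_eq_square mult_ac)
qed simp

text \<open>One more trial replaces the tails by a convex combination, which does not enlarge the
  error already made, and one Euler step adds \<open>2 * p\<^sup>2\<close>.\<close>

lemma binomial_poisson_approx:
  assumes "0 \<le> p" "p \<le> 1"
  shows "\<bar>measure_pmf.prob (binomial_pmf m p) {..<r} - poisson_cdf r (real m * p)\<bar> \<le> 2 * real m * p\<^sup>2"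
proof (induction m arbitrary: r)
  case 0
  show ?case using prob_poisson_less[of 0 r] assms by (simp add: poisson_def binomial_pmf_0)
next
  case (Suc m)
  show ?case
  proof (cases r)
    case 0
    then show ?thesis by (simp add: poisson_cdf_def)
  next
    case (Suc s)
    let ?b = "\<lambda>r. measure_pmf.prob (binomial_pmf m p) {..<r}"
    have "measure_pmf.prob (binomial_pmf (Suc m) p) {..<r}
        = measure_pmf.expectation (bernoulli_pmf p) (\<lambda>b. if b then ?b s else ?b r)"
    proof -
      have "(+) 0 -` {..<r} = {..<r}" "(+) (Suc 0) -` {..<r} = {..<s}" using Suc by auto
      then show ?thesis using assms
        by (simp add: binomial_pmf_Suc measure_bind_pmf map_pmf_def[symmetric] if_distrib
            cong: if_cong)
    qed
    also have "\<dots> = (1 - p) * ?b r + p * ?b s" using assms by simp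
    finally have eq: "measure_pmf.prob (binomial_pmf (Suc m) p) {..<r} = (1 - p) * ?b r + p * ?b s" .
    let ?x = "real m * p"
    have "\<bar>(1 - p) * (?b r - poisson_cdf r ?x) + p * (?b s - poisson_cdf s ?x)\<bar>
        \<le> (1 - p) * (2 * real m * p\<^sup>2) + p * (2 * real m * p\<^sup>2)"
      using assms Suc.IH by (intro order_trans[OF abs_triangle_ineq] add_mono)
        (auto simp: abs_mult intro!: mult_left_mono)
    moreover have "\<bar>poisson_cdf r (?x + p) - ((1 - p) * poisson_cdf r ?x + p * poisson_cdf s ?x)\<bar> \<le> 2 * p\<^sup>2"
      unfolding Suc using assms by (intro poisson_cdf_step) auto
    ultimately show ?thesis unfolding eq
      by (simp add: algebra_simps abs_le_iff)
  qed
qed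

subsection \<open>Thinning and superposition\<close>

lemma poisson_thinning:
  assumes "a \<ge> 0" "0 \<le> q" "q \<le> 1"
  shows "bind_pmf (poisson a) (\<lambda>n. binomial_pmf n q) = poisson (a * q)"
proof -
  \<comment> \<open>The joint law is compared instead of the marginal: the retained and the
    discarded points are independent Poisson variables, and then the masses agree pointwise.\<close>
  let ?L = "bind_pmf (poisson a) (\<lambda>n. map_pmf (Pair n) (binomial_pmf n q))"
  let ?R = "map_pmf (\<lambda>(i, j). (i + j, i)) (pair_pmf (poisson (a * q)) (poisson (a * (1 - q))))"
  have pois: "pmf (poisson a) (i + j) * pmf (binomial_pmf (i + j) q) i
      = pmf (poisson (a * q)) i * pmf (poisson (a * (1 - q))) j" for i j
  proof -
    have "real ((i + j) choose i) = fact (i + j) / (fact i * fact j)"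
      by (simp add: binomial_fact)
    then have "pmf (poisson a) (i + j) * pmf (binomial_pmf (i + j) q) i
        = exp (- a) * ((a * q) ^ i / fact i) * ((a * (1 - q)) ^ j / fact j)"
      using assms by (simp add: pmf_poisson_nonneg power_mult_distrib power_add)
    also have "exp (- a) = exp (- (a * q)) * exp (- (a * (1 - q)))"
      by (simp add: algebra_simps flip: exp_add)
    also have "exp (- (a * q)) * exp (- (a * (1 - q))) * ((a * q) ^ i / fact i) * ((a * (1 - q)) ^ j / fact j)
        = pmf (poisson (a * q)) i * pmf (poisson (a * (1 - q))) j"
      using pmf_poisson_nonneg[of "a * q"] pmf_poisson_nonneg[of "a * (1 - q)"] assms by simp
    finally show ?thesis .
  qed
  have "?L = ?R"
  proof (rule pmf_eqI)
    fix x :: "nat \<times> nat"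
    obtain n k where x: "x = (n, k)" by force
    have "pmf ?L x = measure_pmf.expectation (poisson a)
        (\<lambda>m. indicator {n} m * pmf (binomial_pmf n q) k)"
      unfolding pmf_bind x
    proof (intro Bochner_Integration.integral_cong refl)
      fix m
      show "pmf (map_pmf (Pair m) (binomial_pmf m q)) (n, k)
          = indicator {n} m * pmf (binomial_pmf n q) k"
        using pmf_map_inj'[of "Pair n" "binomial_pmf n q" k]
        by (cases "m = n") (auto simp: inj_on_def pmf_eq_0_set_pmf)
    qed
    also have "\<dots> = pmf (poisson a) n * pmf (binomial_pmf n q) k"
      by (simp add: measure_pmf_single)
    also have "\<dots> = pmf ?R x"
    proof (cases "k \<le> n")
      case True
      then obtain j where n: "n = k + j" using le_Suc_ex by blast
      have "pmf ?R x = pmf ?R ((\<lambda>(i, j). (i + j, i)) (k, j))" by (simp add: x n)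
      also have "\<dots> = pmf (poisson (a * q)) k * pmf (poisson (a * (1 - q))) j"
        by (subst pmf_map_inj') (auto simp: inj_on_def pmf_pair)
      finally show ?thesis by (simp add: n pois)
    next
      case False
      then have "pmf ?R x = 0" by (auto simp: x pmf_eq_0_set_pmf)
      then show ?thesis using False by (simp add: assms binomial_eq_0)
    qed
    finally show "pmf ?L x = pmf ?R x" .
  qed
  then have "map_pmf snd ?L = map_pmf snd ?R" by simp
  moreover have "map_pmf snd ?L = bind_pmf (poisson a) (\<lambda>n. binomial_pmf n q)"
    by (simp add: map_bind_pmf pmf.map_comp o_def)
  moreover have "map_pmf snd ?R = poisson (a * q)"
    by (simp add: pmf.map_comp o_def case_prod_unfold map_fst_pair_pmf)
  ultimately show ?thesis by simp
qed

lemma poisson_superposition: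
  assumes "a \<ge> 0" "b \<ge> 0"
  shows "map_pmf (\<lambda>(m, n). m + n) (pair_pmf (poisson a) (poisson b)) = poisson (a + b)"
proof (rule pmf_eqI)
  fix k
  have "pmf (map_pmf (\<lambda>(m, n). m + n) (pair_pmf (poisson a) (poisson b))) k
      = measure_pmf.prob (pair_pmf (poisson a) (poisson b)) ((\<lambda>i. (i, k - i)) ` {..k})"
    unfolding pmf_map
    by (intro arg_cong[where f = "measure_pmf.prob _"]) (auto simp: image_iff)
  also have "\<dots> = (\<Sum>i\<le>k. pmf (poisson a) i * pmf (poisson b) (k - i))"
    by (subst measure_measure_pmf_finite) (auto simp: sum.reindex inj_on_def pmf_pair)
  also have "\<dots> = (\<Sum>i\<le>k. real (k choose i) * a ^ i * b ^ (k - i)) / fact k * exp (- (a + b))"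
    unfolding sum_divide_distrib sum_distrib_right
    using assms by (intro sum.cong refl)
      (simp add: pmf_poisson_nonneg binomial_fact exp_diff exp_minus field_simps flip: exp_add)
  also have "\<dots> = pmf (poisson (a + b)) k"
    using assms by (simp add: pmf_poisson_nonneg binomial_ring)
  finally show "pmf (map_pmf (\<lambda>(m, n). m + n) (pair_pmf (poisson a) (poisson b))) k
      = pmf (poisson (a + b)) k" .
qed

subsection \<open>Peeling a tree\<close>

definition layer :: "nat \<Rightarrow> tree_vertex set \<Rightarrow> tree_vertex set" where
  "layer d T = {v \<in> T. length v = Suc d}"

text \<open>The number of surviving children that a vertex needs: the parent counts as one
  surviving neighbour, and the root has none.\<close>

definition required :: "tree_vertex \<Rightarrow> nat" where
  "required v = (if tl v = [] then Suc (snd (vertex_type v)) else snd (vertex_type v))"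

text \<open>One step of a bottom-up sweep, from the survivors of one layer to those of the layer
  above. Looking only at parents of members of \<open>B\<close> loses nothing as long as
  \<open>required\<close> is positive, which holds for the trees considered.\<close>

definition promote :: "tree_vertex set \<Rightarrow> tree_vertex set" where
  "promote B = {v \<in> tl ` B. required v \<le> card {u \<in> B. tl u = v}}"

definition family_tree :: "vtype \<Rightarrow> nat \<Rightarrow> tree_vertex set \<Rightarrow> bool" where
  "family_tree s d T \<longleftrightarrow> finite T \<and> [(s, 0)] \<in> T \<and>
     (\<forall>v\<in>T. v \<noteq> [] \<and> length v \<le> Suc d \<and> 0 < snd (vertex_type v) \<and>
        (if tl v = [] then v = [(s, 0)] else tl v \<in> T))"

text \<open>Simultaneous peeling lets information travel up and down the tree, whereas
  \<open>promote\<close> only moves up. For the root the two agree: while the root can still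
  survive, each vertex that supports it has its parent present, and this is the one unit that
  \<open>required\<close> takes for granted.\<close>

lemma root_survives_iff_promote:
  assumes T: "family_tree s l T"
  shows "survives (\<lambda>v. snd (vertex_type v)) (tree_graph T) l [(s, 0)] \<longleftrightarrow>
         [(s, 0)] \<in> (promote ^^ l) (layer l T)"
proof -
  define E where "E = {{v, tl v} | v. v \<in> T \<and> tl v \<noteq> []}"
  define cap :: "tree_vertex \<Rightarrow> nat" where "cap v = snd (vertex_type v)" for v
  define U where "U j = (promote ^^ j) (layer l T)" for j
  let ?a = "alive E (\<lambda>v. Suc (cap v))"
  let ?r = "[(s, 0)] :: tree_vertex"
  have finT: "finite T" and rT: "?r \<in> T"
    and ne: "\<And>v. v \<in> T \<Longrightarrow> v \<noteq> []" and len: "\<And>v. v \<in> T \<Longrightarrow> length v \<le> Suc l"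
    and cap: "\<And>v. v \<in> T \<Longrightarrow> 0 < cap v"
    and root: "\<And>v. v \<in> T \<Longrightarrow> tl v = [] \<Longrightarrow> v = ?r"
    and parent: "\<And>v. v \<in> T \<Longrightarrow> tl v \<noteq> [] \<Longrightarrow> tl v \<in> T"
    using T unfolding family_tree_def cap_def by (auto split: if_splits)
  have tl_ne: "v \<noteq> tl v" if "v \<noteq> []" for v :: tree_vertex
    using that by (cases v) auto
  have "E = (\<lambda>v. {v, tl v}) ` {v \<in> T. tl v \<noteq> []}" by (auto simp: E_def)
  then have finE: "finite E" using finT by simp
  have surv: "survives (\<lambda>v. snd (vertex_type v)) (tree_graph T) l ?r \<longleftrightarrow> ?a l ?r"
    unfolding tree_graph_def E_def[symmetric] cap_def
  proof (rule survives_iff_alive[OF finE _ rT])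
    fix e assume "e \<in> E"
    then obtain v where "v \<in> T" "tl v \<noteq> []" "e = {v, tl v}" by (auto simp: E_def)
    then show "\<exists>u w. u \<noteq> w \<and> e = {u, w} \<and> u \<in> T \<and> w \<in> T"
      using tl_ne[OF ne] parent by blast
  qed
  have nb: "nbrs E v = {u \<in> T. tl u = v} \<union> (if tl v = [] then {} else {tl v})" if "v \<in> T" for v
    using that ne[OF that] by (auto simp: nbrs_def E_def doubleton_eq_iff)
  have req: "Suc (cap v) = required v + (if tl v = [] then 0 else 1)" for v
    by (simp add: required_def cap_def)
  have req_pos: "0 < required v" if "v \<in> T" for v
    using cap[OF that] by (simp add: required_def cap_def)
  have UT: "U j \<subseteq> layer (l - j) T" if "j \<le> l" for j
    using that
  proof (induction j)
    case (Suc j)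
    then have IH: "U j \<subseteq> layer (l - j) T" by simp
    show ?case
    proof
      fix v assume "v \<in> U (Suc j)"
      then obtain u where u: "u \<in> U j" "v = tl u" by (auto simp: U_def promote_def)
      then have "u \<in> T" "length u = Suc (l - j)" using IH by (auto simp: layer_def)
      moreover have "tl u \<noteq> []" using Suc.prems calculation(2) by (cases u) auto
      ultimately show "v \<in> layer (l - Suc j) T"
        using parent u(2) Suc.prems by (auto simp: layer_def)
    qed
  qed (simp add: U_def)
  \<comment> \<open>Round \<open>j\<close> is compared with depth \<open>l - j\<close>, starting
    from the full bottom layer at round 0. The parent supplies at most one alive neighbour, which
    \<open>required\<close> has already discounted.\<close>
  have alive_U: "v \<in> U j" if "j \<le> l" "v \<in> layer (l - j) T" "?a j v" for j v
    using that
  proof (induction j arbitrary: v)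
    case (Suc j)
    have v: "v \<in> T" "length v = Suc (l - Suc j)" using Suc.prems by (auto simp: layer_def)
    have fin: "finite {u \<in> U j. tl u = v}"
      using UT[of j] Suc.prems(1) finT by (auto simp: layer_def intro!: finite_subset[of _ T])
    have "{u \<in> nbrs E v. ?a j u} \<subseteq> {u \<in> U j. tl u = v} \<union> (if tl v = [] then {} else {tl v})"
    proof
      fix u assume u: "u \<in> {u \<in> nbrs E v. ?a j u}"
      show "u \<in> {u \<in> U j. tl u = v} \<union> (if tl v = [] then {} else {tl v})"
      proof (cases "u \<in> T \<and> tl u = v")
        case True
        then have "length u = Suc (l - j)" using v(2) ne[of u] Suc.prems(1) by (cases u) auto
        then have "u \<in> U j" using True u Suc.prems(1) by (intro Suc.IH) (auto simp: layer_def)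
        then show ?thesis using True by simp
      next
        case False
        then show ?thesis using u nb[OF v(1)] by auto
      qed
    qed
    then have "card {u \<in> nbrs E v. ?a j u} \<le> card ({u \<in> U j. tl u = v} \<union> (if tl v = [] then {} else {tl v}))"
      using fin by (intro card_mono) auto
    also have "\<dots> \<le> card {u \<in> U j. tl u = v} + (if tl v = [] then 0 else 1)"
      by (rule order_trans[OF card_Un_le]) auto
    finally have le: "required v \<le> card {u \<in> U j. tl u = v}"
      using Suc.prems(3) req[of v] by (auto simp: alive_Suc split: if_splits)
    then have "{u \<in> U j. tl u = v} \<noteq> {}" using req_pos[OF v(1)] by force
    then show ?case using le by (auto simp: U_def promote_def)
  qed (simp add: U_def)
  \<comment> \<open>\<open>C d\<close> collects the vertices of depth \<open>d\<close> that are kept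
    by the sweep together with all their ancestors; only for these is the parent known to be
    present. Below, survival of \<open>C d\<close> is claimed for every round up to
    \<open>l - d\<close>, so that at each step both the children and the parent are covered by the
    induction hypothesis.\<close>
  define C where "C = rec_nat {?r} (\<lambda>d Cd. {u \<in> U (l - Suc d). tl u \<in> Cd})"
  have C: "C 0 = {?r}" "\<And>d. C (Suc d) = {u \<in> U (l - Suc d). tl u \<in> C d}"
    by (simp_all add: C_def)
  have C_alive: "?a j v" if "?r \<in> U l" "d + j \<le> l" "v \<in> C d" for d j v
    using that(2,3)
  proof (induction j arbitrary: d v)
    case (Suc j)
    have vU: "v \<in> U (l - d)"
      using Suc.prems(2) that(1) by (cases d) (auto simp: C)
    then have v: "v \<in> T" "length v = Suc d" using UT[of "l - d"] Suc.prems(1) by (auto simp: layer_def)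
    have "l - d = Suc (l - Suc d)" using Suc.prems(1) by simp
    then have le: "required v \<le> card {u \<in> U (l - Suc d). tl u = v}"
      using vU by (simp add: U_def promote_def)
    have ch: "{u \<in> U (l - Suc d). tl u = v} \<subseteq> {u \<in> nbrs E v. ?a j u}"
    proof
      fix u assume u: "u \<in> {u \<in> U (l - Suc d). tl u = v}"
      then have "u \<in> C (Suc d)" using Suc.prems(2) by (simp add: C)
      then have "?a j u" using Suc.IH[of "Suc d" u] Suc.prems(1) by simp
      moreover have "u \<in> T" using u UT[of "l - Suc d"] by (auto simp: layer_def)
      ultimately show "u \<in> {u \<in> nbrs E v. ?a j u}" using u nb[OF v(1)] by simp
    qed
    have fin: "finite {u \<in> nbrs E v. ?a j u}" using finite_nbrs[OF finE] by simp
    have "Suc (cap v) \<le> card {u \<in> nbrs E v. ?a j u}"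
    proof (cases "tl v = []")
      case True
      then show ?thesis using le card_mono[OF fin ch] req[of v] by simp
    next
      case False
      then obtain d' where d': "d = Suc d'" using v(2) by (cases v; cases d) auto
      then have "tl v \<in> C d'" using Suc.prems(2) by (simp add: C)
      then have "?a j (tl v)" using Suc.IH[of d'] Suc.prems(1) d' by simp
      then have ch': "insert (tl v) {u \<in> U (l - Suc d). tl u = v} \<subseteq> {u \<in> nbrs E v. ?a j u}"
        using ch nb[OF v(1)] False by auto
      have "tl v \<notin> {u \<in> U (l - Suc d). tl u = v}"
        using v(2) by (auto dest: arg_cong[of _ _ length])
      then have "card (insert (tl v) {u \<in> U (l - Suc d). tl u = v})
          = Suc (card {u \<in> U (l - Suc d). tl u = v})"
        using finite_subset[OF ch fin] by simp
      then show ?thesis using le card_mono[OF fin ch'] req[of v] False by simp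
    qed
    then show ?case by (simp add: alive_Suc)
  qed simp
  have "?a l ?r \<longleftrightarrow> ?r \<in> U l"
  proof
    assume "?a l ?r"
    then show "?r \<in> U l" using rT by (intro alive_U) (auto simp: layer_def)
  next
    assume "?r \<in> U l"
    then show "?a l ?r" using C_alive[of 0 l ?r] by (simp add: C)
  qed
  then show ?thesis using surv by (simp add: U_def)
qed

subsection \<open>Law of the promoted vertices\<close>

definition thin :: "(tree_vertex \<Rightarrow> real) \<Rightarrow> tree_vertex set \<Rightarrow> tree_vertex set pmf" where
  "thin Q F = map_pmf (\<lambda>x. {u \<in> F. x u}) (Pi_pmf F False (\<lambda>u. bernoulli_pmf (Q u)))"

definition children :: "vtype set \<Rightarrow> tree_vertex set \<Rightarrow> (tree_vertex \<times> vtype \<Rightarrow> nat) \<Rightarrow> tree_vertex set" where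
  "children S F N = {(s', m) # v | s' m v. v \<in> F \<and> s' \<in> S \<and> m < N (v, s')}"

lemma thin_subset: "X \<in> set_pmf (thin Q F) \<Longrightarrow> X \<subseteq> F"
  by (auto simp: thin_def)

lemma thin_empty [simp]: "thin Q {} = return_pmf {}"
  by (simp add: thin_def)

lemma thin_one: "finite F \<Longrightarrow> thin (\<lambda>_. 1) F = return_pmf F"
proof -
  assume "finite F"
  have b: "bernoulli_pmf 1 = return_pmf True"
  proof (rule pmf_eqI)
    show "pmf (bernoulli_pmf 1) b = pmf (return_pmf True) b" for b by (cases b) simp_all
  qed
  have "set_pmf (thin (\<lambda>_. 1) F) \<subseteq> {F}"
    unfolding thin_def b using \<open>finite F\<close> by (auto simp: set_Pi_pmf PiE_dflt_def)
  then show ?thesis by (simp add: set_pmf_subset_singleton)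
qed

lemma thin_cong: "(\<And>u. u \<in> F \<Longrightarrow> Q u = Q' u) \<Longrightarrow> thin Q F = thin Q' F"
  unfolding thin_def by (intro arg_cong[where f = "map_pmf _"] Pi_pmf_cong) auto

lemma thin_union:
  assumes "finite A" "finite B" "A \<inter> B = {}"
  shows "thin Q (A \<union> B) = bind_pmf (thin Q A) (\<lambda>X. map_pmf (\<lambda>Y. X \<union> Y) (thin Q B))"
proof -
  have "thin Q (A \<union> B) = map_pmf (\<lambda>(f, g). {u \<in> A. f u} \<union> {u \<in> B. g u})
      (pair_pmf (Pi_pmf A False (\<lambda>u. bernoulli_pmf (Q u))) (Pi_pmf B False (\<lambda>u. bernoulli_pmf (Q u))))"
    unfolding thin_def Pi_pmf_union[OF assms] pmf.map_comp o_def
    by (intro map_pmf_cong refl) (use assms(3) in auto)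
  then show ?thesis
    by (simp add: thin_def pair_pmf_def map_pmf_def bind_assoc_pmf bind_return_pmf)
qed

lemma mem_children:
  "u \<in> children S F N \<longleftrightarrow>
     u \<noteq> [] \<and> tl u \<in> F \<and> fst (hd u) \<in> S \<and> snd (hd u) < N (tl u, fst (hd u))"
  by (cases u) (auto simp: children_def)

lemma finite_children: "finite S \<Longrightarrow> finite F \<Longrightarrow> finite (children S F N)"
proof -
  assume fin: "finite S" "finite F"
  have "children S F N = (\<Union>v\<in>F. \<Union>s\<in>S. (\<lambda>m. (s, m) # v) ` {..<N (v, s)})"
    by (auto simp: children_def)
  then show ?thesis using fin by auto
qed

lemma card_thin_siblings:
  assumes "finite M" "card M = n" "\<And>u. u \<in> M \<Longrightarrow> Q u = q" "0 \<le> q" "q \<le> 1"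
  shows "map_pmf card (thin Q M) = binomial_pmf n q"
proof -
  have "thin Q M = thin (\<lambda>_. q) M" using assms by (intro thin_cong) auto
  then show ?thesis
    using assms by (subst binomial_pmf_altdef'[of M n q False]) (auto simp: thin_def pmf.map_comp o_def)
qed

text \<open>Thinning makes the retained children of each type Poisson, and superposition adds up the
  types one by one.\<close>

lemma card_thin_children:
  assumes "finite S" "\<And>s. s \<in> S \<Longrightarrow> 0 \<le> q s \<and> q s \<le> 1" "\<And>s. s \<in> S \<Longrightarrow> 0 \<le> \<mu> s"
  shows "bind_pmf (Pi_pmf ({v} \<times> S) 0 (\<lambda>(v, s). poisson (\<mu> s)))
           (\<lambda>N. map_pmf card (thin (\<lambda>u. q (vertex_type u)) (children S {v} N)))
         = poisson (\<Sum>s\<in>S. \<mu> s * q s)"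
  using assms
proof (induction S rule: finite_induct)
  case empty
  then show ?case by (simp add: children_def poisson_def bind_return_pmf)
next
  case (insert s S)
  let ?Q = "\<lambda>u. q (vertex_type u)"
  let ?P = "Pi_pmf ({v} \<times> S) 0 (\<lambda>(v, s). poisson (\<mu> s))"
  define M where "M k = (\<lambda>m. (s, m) # v) ` {..<k}" for k :: nat
  have mem_M: "u \<in> M k \<longleftrightarrow> u \<noteq> [] \<and> tl u = v \<and> fst (hd u) = s \<and> snd (hd u) < k" for u k
    by (cases u) (auto simp: M_def)
  have cardM: "card (M k) = k" for k
    unfolding M_def by (subst card_image) (auto simp: inj_on_def)
  have finM: "finite (M k)" for k by (simp add: M_def)
  have QM: "?Q u = q s" if "u \<in> M k" for u k using that by (auto simp: M_def vertex_type_def)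
  have prod: "{v} \<times> insert s S = insert (v, s) ({v} \<times> S)" by auto
  have ch: "children (insert s S) {v} (N((v, s) := k)) = M k \<union> children S {v} N" for N k
    using insert.hyps by (intro set_eqI) (auto simp: mem_children mem_M)
  have disj: "M k \<inter> children S {v} N = {}" for k N
    using insert.hyps by (auto simp: mem_children mem_M)
  have card: "map_pmf card (thin ?Q (M k \<union> children S {v} N))
      = bind_pmf (binomial_pmf k (q s)) (\<lambda>i. map_pmf (\<lambda>j. i + j) (map_pmf card (thin ?Q (children S {v} N))))"
    (is "?l = ?r") for k N
  proof -
    have fc: "finite (children S {v} N)" using insert.hyps by (intro finite_children) auto
    have "?l = bind_pmf (thin ?Q (M k)) (\<lambda>X. map_pmf (\<lambda>Y. card (X \<union> Y)) (thin ?Q (children S {v} N)))"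
      by (simp add: thin_union[OF finM fc disj] map_bind_pmf pmf.map_comp o_def)
    also have "\<dots> = bind_pmf (thin ?Q (M k)) (\<lambda>X. map_pmf (\<lambda>Y. card X + card Y) (thin ?Q (children S {v} N)))"
    proof (intro bind_pmf_cong map_pmf_cong refl)
      fix X Y assume "X \<in> set_pmf (thin ?Q (M k))" "Y \<in> set_pmf (thin ?Q (children S {v} N))"
      then have "X \<subseteq> M k" "Y \<subseteq> children S {v} N" by (auto dest: thin_subset)
      then show "card (X \<union> Y) = card X + card Y"
        using disj[of k N] finM fc by (intro card_Un_disjoint) (auto dest: finite_subset)
    qed
    also have "\<dots> = bind_pmf (map_pmf card (thin ?Q (M k)))
        (\<lambda>i. map_pmf (\<lambda>j. i + j) (map_pmf card (thin ?Q (children S {v} N))))"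
      by (simp add: bind_map_pmf pmf.map_comp o_def)
    also have "map_pmf card (thin ?Q (M k)) = binomial_pmf k (q s)"
      using insert.prems by (intro card_thin_siblings finM cardM QM) auto
    finally show ?thesis .
  qed
  have "bind_pmf (Pi_pmf ({v} \<times> insert s S) 0 (\<lambda>(v, s). poisson (\<mu> s)))
           (\<lambda>N. map_pmf card (thin ?Q (children (insert s S) {v} N)))
      = bind_pmf (poisson (\<mu> s)) (\<lambda>k. bind_pmf ?P (\<lambda>N. bind_pmf (binomial_pmf k (q s))
          (\<lambda>i. map_pmf (\<lambda>j. i + j) (map_pmf card (thin ?Q (children S {v} N))))))"
    unfolding prod using insert.hyps
    by (subst Pi_pmf_insert) (auto simp: pair_pmf_def bind_map_pmf bind_assoc_pmf bind_return_pmf ch card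
        simp del: fun_upd_apply)
  also have "\<dots> = bind_pmf (poisson (\<mu> s)) (\<lambda>k. bind_pmf (binomial_pmf k (q s)) (\<lambda>i. bind_pmf ?P
          (\<lambda>N. map_pmf (\<lambda>j. i + j) (map_pmf card (thin ?Q (children S {v} N))))))"
    by (intro bind_pmf_cong refl bind_commute_pmf)
  also have "\<dots> = bind_pmf (bind_pmf (poisson (\<mu> s)) (\<lambda>k. binomial_pmf k (q s)))
      (\<lambda>i. map_pmf (\<lambda>j. i + j) (bind_pmf ?P (\<lambda>N. map_pmf card (thin ?Q (children S {v} N)))))"
    by (simp add: bind_assoc_pmf map_bind_pmf)
  also have "\<dots> = bind_pmf (poisson (\<mu> s * q s)) (\<lambda>i. map_pmf (\<lambda>j. i + j) (poisson (\<Sum>s\<in>S. \<mu> s * q s)))"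
    using insert.prems by (simp add: poisson_thinning insert.IH)
  also have "\<dots> = map_pmf (\<lambda>(i, j). i + j) (pair_pmf (poisson (\<mu> s * q s)) (poisson (\<Sum>s\<in>S. \<mu> s * q s)))"
    by (simp add: pair_pmf_def map_pmf_def bind_assoc_pmf bind_return_pmf)
  also have "\<dots> = poisson (\<Sum>s\<in>insert s S. \<mu> s * q s)"
    using insert.prems insert.hyps by (simp add: poisson_superposition sum_nonneg)
  finally show ?case .
qed

lemma map_pmf_threshold:
  "map_pmf (\<lambda>k. (r :: nat) \<le> k) P = bernoulli_pmf (1 - measure_pmf.prob P {..<r})"
proof (rule pmf_eqI)
  fix b
  have vimage: "(\<lambda>k. r \<le> k) -` {True} = UNIV - {..<r}" "(\<lambda>k. r \<le> k) -` {False} = {..<r}"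
    by (auto simp: set_eq_iff)
  have compl: "measure_pmf.prob P (UNIV - {..<r}) = 1 - measure_pmf.prob P {..<r}"
    using measure_pmf.prob_compl[of "{..<r}" P] unfolding space_measure_pmf sets_measure_pmf by blast
  define a where "a = measure_pmf.prob P {..<r}"
  have a: "0 \<le> a" "a \<le> 1" by (simp_all add: a_def)
  show "pmf (map_pmf (\<lambda>k. r \<le> k) P) b = pmf (bernoulli_pmf (1 - measure_pmf.prob P {..<r})) b"
    unfolding pmf_map a_def[symmetric] using a
    by (cases b) (simp_all only: vimage compl a_def[symmetric], simp_all)
qed

lemma promote_Un:
  assumes "tl ` X \<inter> tl ` Y = {}"
  shows "promote (X \<union> Y) = promote X \<union> promote Y"
proof -
  have "{u \<in> X \<union> Y. tl u = v} = {u \<in> X. tl u = v}" if "v \<in> tl ` X" for v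
    using assms that by blast
  moreover have "{u \<in> X \<union> Y. tl u = v} = {u \<in> Y. tl u = v}" if "v \<in> tl ` Y" for v
    using assms that by blast
  ultimately show ?thesis unfolding promote_def image_Un by auto
qed

lemma promote_siblings:
  assumes "\<And>u. u \<in> X \<Longrightarrow> tl u = v" "0 < required v"
  shows "promote X = (if required v \<le> card X then {v} else {})"
proof (cases "X = {}")
  case False
  have "{u \<in> X. tl u = v} = X" "tl ` X = {v}" using assms(1) False by blast+
  then show ?thesis by (auto simp: promote_def)
qed (use assms(2) in \<open>simp add: promote_def\<close>)

text \<open>Why the sweep has a tractable law: the families of distinct parents are independent, so
  keeping children independently and promoting yields an independent thinning of the parent layer
  again, with new retention probabilities.\<close>

lemma promote_thin_children:
  assumes "finite F" "finite S" "\<And>s. s \<in> S \<Longrightarrow> 0 \<le> q s \<and> q s \<le> 1" "\<And>s s'. 0 \<le> \<mu> s s'"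
    and "\<And>v. v \<in> F \<Longrightarrow> 0 < required v"
  shows "bind_pmf (Pi_pmf (F \<times> S) 0 (\<lambda>(v, s'). poisson (\<mu> (vertex_type v) s')))
           (\<lambda>N. map_pmf promote (thin (\<lambda>u. q (vertex_type u)) (children S F N)))
         = thin (\<lambda>v. 1 - poisson_cdf (required v) (\<Sum>s'\<in>S. \<mu> (vertex_type v) s' * q s')) F"
  using assms(1,5)
proof (induction F rule: finite_induct)
  case empty
  then show ?case by (simp add: children_def promote_def bind_return_pmf)
next
  case (insert v F)
  let ?Q = "\<lambda>u. q (vertex_type u)"
  let ?Q' = "\<lambda>v. 1 - poisson_cdf (required v) (\<Sum>s'\<in>S. \<mu> (vertex_type v) s' * q s')"
  let ?P = "\<lambda>F. Pi_pmf (F \<times> S) 0 (\<lambda>(v, s'). poisson (\<mu> (vertex_type v) s'))"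
  have single: "bind_pmf (?P {v}) (\<lambda>N. map_pmf promote (thin ?Q (children S {v} N))) = thin ?Q' {v}"
  proof -
    have "bind_pmf (?P {v}) (\<lambda>N. map_pmf promote (thin ?Q (children S {v} N)))
        = bind_pmf (?P {v}) (\<lambda>N. map_pmf (\<lambda>X. if required v \<le> card X then {v} else {})
            (thin ?Q (children S {v} N)))"
    proof (intro bind_pmf_cong map_pmf_cong refl)
      fix N X assume "X \<in> set_pmf (thin ?Q (children S {v} N))"
      then have "X \<subseteq> children S {v} N" by (rule thin_subset)
      then show "promote X = (if required v \<le> card X then {v} else {})"
        using insert.prems[of v] by (intro promote_siblings) (fastforce simp: mem_children)+
    qed
    also have "\<dots> = map_pmf (\<lambda>b. if b then {v} else {}) (map_pmf (\<lambda>k. required v \<le> k)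
        (bind_pmf (?P {v}) (\<lambda>N. map_pmf card (thin ?Q (children S {v} N)))))"
      by (simp add: map_bind_pmf pmf.map_comp o_def)
    also have "bind_pmf (?P {v}) (\<lambda>N. map_pmf card (thin ?Q (children S {v} N)))
        = poisson (\<Sum>s'\<in>S. \<mu> (vertex_type v) s' * q s')"
    proof -
      have "?P {v} = Pi_pmf ({v} \<times> S) 0 (\<lambda>(_, s'). poisson (\<mu> (vertex_type v) s'))"
        by (intro Pi_pmf_cong) (auto simp: assms(2))
      then show ?thesis using assms by (simp only:) (intro card_thin_children, auto)
    qed
    also have "map_pmf (\<lambda>k. required v \<le> k) \<dots> = bernoulli_pmf (?Q' v)"
      using assms by (simp add: map_pmf_threshold prob_poisson_less sum_nonneg)
    also have "map_pmf (\<lambda>b. if b then {v} else {}) \<dots> = thin ?Q' {v}"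
      by (auto simp: thin_def Pi_pmf_singleton pmf.map_comp o_def intro!: map_pmf_cong split: if_splits)
    finally show ?thesis .
  qed
  have prod: "insert v F \<times> S = {v} \<times> S \<union> F \<times> S" by auto
  have disj: "({v} \<times> S) \<inter> (F \<times> S) = {}" using insert.hyps by auto
  have ch: "children S (insert v F) (\<lambda>x. if x \<in> {v} \<times> S then N x else N' x)
      = children S {v} N \<union> children S F N'" for N N'
    using insert.hyps by (intro set_eqI) (simp add: mem_children mem_Times_iff, metis)
  have cdisj: "children S {v} N \<inter> children S F N' = {}" for N N'
    using insert.hyps by (auto simp: mem_children)
  have fc: "finite (children S {v} N)" "finite (children S F N)" for N
    using insert.hyps assms(2) by (auto intro: finite_children)
  have pr: "map_pmf promote (thin ?Q (children S {v} N \<union> children S F N'))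
      = bind_pmf (map_pmf promote (thin ?Q (children S {v} N)))
         (\<lambda>X. map_pmf (\<lambda>Y. X \<union> Y) (map_pmf promote (thin ?Q (children S F N'))))" for N N'
  proof -
    have "map_pmf promote (thin ?Q (children S {v} N \<union> children S F N'))
      = bind_pmf (thin ?Q (children S {v} N))
         (\<lambda>X. map_pmf (\<lambda>Y. promote (X \<union> Y)) (thin ?Q (children S F N')))"
      by (simp add: thin_union[OF fc(1) fc(2) cdisj] map_bind_pmf pmf.map_comp o_def)
    also have "\<dots> = bind_pmf (thin ?Q (children S {v} N))
         (\<lambda>X. map_pmf (\<lambda>Y. promote X \<union> promote Y) (thin ?Q (children S F N')))"
    proof (intro bind_pmf_cong map_pmf_cong refl)
      fix X Y assume "X \<in> set_pmf (thin ?Q (children S {v} N))" "Y \<in> set_pmf (thin ?Q (children S F N'))"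
      then have "X \<subseteq> children S {v} N" "Y \<subseteq> children S F N'" by (auto dest: thin_subset)
      then have "tl ` X \<subseteq> {v}" "tl ` Y \<subseteq> F" by (fastforce simp: mem_children)+
      then show "promote (X \<union> Y) = promote X \<union> promote Y"
        using insert.hyps(2) by (intro promote_Un) blast
    qed
    finally show ?thesis by (simp add: bind_map_pmf pmf.map_comp o_def)
  qed
  have "bind_pmf (?P (insert v F)) (\<lambda>N. map_pmf promote (thin ?Q (children S (insert v F) N)))
      = bind_pmf (?P {v}) (\<lambda>N. bind_pmf (?P F) (\<lambda>N'. bind_pmf (map_pmf promote (thin ?Q (children S {v} N)))
         (\<lambda>X. map_pmf (\<lambda>Y. X \<union> Y) (map_pmf promote (thin ?Q (children S F N'))))))"
    unfolding prod using insert.hyps assms(2)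
    by (subst Pi_pmf_union[OF _ _ disj])
      (simp_all add: pair_pmf_def bind_map_pmf bind_assoc_pmf bind_return_pmf ch pr del: mem_Sigma_iff)
  also have "\<dots> = bind_pmf (?P {v}) (\<lambda>N. bind_pmf (map_pmf promote (thin ?Q (children S {v} N)))
      (\<lambda>X. bind_pmf (?P F) (\<lambda>N'. map_pmf (\<lambda>Y. X \<union> Y) (map_pmf promote (thin ?Q (children S F N'))))))"
    by (intro bind_pmf_cong refl bind_commute_pmf)
  also have "\<dots> = bind_pmf (bind_pmf (?P {v}) (\<lambda>N. map_pmf promote (thin ?Q (children S {v} N))))
      (\<lambda>X. map_pmf (\<lambda>Y. X \<union> Y) (bind_pmf (?P F) (\<lambda>N'. map_pmf promote (thin ?Q (children S F N')))))"
    by (simp add: bind_assoc_pmf map_bind_pmf)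
  also have "\<dots> = bind_pmf (thin ?Q' {v}) (\<lambda>X. map_pmf (\<lambda>Y. X \<union> Y) (thin ?Q' F))"
    unfolding single using insert.prems by (subst insert.IH) auto
  also have "\<dots> = thin ?Q' ({v} \<union> F)"
    using insert.hyps by (intro thin_union[symmetric]) auto
  finally show ?case by simp
qed

section \<open>Density evolution for the branching process\<close>

lemma thin_singleton: "thin Q {v} = map_pmf (\<lambda>b. if b then {v} else {}) (bernoulli_pmf (Q v))"
  by (auto simp: thin_def Pi_pmf_singleton pmf.map_comp o_def intro!: map_pmf_cong split: if_splits)

text \<open>Density evolution for a vertex below the root. The threshold is \<open>snd s\<close> and
  not its successor because the parent counts as one surviving neighbour.\<close>

primrec survival :: "vtype set \<Rightarrow> (vtype \<Rightarrow> vtype \<Rightarrow> real) \<Rightarrow> nat \<Rightarrow> vtype \<Rightarrow> real" where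
  "survival S \<mu> 0 s = 1"
| "survival S \<mu> (Suc k) s = 1 - poisson_cdf (snd s) (\<Sum>s'\<in>S. \<mu> s s' * survival S \<mu> k s')"

lemma survival_bounds:
  assumes "\<And>s s'. 0 \<le> \<mu> s s'"
  shows "0 \<le> survival S \<mu> k s \<and> survival S \<mu> k s \<le> 1"
proof (induction k arbitrary: s)
  case (Suc k)
  then have "0 \<le> (\<Sum>s'\<in>S. \<mu> s s' * survival S \<mu> k s')"
    using assms by (intro sum_nonneg mult_nonneg_nonneg) auto
  then show ?case using poisson_cdf_bounds by (simp add: Suc)
qed simp

lemma offspring_mean_nonneg: "c \<ge> 0 \<Longrightarrow> 0 \<le> offspring_mean \<eta> \<gamma> \<tau> c s s'"
  by (auto simp: offspring_mean_def split: prod.splits)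

lemma generations_Suc:
  "generations L tmax \<eta> \<gamma> \<tau> c s (Suc d) = bind_pmf (generations L tmax \<eta> \<gamma> \<tau> c s d) (\<lambda>T.
     map_pmf (\<lambda>N. T \<union> children ({1..L} \<times> {1..tmax}) (layer d T) N)
       (Pi_pmf (layer d T \<times> ({1..L} \<times> {1..tmax})) 0
         (\<lambda>(v, s'). poisson (offspring_mean \<eta> \<gamma> \<tau> c (vertex_type v) s'))))"
  by (simp only: generations.simps Let_def layer_def children_def)

lemma family_tree_generations:
  assumes "T \<in> set_pmf (generations L tmax \<eta> \<gamma> \<tau> c s d)" "0 < snd s"
  shows "family_tree s d T"
  using assms(1)
proof (induction d arbitrary: T)
  case 0
  then show ?case using assms(2) by (simp add: family_tree_def vertex_type_def)
next
  case (Suc d)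
  let ?S = "{1..L} \<times> {1..tmax}"
  obtain T' N where T': "T' \<in> set_pmf (generations L tmax \<eta> \<gamma> \<tau> c s d)"
    and T: "T = T' \<union> children ?S (layer d T') N"
    using Suc.prems unfolding generations_Suc by auto
  have ft: "family_tree s d T'" by (rule Suc.IH[OF T'])
  then have fin: "finite (children ?S (layer d T') N)"
    by (intro finite_children) (auto simp: layer_def family_tree_def)
  have new: "v \<noteq> [] \<and> length v \<le> Suc (Suc d) \<and> 0 < snd (vertex_type v) \<and>
        tl v \<noteq> [] \<and> tl v \<in> T'" if "v \<in> children ?S (layer d T') N" for v
  proof -
    have "v \<noteq> []" "tl v \<in> T'" "length (tl v) = Suc d" "0 < snd (fst (hd v))"
      using that by (auto simp: mem_children layer_def)
    then show ?thesis by (cases v) (auto simp: vertex_type_def)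
  qed
  have old: "v \<noteq> [] \<and> length v \<le> Suc d \<and> 0 < snd (vertex_type v) \<and>
        (if tl v = [] then v = [(s, 0)] else tl v \<in> T')" if "v \<in> T'" for v
    using ft that unfolding family_tree_def by blast
  have "\<forall>v\<in>T. v \<noteq> [] \<and> length v \<le> Suc (Suc d) \<and> 0 < snd (vertex_type v) \<and>
        (if tl v = [] then v = [(s, 0)] else tl v \<in> T)"
  proof
    fix v assume "v \<in> T"
    then consider "v \<in> T'" | "v \<in> children ?S (layer d T') N" by (auto simp: T)
    then show "v \<noteq> [] \<and> length v \<le> Suc (Suc d) \<and> 0 < snd (vertex_type v) \<and>
        (if tl v = [] then v = [(s, 0)] else tl v \<in> T)"
    proof cases
      case 1
      then show ?thesis using old[of v] by (simp add: T split: if_splits)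
    next
      case 2
      then show ?thesis using new[of v] by (simp add: T)
    qed
  qed
  moreover have "finite T" "[(s, 0)] \<in> T" using ft fin by (auto simp: T family_tree_def)
  ultimately show ?case unfolding family_tree_def by blast
qed

lemma layer_Suc_children:
  assumes "family_tree s d T"
  shows "layer (Suc d) (T \<union> children S (layer d T) N) = children S (layer d T) N"
proof -
  have "length v = Suc (Suc d)" if "v \<in> children S (layer d T) N" for v
    using that by (cases v) (auto simp: mem_children layer_def)
  then show ?thesis using assms by (auto simp: layer_def family_tree_def)
qed

text \<open>The last generation is integrated out by \<open>promote_thin_children\<close>, at the
  price of updating the retention probabilities of the layer above.\<close>

lemma thinned_layer_step:
  fixes L tmax :: nat and \<eta> \<gamma> \<tau> and c :: real
  defines "S \<equiv> {1..L} \<times> {1..tmax}"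
  assumes "0 < snd s" "c \<ge> 0" "\<And>s. 0 \<le> q s \<and> q s \<le> 1"
  defines "\<mu> \<equiv> offspring_mean \<eta> \<gamma> \<tau> c"
  shows "bind_pmf (generations L tmax \<eta> \<gamma> \<tau> c s (Suc d))
           (\<lambda>T. map_pmf (promote ^^ Suc d) (thin (\<lambda>u. q (vertex_type u)) (layer (Suc d) T)))
       = bind_pmf (generations L tmax \<eta> \<gamma> \<tau> c s d) (\<lambda>T. map_pmf (promote ^^ d)
           (thin (\<lambda>v. 1 - poisson_cdf (required v) (\<Sum>s'\<in>S. \<mu> (vertex_type v) s' * q s')) (layer d T)))"
  unfolding generations_Suc bind_assoc_pmf bind_map_pmf S_def[symmetric] \<mu>_def[symmetric]
proof (intro bind_pmf_cong refl)
  fix T assume "T \<in> set_pmf (generations L tmax \<eta> \<gamma> \<tau> c s d)"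
  then have ft: "family_tree s d T" using assms(2) by (rule family_tree_generations)
  then have fin: "finite (layer d T)" and req: "\<And>v. v \<in> layer d T \<Longrightarrow> 0 < required v"
    by (auto simp: family_tree_def layer_def required_def)
  let ?P = "Pi_pmf (layer d T \<times> S) 0 (\<lambda>(v, s'). poisson (\<mu> (vertex_type v) s'))"
  have "bind_pmf ?P (\<lambda>N. map_pmf (promote ^^ Suc d) (thin (\<lambda>u. q (vertex_type u))
          (layer (Suc d) (T \<union> children S (layer d T) N))))
      = map_pmf (promote ^^ d) (bind_pmf ?P (\<lambda>N. map_pmf promote
          (thin (\<lambda>u. q (vertex_type u)) (children S (layer d T) N))))"
    unfolding layer_Suc_children[OF ft] funpow_Suc_right map_bind_pmf pmf.map_comp ..
  also have "\<dots> = map_pmf (promote ^^ d)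
      (thin (\<lambda>v. 1 - poisson_cdf (required v) (\<Sum>s'\<in>S. \<mu> (vertex_type v) s' * q s')) (layer d T))"
    using assms fin req
    by (intro arg_cong[where f = "map_pmf _"] promote_thin_children)
      (auto simp: S_def \<mu>_def offspring_mean_nonneg)
  finally show "bind_pmf ?P (\<lambda>N. map_pmf (promote ^^ Suc d) (thin (\<lambda>u. q (vertex_type u))
          (layer (Suc d) (T \<union> children S (layer d T) N))))
      = map_pmf (promote ^^ d)
      (thin (\<lambda>v. 1 - poisson_cdf (required v) (\<Sum>s'\<in>S. \<mu> (vertex_type v) s' * q s')) (layer d T))" .
qed

text \<open>Below the root \<open>required\<close> equals the capability, so every integrated layer
  advances \<open>survival\<close> by one step. The descent stops at layer 1 because the root needs
  one child more and follows a different formula.\<close>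

lemma thinned_layer_first:
  fixes L tmax :: nat and \<eta> \<gamma> \<tau> and c :: real
  assumes "0 < snd s" "c \<ge> 0"
  defines "Z \<equiv> \<lambda>k d. bind_pmf (generations L tmax \<eta> \<gamma> \<tau> c s d) (\<lambda>T. map_pmf (promote ^^ d)
     (thin (\<lambda>u. survival ({1..L} \<times> {1..tmax}) (offspring_mean \<eta> \<gamma> \<tau> c) k (vertex_type u)) (layer d T)))"
  shows "Z k (Suc d) = Z (k + d) 1"
proof (induction d arbitrary: k)
  case (Suc d)
  have req: "required u = snd (vertex_type u)" if "u \<in> layer (Suc d) T" for u T
    using that by (cases u) (auto simp: layer_def required_def)
  have "Z k (Suc (Suc d)) = Z (Suc k) (Suc d)"
    unfolding Z_def
    by (subst thinned_layer_step)
      (auto simp: assms offspring_mean_nonneg survival_bounds req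
        simp del: generations.simps funpow.simps intro!: bind_pmf_cong arg_cong[where f = "map_pmf _"] thin_cong)
  then show ?case using Suc.IH by simp
qed simp

lemma generations_root_survival:
  fixes L tmax :: nat and \<eta> \<gamma> \<tau> and c :: real
  assumes "0 < snd s" "c \<ge> 0"
  shows "measure_pmf.prob (generations L tmax \<eta> \<gamma> \<tau> c s (Suc l))
          {T. survives (\<lambda>v. snd (vertex_type v)) (tree_graph T) (Suc l) [(s, 0)]}
       = 1 - poisson_cdf (Suc (snd s)) (\<Sum>s'\<in>{1..L} \<times> {1..tmax}. offspring_mean \<eta> \<gamma> \<tau> c s s' *
            survival ({1..L} \<times> {1..tmax}) (offspring_mean \<eta> \<gamma> \<tau> c) l s')"
proof -
  let ?S = "{1..L} \<times> {1..tmax}" and ?\<mu> = "offspring_mean \<eta> \<gamma> \<tau> c"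
  let ?G = "generations L tmax \<eta> \<gamma> \<tau> c s" and ?r = "[(s, 0)] :: tree_vertex"
  let ?p = "1 - poisson_cdf (Suc (snd s)) (\<Sum>s'\<in>?S. ?\<mu> s s' * survival ?S ?\<mu> l s')"
  have nonneg: "0 \<le> (\<Sum>s'\<in>?S. ?\<mu> s s' * survival ?S ?\<mu> l s')"
    using assms survival_bounds[of ?\<mu> ?S l] by (intro sum_nonneg mult_nonneg_nonneg offspring_mean_nonneg)
      (auto simp: offspring_mean_nonneg)
  have "measure_pmf.prob (?G (Suc l)) {T. survives (\<lambda>v. snd (vertex_type v)) (tree_graph T) (Suc l) ?r}
      = measure_pmf.prob (?G (Suc l)) {T. ?r \<in> (promote ^^ Suc l) (layer (Suc l) T)}"
    using root_survives_iff_promote[OF family_tree_generations[OF _ assms(1)]]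
    by (intro measure_pmf.finite_measure_eq_AE) (auto simp: AE_measure_pmf_iff simp del: generations.simps funpow.simps)
  also have "\<dots> = measure_pmf.prob (map_pmf (\<lambda>T. (promote ^^ Suc l) (layer (Suc l) T)) (?G (Suc l))) {B. ?r \<in> B}"
    by (simp add: vimage_def del: generations.simps funpow.simps)
  \<comment> \<open>The full bottom layer is its own thinning with retention probability 1, which is
    \<open>survival\<close> at round 0; this starts the recursion.\<close>
  also have "map_pmf (\<lambda>T. (promote ^^ Suc l) (layer (Suc l) T)) (?G (Suc l))
      = bind_pmf (?G (Suc l)) (\<lambda>T. map_pmf (promote ^^ Suc l)
          (thin (\<lambda>u. survival ?S ?\<mu> 0 (vertex_type u)) (layer (Suc l) T)))"
    unfolding map_pmf_def[of _ "?G (Suc l)"]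
  proof (intro bind_pmf_cong refl)
    fix T assume "T \<in> set_pmf (?G (Suc l))"
    then have "finite (layer (Suc l) T)"
      using family_tree_generations[of T L tmax \<eta> \<gamma> \<tau> c s "Suc l"] assms(1)
      by (simp add: family_tree_def layer_def del: generations.simps)
    then show "return_pmf ((promote ^^ Suc l) (layer (Suc l) T)) = map_pmf (promote ^^ Suc l)
          (thin (\<lambda>u. survival ?S ?\<mu> 0 (vertex_type u)) (layer (Suc l) T))"
      by (simp add: thin_one del: funpow.simps)
  qed
  also have "\<dots> = bind_pmf (?G 1) (\<lambda>T. map_pmf (promote ^^ 1)
          (thin (\<lambda>u. survival ?S ?\<mu> l (vertex_type u)) (layer 1 T)))"
    using thinned_layer_first[OF assms, where k = 0 and d = l] by simp
  also have "\<dots> = bind_pmf (?G 0) (\<lambda>T. map_pmf (promote ^^ 0)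
           (thin (\<lambda>v. 1 - poisson_cdf (required v) (\<Sum>s'\<in>?S. ?\<mu> (vertex_type v) s' * survival ?S ?\<mu> l s')) (layer 0 T)))"
    using thinned_layer_step[OF assms, of "survival ?S ?\<mu> l" L tmax \<eta> \<gamma> \<tau> 0] assms(2)
    by (simp add: survival_bounds offspring_mean_nonneg)
  also have "\<dots> = thin (\<lambda>_. ?p) {?r}"
  proof -
    have "layer 0 {?r} = {?r}" by (auto simp: layer_def)
    then show ?thesis
      by (simp add: bind_return_pmf pmf.map_id) (intro thin_cong, simp add: required_def vertex_type_def)
  qed
  also have "measure_pmf.prob \<dots> {B. ?r \<in> B} = measure_pmf.prob (bernoulli_pmf ?p) {True}"
    unfolding thin_singleton measure_map_pmf
    by (intro arg_cong[where f = "measure_pmf.prob _"]) (auto split: if_splits)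
  also have "\<dots> = ?p"
    using poisson_cdf_bounds[OF nonneg, of "Suc (snd s)"] unfolding measure_pmf_single
    by (subst pmf_bernoulli_True) auto
  finally show ?thesis .
qed

lemma root_survival_prob_eq:
  fixes L tmax :: nat and \<eta> \<gamma> \<tau> and c :: real
  assumes gamma: "set_pmf \<gamma> \<subseteq> {1..L}" and tau: "\<And>i. i \<in> {1..L} \<Longrightarrow> set_pmf (\<tau> i) \<subseteq> {1..tmax}"
    and "c \<ge> 0"
  defines "S \<equiv> {1..L} \<times> {1..tmax}" and "\<mu> \<equiv> offspring_mean \<eta> \<gamma> \<tau> c"
  shows "root_survival_prob L tmax \<eta> \<gamma> \<tau> c (Suc l) = (\<Sum>s\<in>S. pmf \<gamma> (fst s) * pmf (\<tau> (fst s)) (snd s) *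
     (1 - poisson_cdf (Suc (snd s)) (\<Sum>s'\<in>S. \<mu> s s' * survival S \<mu> l s')))"
proof -
  let ?A = "{(s, T). survives (\<lambda>v. snd (vertex_type v)) (tree_graph T) (Suc l) [(s, 0)]}"
  let ?p = "\<lambda>s. 1 - poisson_cdf (Suc (snd s)) (\<Sum>s'\<in>S. \<mu> s s' * survival S \<mu> l s')"
  have root: "pmf (root_type \<gamma> \<tau>) (i, t) = pmf \<gamma> i * pmf (\<tau> i) t" for i t
  proof -
    have "pmf (root_type \<gamma> \<tau>) (i, t) = measure_pmf.expectation \<gamma> (\<lambda>j. indicator {i} j * pmf (\<tau> i) t)"
      unfolding root_type_def pmf_bind
    proof (intro Bochner_Integration.integral_cong refl)
      fix j
      show "pmf (map_pmf (Pair j) (\<tau> j)) (i, t) = indicator {i} j * pmf (\<tau> i) t"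
        using pmf_map_inj'[of "Pair i" "\<tau> i" t]
        by (cases "j = i") (auto simp: inj_on_def pmf_eq_0_set_pmf)
    qed
    then show ?thesis by (simp add: measure_pmf_single)
  qed
  have supp: "set_pmf (root_type \<gamma> \<tau>) \<subseteq> S"
    using gamma tau by (fastforce simp: root_type_def S_def)
  have "root_survival_prob L tmax \<eta> \<gamma> \<tau> c (Suc l) = measure_pmf.expectation (root_type \<gamma> \<tau>)
      (\<lambda>s. measure_pmf.prob (generations L tmax \<eta> \<gamma> \<tau> c s (Suc l)) (Pair s -` ?A))"
    by (simp add: root_survival_prob_def branching_process_def measure_bind_pmf del: generations.simps)
  also have "\<dots> = (\<Sum>s\<in>S. measure_pmf.prob (generations L tmax \<eta> \<gamma> \<tau> c s (Suc l)) (Pair s -` ?A) * pmf (root_type \<gamma> \<tau>) s)"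
    using supp by (intro integral_measure_pmf_real) (auto simp: S_def)
  also have "\<dots> = (\<Sum>s\<in>S. pmf \<gamma> (fst s) * pmf (\<tau> (fst s)) (snd s) * ?p s)"
  proof (intro sum.cong refl)
    fix s assume "s \<in> S"
    then have "0 < snd s" by (auto simp: S_def)
    then have "measure_pmf.prob (generations L tmax \<eta> \<gamma> \<tau> c s (Suc l)) (Pair s -` ?A) = ?p s"
      using generations_root_survival[of s c L tmax \<eta> \<gamma> \<tau> l] \<open>c \<ge> 0\<close>
      by (simp add: vimage_def S_def \<mu>_def del: generations.simps)
    then show "measure_pmf.prob (generations L tmax \<eta> \<gamma> \<tau> c s (Suc l)) (Pair s -` ?A) * pmf (root_type \<gamma> \<tau>) s
        = pmf \<gamma> (fst s) * pmf (\<tau> (fst s)) (snd s) * ?p s"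
      using root[of "fst s" "snd s"] by simp
  qed
  finally show ?thesis .
qed

subsection \<open>The residual graph\<close>

text \<open>The thresholds \<open>\<theta> u\<close> depend on the vertex \<open>u\<close> under
  test: each \<open>u\<close> is counted as if only its own threshold had been lowered, although all
  tests run on the same graph.\<close>

definition survivors :: "nat \<Rightarrow> nat set \<Rightarrow> (nat \<Rightarrow> nat \<Rightarrow> nat) \<Rightarrow> nat \<Rightarrow> nat set set \<Rightarrow> real" where
  "survivors D U \<theta> k E = real (card {u \<in> U. alive E (trunc D E (\<theta> u)) k u})"

lemma card_diff_le:
  assumes "finite U" "finite {u. P u \<noteq> Q u}"
  shows "\<bar>real (card {u \<in> U. P u}) - real (card {u \<in> U. Q u})\<bar> \<le> real (card {u. P u \<noteq> Q u})"
proof -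
  have *: "card {u \<in> U. P u} \<le> card {u \<in> U. Q u} + card {u. P u \<noteq> Q u}"
    if "finite {u. P u \<noteq> Q u}" for P Q
  proof -
    have "card {u \<in> U. P u} \<le> card ({u \<in> U. Q u} \<union> {u. P u \<noteq> Q u})"
      using assms(1) that by (intro card_mono) auto
    then show ?thesis using card_Un_le order_trans by blast
  qed
  have sw: "{u. Q u \<noteq> P u} = {u. P u \<noteq> Q u}" by auto
  show ?thesis using *[of P Q] *[of Q P] assms(2) sw by (simp add: abs_le_iff)
qed

lemma prob_diff_le:
  assumes "\<And>x. x \<notin> B \<Longrightarrow> x \<in> A \<longleftrightarrow> x \<in> A'"
  shows "\<bar>measure_pmf.prob M A - measure_pmf.prob M A'\<bar> \<le> measure_pmf.prob M B"
proof -
  have *: "measure_pmf.prob M A \<le> measure_pmf.prob M A' + measure_pmf.prob M B"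
    if "A \<subseteq> A' \<union> B" for A A'
  proof -
    have "measure_pmf.prob M A \<le> measure_pmf.prob M (A' \<union> B)"
      using that by (intro measure_pmf.finite_measure_mono) auto
    also have "\<dots> \<le> measure_pmf.prob M A' + measure_pmf.prob M B"
      by (intro measure_Un_le) auto
    finally show ?thesis .
  qed
  have "A \<subseteq> A' \<union> B" "A' \<subseteq> A \<union> B" using assms by auto
  then show ?thesis using *[of A A'] *[of A' A] by linarith
qed

locale erasure_graph =
  fixes \<eta> :: "nat \<Rightarrow> nat \<Rightarrow> nat" and n :: nat and pos :: "nat \<Rightarrow> nat" and c :: real
  assumes n_pos: "0 < n" and c_pos: "0 < c" and c_le: "c \<le> real n"
    and sym: "\<And>k m. k \<in> {1..n} \<Longrightarrow> m \<in> {1..n} \<Longrightarrow> \<eta> (pos k) (pos m) = \<eta> (pos m) (pos k)"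
begin

definition "p = c / real n"
definition "bits = code_bits \<eta> n pos"
definition "\<P> = erasures \<eta> (c / real n) n pos"
definition G :: "(nat set \<Rightarrow> bool) \<Rightarrow> nat set set" where "G x = {e \<in> bits. x e}"
definition compat :: "nat \<Rightarrow> nat set" where "compat v = {u \<in> {1..n}. u \<noteq> v \<and> \<eta> (pos v) (pos u) = 1}"
definition star :: "nat \<Rightarrow> nat set set" where "star v = {e \<in> bits. v \<in> e}"

lemma p_bounds: "0 \<le> p" "p \<le> 1"
  using n_pos c_pos c_le by (auto simp: p_def)

lemma n_p: "real n * p = c"
  using n_pos by (simp add: p_def)

lemma P_eq: "\<P> = Pi_pmf bits False (\<lambda>_. bernoulli_pmf p)"
  by (simp add: \<P>_def erasures_def bits_def p_def)

lemma bits_subset: "bits \<subseteq> (\<lambda>(k, m). {k, m}) ` ({1..n} \<times> {1..n})"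
  by (auto simp: bits_def code_bits_def)

lemma bits_pair: "e \<in> bits \<Longrightarrow> \<exists>a b. e = {a, b}"
  by (auto simp: bits_def code_bits_def)

lemma finite_bits [simp]: "finite bits"
  by (rule finite_subset[OF bits_subset]) auto

lemma card_bits: "card bits \<le> n * n"
  using card_mono[OF _ bits_subset] card_image_le[of "{1..n} \<times> {1..n}" "\<lambda>(k, m). {k, m}"] by simp

lemma mem_bits: "v \<in> {1..n} \<Longrightarrow> {v, u} \<in> bits \<longleftrightarrow> u \<in> compat v"
  using sym by (auto simp: bits_def code_bits_def compat_def doubleton_eq_iff)

lemma finite_G [simp]: "finite (G x)"
  by (simp add: G_def)

lemma nbrs_G: "v \<in> {1..n} \<Longrightarrow> nbrs (G x) v = {u \<in> compat v. x {v, u}}"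
  by (auto simp: nbrs_def G_def mem_bits)

lemma nbrs_G_outside: "v \<notin> {1..n} \<Longrightarrow> nbrs (G x) v = {}"
  by (auto simp: nbrs_def G_def bits_def code_bits_def doubleton_eq_iff)

lemma star_eq: "v \<in> {1..n} \<Longrightarrow> star v = (\<lambda>u. {v, u}) ` compat v"
proof (intro equalityI subsetI)
  fix e assume v: "v \<in> {1..n}" and e: "e \<in> star v"
  then obtain k m where "e = {k, m}" using bits_subset by (auto simp: star_def)
  then obtain u where "e = {v, u}" using e by (auto simp: star_def)
  then show "e \<in> (\<lambda>u. {v, u}) ` compat v" using e mem_bits[OF v] by (auto simp: star_def)
qed (auto simp: star_def mem_bits)

lemma finite_compat [simp]: "finite (compat v)"
  by (simp add: compat_def)

lemma card_compat: "card (compat v) \<le> n"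
proof -
  have "compat v \<subseteq> {1..n}" by (auto simp: compat_def)
  then show ?thesis using card_mono[of "{1..n}" "compat v"] by simp
qed

lemma inj_doubleton: "inj_on (\<lambda>u. {v, u}) A"
  by (auto simp: inj_on_def doubleton_eq_iff)

lemma card_nbrs_G: "v \<in> {1..n} \<Longrightarrow> card (nbrs (G x) v) = card {e \<in> star v. x e}"
proof -
  assume v: "v \<in> {1..n}"
  have "{e \<in> star v. x e} = (\<lambda>u. {v, u}) ` nbrs (G x) v"
    using v by (auto simp: star_eq nbrs_G)
  then show ?thesis by (simp add: card_image[OF inj_doubleton])
qed

lemma integrable_P [intro, simp]:
  fixes f :: "_ \<Rightarrow> real" shows "integrable (measure_pmf \<P>) f"
  unfolding P_eq by (intro integrable_Pi_pmf_bool) simp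

definition high_degree :: "nat \<Rightarrow> (nat set \<Rightarrow> bool) set" where
  "high_degree D = {x. \<exists>v. card (nbrs (G x) v) > D}"

text \<open>A union bound over the Chernoff bounds for the single degrees: a vertex meets at most
  \<open>n\<close> bits, so its expected degree is at most \<open>n * p = c\<close>.\<close>

lemma prob_high_degree: "measure_pmf.prob \<P> (high_degree D) \<le> real n * exp (2 * c - real D)"
proof -
  have "high_degree D \<subseteq> (\<Union>v\<in>{1..n}. {x. card {e \<in> star v. x e} > D})"
  proof
    fix x assume "x \<in> high_degree D"
    then obtain v where v: "card (nbrs (G x) v) > D" by (auto simp: high_degree_def)
    then have "v \<in> {1..n}" using nbrs_G_outside[of v x] by (metis card.empty not_less_zero)
    then show "x \<in> (\<Union>v\<in>{1..n}. {x. card {e \<in> star v. x e} > D})" using v card_nbrs_G by auto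
  qed
  then have "measure_pmf.prob \<P> (high_degree D) \<le> measure_pmf.prob \<P> (\<Union>v\<in>{1..n}. {x. card {e \<in> star v. x e} > D})"
    by (intro measure_pmf.finite_measure_mono) auto
  also have "\<dots> \<le> (\<Sum>v\<in>{1..n}. measure_pmf.prob \<P> {x. card {e \<in> star v. x e} > D})"
    by (intro measure_pmf.finite_measure_subadditive_finite) auto
  also have "\<dots> \<le> (\<Sum>v\<in>{1..n}. exp (2 * c - real D))"
  proof (intro sum_mono)
    fix v assume v: "v \<in> {1..n}"
    have "measure_pmf.prob \<P> {x. card {e \<in> star v. x e} > D} \<le> exp (2 * p * real (card (star v)) - real D)"
      unfolding P_eq by (intro card_bits_tail p_bounds) (auto simp: star_def)
    also have "p * real (card (star v)) \<le> c"
    proof -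
      have "card (star v) \<le> n"
        using card_image_le[of "compat v" "\<lambda>u. {v, u}"] card_compat[of v] by (simp add: star_eq[OF v])
      then have "p * real (card (star v)) \<le> p * real n" using p_bounds by (intro mult_left_mono) auto
      then show ?thesis using n_p by (simp add: mult.commute)
    qed
    then have "exp (2 * p * real (card (star v)) - real D) \<le> exp (2 * c - real D)" by simp
    finally show "measure_pmf.prob \<P> {x. card {e \<in> star v. x e} > D} \<le> exp (2 * c - real D)" .
  qed
  finally show ?thesis by simp
qed

subsection \<open>Concentration of the truncated counts\<close>

lemma survivors_edges:
  assumes "finite U" "finite E" "finite F" "F \<subseteq> bits"
  shows "\<bar>survivors D U \<theta> k E - survivors D U \<theta> k (E \<union> F)\<bar> \<le> real (card F) * (2 * (real D + 2) ^ k)"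
proof -
  let ?X = "{u. alive E (trunc D E (\<theta> u)) k u \<noteq> alive (E \<union> F) (trunc D (E \<union> F) (\<theta> u)) k u}"
  have X: "finite ?X \<and> card ?X \<le> card F * (2 * (D + 2) ^ k)"
    using assms(4) bits_pair by (intro alive_trunc_edges_change[OF assms(2,3)]) blast
  then have "real (card ?X) \<le> real (card F * (2 * (D + 2) ^ k))" by (simp only: of_nat_le_iff)
  also have "\<dots> = real (card F) * (2 * (real D + 2) ^ k)" by (simp add: add.commute)
  finally have "real (card ?X) \<le> real (card F) * (2 * (real D + 2) ^ k)" .
  then show ?thesis
    unfolding survivors_def by (rule order_trans[OF card_diff_le[OF assms(1) conjunct1[OF X]]])
qed

lemma survivors_tail:
  fixes D k :: nat and \<theta> :: "nat \<Rightarrow> nat \<Rightarrow> nat" and U :: "nat set" and \<epsilon> :: real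
  assumes "U \<subseteq> {1..n}" "0 < \<epsilon>"
  defines "\<kappa> \<equiv> min 1 (\<epsilon> / (2 * c))" and "f \<equiv> \<lambda>x. survivors D U \<theta> k (G x)"
  shows "measure_pmf.prob \<P> {x. \<bar>f x - measure_pmf.expectation \<P> f\<bar> > \<epsilon> * real n}
           \<le> 2 * exp (- (\<kappa> * \<epsilon> * real n / (8 * (real D + 2) ^ (2 * k))))"
proof -
  define B where "B = 2 * (real D + 2) ^ k"
  have B1: "1 \<le> B"
    using one_le_power[of "real D + 2" k] unfolding B_def by linarith
  have B2: "B\<^sup>2 = 4 * (real D + 2) ^ (2 * k)"
    by (simp add: B_def power_mult_distrib power_mult mult.commute[of 2 k])
  have \<kappa>: "0 < \<kappa>" "\<kappa> \<le> 1" "c * \<kappa> \<le> \<epsilon> / 2"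
    using assms(2) c_pos by (auto simp: \<kappa>_def min_def field_simps)
  \<comment> \<open>\<open>B\<close> bounds the effect of one bit. Since
    \<open>\<kappa> \<le> 1\<close> and \<open>B \<ge> 1\<close>, this \<open>s\<close> satisfies
    \<open>s * B \<le> 1\<close>; since \<open>c * \<kappa> \<le> \<epsilon> / 2\<close>, the
    quadratic term is at most half of the linear term \<open>s * \<epsilon> * n\<close>.\<close>
  define s where "s = \<kappa> / B\<^sup>2"
  have s: "0 \<le> s" "s * B \<le> 1"
  proof -
    show "0 \<le> s" using \<kappa> by (simp add: s_def)
    have "s * B = \<kappa> / B" using B1 by (simp add: s_def power2_eq_square)
    also have "\<dots> \<le> 1" using \<kappa> B1 by (simp add: divide_le_eq)
    finally show "s * B \<le> 1" .
  qed
  have "measure_pmf.prob \<P> {x. \<bar>f x - measure_pmf.expectation \<P> f\<bar> > \<epsilon> * real n}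
      \<le> 2 * exp (real (card bits) * (p * s\<^sup>2 * B\<^sup>2) - s * (\<epsilon> * real n))"
    unfolding P_eq
  proof (rule bounded_differences_tail[OF finite_bits p_bounds s])
    fix x e assume e: "e \<in> bits"
    have G1: "G (x(e := True)) = G (x(e := False)) \<union> {e}" using e by (auto simp: G_def)
    show "\<bar>f (x(e := True)) - f (x(e := False))\<bar> \<le> B"
      unfolding f_def G1 B_def
      using survivors_edges[OF finite_subset[OF assms(1)] finite_G, of "{e}" D \<theta> k "x(e := False)"] e
      unfolding abs_minus_commute[of "survivors D U \<theta> k (G (x(e := False)) \<union> {e})"] by simp
  qed
  also have "real (card bits) * (p * s\<^sup>2 * B\<^sup>2) - s * (\<epsilon> * real n) \<le> - (\<kappa> * \<epsilon> * real n / (2 * B\<^sup>2))"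
  proof -
    have "real (card bits) \<le> real n * real n" using card_bits unfolding of_nat_mult[symmetric] of_nat_le_iff .
    then have "real (card bits) * (p * s\<^sup>2 * B\<^sup>2) \<le> real n * real n * (p * s\<^sup>2 * B\<^sup>2)"
      using p_bounds by (intro mult_right_mono) auto
    also have "\<dots> = real n * (real n * p) * (s * (s * B\<^sup>2))" by (simp add: power2_eq_square)
    also have "\<dots> = real n * s * (c * \<kappa>)" unfolding n_p using B1 by (simp add: s_def)
    also have "\<dots> \<le> real n * s * (\<epsilon> / 2)" using \<kappa> s by (intro mult_left_mono) auto
    finally have "real (card bits) * (p * s\<^sup>2 * B\<^sup>2) - s * (\<epsilon> * real n) \<le> - (s * \<epsilon> * real n / 2)"
      by (simp add: algebra_simps)
    also have "s * \<epsilon> * real n / 2 = \<kappa> * \<epsilon> * real n / (2 * B\<^sup>2)" by (simp add: s_def)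
    finally show ?thesis .
  qed
  finally show ?thesis by (simp add: B2)
qed

subsection \<open>Deleting one vertex\<close>

definition nbhd :: "nat \<Rightarrow> (nat set \<Rightarrow> bool) \<Rightarrow> nat set" where
  "nbhd v x = {u \<in> compat v. x {v, u}}"

definition without :: "nat \<Rightarrow> (nat set \<Rightarrow> bool) \<Rightarrow> nat set set" where
  "without v x = {e \<in> G x. v \<notin> e}"

lemma finite_nbhd [simp]: "finite (nbhd v x)"
  by (simp add: nbhd_def)

text \<open>The neighbourhood of \<open>v\<close> is independent of the graph without \<open>v\<close>: it may be resampled.\<close>

lemma prob_resample:
  assumes v: "v \<in> {1..n}"
  shows "measure_pmf.prob \<P> {x. R (without v x) (nbhd v x)} =
         measure_pmf.expectation \<P> (\<lambda>x. measure_pmf.prob \<P> {x'. R (without v x) (nbhd v x')})"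
proof -
  \<comment> \<open>\<open>M x x'\<close> takes the bits at \<open>v\<close> from \<open>x'\<close>
    and all others from \<open>x\<close>. The redundant nested conditionals reproduce the form in
    which \<open>Pi_pmf_subset\<close> delivers the two restrictions.\<close>
  define M :: "(nat set \<Rightarrow> bool) \<Rightarrow> (nat set \<Rightarrow> bool) \<Rightarrow> nat set \<Rightarrow> bool"
    where "M x x' = (\<lambda>e. if e \<in> star v then (if e \<in> star v then x' e else False)
      else (if e \<in> bits - star v then x e else False))" for x x'
  have star: "star v \<subseteq> bits" by (auto simp: star_def)
  have un: "bits = star v \<union> (bits - star v)" using star by auto
  let ?q = "\<lambda>_ :: nat set. bernoulli_pmf p"
  have "\<P> = map_pmf (\<lambda>(f, g) x. if x \<in> star v then f x else g x)
      (pair_pmf (Pi_pmf (star v) False ?q) (Pi_pmf (bits - star v) False ?q))"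
    unfolding P_eq by (subst un, rule Pi_pmf_union) (auto intro: finite_subset[OF star])
  also have "\<dots> = bind_pmf \<P> (\<lambda>x'. bind_pmf \<P> (\<lambda>x. return_pmf (M x x')))"
    unfolding Pi_pmf_subset[OF finite_bits star] Pi_pmf_subset[OF finite_bits Diff_subset[of bits "star v"]] P_eq[symmetric]
    by (simp add: pair_pmf_def map_pmf_def bind_assoc_pmf bind_return_pmf M_def)
  also have "\<dots> = bind_pmf \<P> (\<lambda>x. map_pmf (M x) \<P>)"
    unfolding map_pmf_def by (rule bind_commute_pmf)
  finally have P: "\<P> = bind_pmf \<P> (\<lambda>x. map_pmf (M x) \<P>)" .
  have "nbhd v (M x x') = nbhd v x'" for x x'
    using mem_bits[OF v] by (auto simp: nbhd_def M_def star_def)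
  moreover have "without v (M x x') = without v x" for x x'
    by (auto simp: without_def G_def M_def star_def)
  ultimately show ?thesis
    by (subst P) (simp add: measure_bind_pmf vimage_def)
qed

lemma nbhd_law:
  assumes v: "v \<in> {1..n}" and C: "C \<subseteq> compat v"
  shows "map_pmf (\<lambda>x. card {u \<in> C. x {v, u}}) \<P> = binomial_pmf (card C) p"
proof -
  let ?A = "(\<lambda>u. {v, u}) ` C"
  have A: "?A \<subseteq> bits" using C mem_bits[OF v] by auto
  have fin: "finite ?A" using A finite_bits by (rule finite_subset)
  have card: "card {e \<in> ?A. x e} = card {u \<in> C. x {v, u}}" for x
  proof -
    have "{e \<in> ?A. x e} = (\<lambda>u. {v, u}) ` {u \<in> C. x {v, u}}" by auto
    then show ?thesis by (simp add: card_image[OF inj_doubleton])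
  qed
  have "binomial_pmf (card C) p = map_pmf (\<lambda>x. card {e \<in> ?A. x e}) (Pi_pmf ?A False (\<lambda>_. bernoulli_pmf p))"
    using fin p_bounds by (intro binomial_pmf_altdef') (auto simp: card_image[OF inj_doubleton])
  also have "\<dots> = map_pmf (\<lambda>x. card {e \<in> ?A. x e}) \<P>"
    unfolding Pi_pmf_subset[OF finite_bits A] P_eq pmf.map_comp o_def
    by (intro map_pmf_cong refl arg_cong[where f = card]) auto
  finally show ?thesis unfolding card by simp
qed

lemma prob_two_nbrs:
  assumes v: "v \<in> {1..n}" and "u \<in> compat v" "w \<in> compat v" "u \<noteq> w"
  shows "measure_pmf.prob \<P> {x. u \<in> nbhd v x \<and> w \<in> nbhd v x} = p\<^sup>2"
proof -
  have "{x. u \<in> nbhd v x \<and> w \<in> nbhd v x} = (\<lambda>x. card {y \<in> {u, w}. x {v, y}}) -` {2}"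
  proof (intro set_eqI)
    fix x
    have "{y \<in> {u, w}. x {v, y}} = (if x {v, u} then {u} else {}) \<union> (if x {v, w} then {w} else {})"
      by auto
    then show "x \<in> {x. u \<in> nbhd v x \<and> w \<in> nbhd v x} \<longleftrightarrow> x \<in> (\<lambda>x. card {y \<in> {u, w}. x {v, y}}) -` {2}"
      using assms by (simp add: nbhd_def)
  qed
  then have "measure_pmf.prob \<P> {x. u \<in> nbhd v x \<and> w \<in> nbhd v x}
      = pmf (binomial_pmf (card {u, w}) p) 2"
    using nbhd_law[OF v, of "{u, w}"] assms by (simp flip: measure_pmf_single measure_map_pmf)
  then show ?thesis using assms p_bounds by (simp add: power2_eq_square numeral_2_eq_2)
qed

lemma expectation_degree:
  assumes v: "v \<in> {1..n}"
  shows "measure_pmf.expectation \<P> (\<lambda>x. real (card (nbhd v x))) \<le> c"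
proof -
  have "real (card (nbhd v x)) = (\<Sum>u\<in>compat v. of_bool (x {v, u}))" for x
    by (simp add: nbhd_def Collect_conj_eq[symmetric] Int_def)
  then have "measure_pmf.expectation \<P> (\<lambda>x. real (card (nbhd v x)))
      = measure_pmf.expectation \<P> (\<lambda>x. \<Sum>u\<in>compat v. of_bool (x {v, u}))"
    by (simp only:)
  also have "\<dots> = (\<Sum>u\<in>compat v. measure_pmf.expectation \<P> (\<lambda>x. of_bool (x {v, u})))"
    by (rule Bochner_Integration.integral_sum) simp
  also have "\<dots> = (\<Sum>u\<in>compat v. p)"
  proof (intro sum.cong refl)
    fix u assume u: "u \<in> compat v"
    have "measure_pmf.expectation \<P> (\<lambda>x. of_bool (x {v, u}) :: real)
        = measure_pmf.expectation (map_pmf (\<lambda>x. x {v, u}) \<P>) of_bool"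
      by (rule integral_map_pmf[symmetric])
    also have "map_pmf (\<lambda>x. x {v, u}) \<P> = bernoulli_pmf p"
      unfolding P_eq using u mem_bits[OF v] by (simp add: Pi_pmf_component)
    finally show "measure_pmf.expectation \<P> (\<lambda>x. of_bool (x {v, u})) = p"
      using p_bounds by simp
  qed
  also have "\<dots> = real (card (compat v)) * p" by simp
  also have "\<dots> \<le> real n * p" using card_compat p_bounds by (intro mult_right_mono) auto
  finally show ?thesis using n_p by simp
qed

text \<open>A vertex influencing another one while both are adjacent to \<open>v\<close> creates a short cycle.\<close>

definition entangled :: "nat \<Rightarrow> nat \<Rightarrow> nat \<Rightarrow> (nat set \<Rightarrow> bool) set" where
  "entangled D k v = {x. \<exists>w\<in>nbhd v x. \<exists>u\<in>nbhd v x. u \<noteq> w \<and>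
     u \<in> infl {y. card (nbrs (without v x) y) \<le> D} (without v x) {w} k}"

lemma finite_without [simp]: "finite (without v x)"
  by (simp add: without_def)

text \<open>After resampling, the influence sets belong to a frozen graph and the neighbourhood is
  fresh. There are at most \<open>n\<close> choices of \<open>w\<close>, each influencing at most
  \<open>(D + 2) ^ k\<close> vertices \<open>u\<close>, and both are adjacent to \<open>v\<close>
  with probability \<open>p\<^sup>2\<close>.\<close>

lemma prob_entangled:
  assumes v: "v \<in> {1..n}"
  shows "measure_pmf.prob \<P> (entangled D k v) \<le> c\<^sup>2 * (real D + 2) ^ k / real n"
proof -
  define I where "I E w = infl {y. card (nbrs E y) \<le> D} E {w} k" for E :: "nat set set" and w
  have bound: "measure_pmf.prob \<P> {x'. \<exists>w\<in>nbhd v x'. \<exists>u\<in>nbhd v x'. u \<noteq> w \<and> u \<in> I (without v x) w}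
      \<le> c\<^sup>2 * (real D + 2) ^ k / real n" for x
  proof -
    let ?E = "without v x"
    have I: "finite (I ?E w) \<and> card (I ?E w) \<le> (D + 2) ^ k" for w
      using card_infl[of ?E "{w}" "{y. card (nbrs ?E y) \<le> D}" D k] by (simp add: I_def)
    have "measure_pmf.prob \<P> {x'. \<exists>w\<in>nbhd v x'. \<exists>u\<in>nbhd v x'. u \<noteq> w \<and> u \<in> I ?E w}
        \<le> measure_pmf.prob \<P> (\<Union>w\<in>compat v. \<Union>u\<in>{u \<in> compat v. u \<noteq> w \<and> u \<in> I ?E w}.
            {x'. u \<in> nbhd v x' \<and> w \<in> nbhd v x'})"
      by (intro measure_pmf.finite_measure_mono) (auto simp: nbhd_def)
    also have "\<dots> \<le> (\<Sum>w\<in>compat v. measure_pmf.prob \<P> (\<Union>u\<in>{u \<in> compat v. u \<noteq> w \<and> u \<in> I ?E w}.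
            {x'. u \<in> nbhd v x' \<and> w \<in> nbhd v x'}))"
      by (intro measure_pmf.finite_measure_subadditive_finite) auto
    also have "\<dots> \<le> (\<Sum>w\<in>compat v. \<Sum>u\<in>{u \<in> compat v. u \<noteq> w \<and> u \<in> I ?E w}.
        measure_pmf.prob \<P> {x'. u \<in> nbhd v x' \<and> w \<in> nbhd v x'})"
      by (intro sum_mono measure_pmf.finite_measure_subadditive_finite) auto
    also have "\<dots> = (\<Sum>w\<in>compat v. real (card {u \<in> compat v. u \<noteq> w \<and> u \<in> I ?E w}) * p\<^sup>2)"
      using prob_two_nbrs[OF v] by (intro sum.cong refl) simp
    also have "\<dots> \<le> (\<Sum>w\<in>compat v. (real D + 2) ^ k * p\<^sup>2)"
    proof (intro sum_mono mult_right_mono)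
      fix w
      have "card {u \<in> compat v. u \<noteq> w \<and> u \<in> I ?E w} \<le> card (I ?E w)"
        using I by (intro card_mono) auto
      also have "\<dots> \<le> (D + 2) ^ k" using I by simp
      finally have "real (card {u \<in> compat v. u \<noteq> w \<and> u \<in> I ?E w}) \<le> real ((D + 2) ^ k)"
        by (simp only: of_nat_le_iff)
      then show "real (card {u \<in> compat v. u \<noteq> w \<and> u \<in> I ?E w}) \<le> (real D + 2) ^ k"
        by (simp add: add.commute)
    qed simp
    also have "\<dots> = real (card (compat v)) * ((real D + 2) ^ k * p\<^sup>2)" by simp
    also have "\<dots> \<le> real n * ((real D + 2) ^ k * p\<^sup>2)"
      using card_compat[of v] by (intro mult_right_mono) auto
    also have "\<dots> = c\<^sup>2 * (real D + 2) ^ k / real n"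
      using n_pos by (simp add: p_def power2_eq_square)
    finally show ?thesis .
  qed
  have "measure_pmf.prob \<P> (entangled D k v) = measure_pmf.expectation \<P> (\<lambda>x.
      measure_pmf.prob \<P> {x'. \<exists>w\<in>nbhd v x'. \<exists>u\<in>nbhd v x'. u \<noteq> w \<and> u \<in> I (without v x) w})"
    unfolding entangled_def I_def
    by (rule prob_resample[OF v, where R = "\<lambda>E N. \<exists>w\<in>N. \<exists>u\<in>N. u \<noteq> w \<and>
          u \<in> infl {y. card (nbrs E y) \<le> D} E {w} k"])
  also have "\<dots> \<le> c\<^sup>2 * (real D + 2) ^ k / real n"
    by (intro measure_pmf.integral_le_const integrable_P AE_pmfI bound)
  finally show ?thesis .
qed

text \<open>Outside the two exceptional events the truncation is vacuous, and lowering all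
  neighbours of \<open>v\<close> at once has the same effect on a neighbour \<open>u\<close> as
  lowering \<open>u\<close> alone. The tested vertex \<open>v\<close> may have its own threshold
  \<open>\<theta>0 v\<close>: the original one for the observed failure, the lowered one inside the
  recursion.\<close>

lemma alive_cavity_truncated:
  assumes v: "v \<in> {1..n}" and x: "x \<notin> high_degree D" "x \<notin> entangled D k v"
    and \<theta>: "\<And>u. u \<noteq> v \<Longrightarrow> \<theta>0 u = \<theta> u"
  shows "alive (G x) \<theta>0 (Suc k) v \<longleftrightarrow> \<theta>0 v \<le> card {u \<in> nbhd v x.
     alive (without v x) (trunc D (without v x) (\<theta>(u := \<theta> u - 1))) k u}"
proof -
  let ?E = "without v x"
  let ?\<theta>' = "\<lambda>u. if u \<in> nbhd v x then \<theta>0 u - 1 else \<theta>0 u"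
  have nb: "nbrs (G x) v = nbhd v x" using nbrs_G[OF v] by (simp add: nbhd_def)
  have loop: "{v} \<notin> G x" using mem_bits[OF v, of v] by (auto simp: G_def compat_def)
  have deg: "card (nbrs ?E u) \<le> D" for u
  proof -
    have "card (nbrs ?E u) \<le> card (nbrs (G x) u)"
      using finite_nbrs[OF finite_G] by (intro card_mono) (auto simp: nbrs_def without_def)
    also have "\<dots> \<le> D" using x(1) by (simp add: high_degree_def not_less)
    finally show ?thesis .
  qed
  have tr: "trunc D ?E \<theta>' = \<theta>'" for \<theta>' by (rule trunc_id[OF deg])
  have iso: "nbrs ?E v = {}" by (auto simp: nbrs_def without_def)
  have same: "alive ?E ?\<theta>' k u = alive ?E (\<theta>(u := \<theta> u - 1)) k u" if u: "u \<in> nbhd v x" for u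
  proof (rule ccontr)
    \<comment> \<open>The two threshold functions agree outside \<open>?A\<close>. Influence from
      \<open>v\<close> is impossible since \<open>v\<close> is isolated after its deletion, and
      influence from another neighbour would mean entanglement.\<close>
    let ?A = "insert v (nbhd v x - {u})"
    assume "alive ?E ?\<theta>' k u \<noteq> alive ?E (\<theta>(u := \<theta> u - 1)) k u"
    then have neq: "alive ?E (trunc D ?E ?\<theta>') k u \<noteq> alive ?E (trunc D ?E (\<theta>(u := \<theta> u - 1))) k u"
      unfolding tr .
    have uv: "u \<noteq> v" using u by (auto simp: nbhd_def compat_def)
    have "u \<in> infl {w. card (nbrs ?E w) \<le> D} ?E ?A k"
    proof (rule alive_trunc_cap_change[OF finite_without _ neq])
      fix w assume w: "w \<notin> ?A"
      then have "\<theta>0 w = \<theta> w" by (intro \<theta>) simp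
      then show "?\<theta>' w = (\<theta>(u := \<theta> u - 1)) w" using w u by (cases "w = u") auto
    qed
    from infl_singletons[OF this]
    obtain a where a: "a \<in> ?A" "u \<in> infl {w. card (nbrs ?E w) \<le> D} ?E {a} k" ..
    show False
    proof (cases "a = v")
      case True
      then show False using subsetD[OF infl_isolated[OF iso] a(2)[unfolded True]] uv by simp
    next
      case False
      then have a': "a \<in> nbhd v x" "u \<noteq> a" using a(1) by auto
      have "x \<in> entangled D k v"
        unfolding entangled_def mem_Collect_eq using a' u a(2) by (intro bexI[of _ a] bexI[of _ u] conjI)
      then show False using x(2) by simp
    qed
  qed
  have "alive (G x) \<theta>0 (Suc k) v \<longleftrightarrow> \<theta>0 v \<le> card {u \<in> nbhd v x. alive ?E ?\<theta>' k u}"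
    using alive_cavity[OF finite_G loop, of \<theta>0 k] unfolding nb without_def .
  also have "{u \<in> nbhd v x. alive ?E ?\<theta>' k u}
      = {u \<in> nbhd v x. alive ?E (trunc D ?E (\<theta>(u := \<theta> u - 1))) k u}"
    unfolding tr using same by (intro Collect_cong conj_cong refl)
  finally show ?thesis .
qed

text \<open>The five error terms are, in order: a degree above \<open>D\<close>; entangled
  neighbours; the Poisson approximation; the passage from the graph without \<open>v\<close> to the
  whole graph, together with counting \<open>v\<close> itself; the deviation of the proportion of
  eligible survivors from \<open>m\<close>, converted by the Lipschitz bound.\<close>

lemma cavity_estimate:
  fixes \<theta> \<theta>0 :: "nat \<Rightarrow> nat" and D k v :: nat and m :: real
  assumes v: "v \<in> {1..n}" and \<theta>: "\<And>u. u \<noteq> v \<Longrightarrow> \<theta>0 u = \<theta> u" and m: "0 \<le> m"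
  defines "f \<equiv> \<lambda>x. survivors D {u \<in> {1..n}. \<eta> (pos v) (pos u) = 1} (\<lambda>u. \<theta>(u := \<theta> u - 1)) k (G x)"
  shows "\<bar>measure_pmf.prob \<P> {x. alive (G x) \<theta>0 (Suc k) v} - (1 - poisson_cdf (\<theta>0 v) (c * m))\<bar>
    \<le> real n * exp (2 * c - real D) + c\<^sup>2 * (real D + 2) ^ k / real n + 2 * c\<^sup>2 / real n
      + c * (1 + 2 * c * (real D + 2) ^ k) / real n
      + c * measure_pmf.expectation \<P> (\<lambda>x. \<bar>f x / real n - m\<bar>)"
proof -
  define Q where "Q E = {u. alive E (trunc D E (\<theta>(u := \<theta> u - 1))) k u}" for E :: "nat set set"
  define M where "M x = card (compat v \<inter> Q (without v x))" for x
  let ?r = "\<theta>0 v"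
  define A' where "A' = {x. ?r \<le> card (nbhd v x \<inter> Q (without v x))}"
  have eq: "{u \<in> nbhd v x. alive (without v x) (trunc D (without v x) (\<theta>(u := \<theta> u - 1))) k u}
      = nbhd v x \<inter> Q (without v x)" for x by (auto simp: Q_def)
  have "\<bar>measure_pmf.prob \<P> {x. alive (G x) \<theta>0 (Suc k) v} - measure_pmf.prob \<P> A'\<bar>
      \<le> measure_pmf.prob \<P> (high_degree D \<union> entangled D k v)"
  proof (rule prob_diff_le)
    fix x assume "x \<notin> high_degree D \<union> entangled D k v"
    then have "x \<notin> high_degree D" "x \<notin> entangled D k v" by auto
    from alive_cavity_truncated[OF v this, of \<theta>0 \<theta>, OF \<theta>]
    show "x \<in> {x. alive (G x) \<theta>0 (Suc k) v} \<longleftrightarrow> x \<in> A'"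
      unfolding A'_def mem_Collect_eq eq .
  qed
  also have "\<dots> \<le> measure_pmf.prob \<P> (high_degree D) + measure_pmf.prob \<P> (entangled D k v)"
    by (intro measure_Un_le) auto
  also have "\<dots> \<le> real n * exp (2 * c - real D) + c\<^sup>2 * (real D + 2) ^ k / real n"
    using prob_high_degree prob_entangled[OF v] by (intro add_mono)
  finally have step1: "\<bar>measure_pmf.prob \<P> {x. alive (G x) \<theta>0 (Suc k) v} - measure_pmf.prob \<P> A'\<bar>
      \<le> real n * exp (2 * c - real D) + c\<^sup>2 * (real D + 2) ^ k / real n" .

  \<comment> \<open>With the graph without \<open>v\<close> frozen to \<open>E\<close>, the set
    \<open>Q E\<close> is deterministic, so the number of its members adjacent to \<open>v\<close>
    is binomial.\<close>
  have bin: "measure_pmf.prob \<P> {x'. ?r \<le> card (nbhd v x' \<inter> Q E)}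
      = 1 - measure_pmf.prob (binomial_pmf (card (compat v \<inter> Q E)) p) {..<?r}" for E
  proof -
    have N: "nbhd v x' \<inter> Q E = {u \<in> compat v \<inter> Q E. x' {v, u}}" for x' by (auto simp: nbhd_def)
    have "measure_pmf.prob (binomial_pmf (card (compat v \<inter> Q E)) p) {..<?r}
        = measure_pmf.prob \<P> {x'. card (nbhd v x' \<inter> Q E) < ?r}"
      unfolding N nbhd_law[OF v Int_lower1, symmetric] by (simp add: vimage_def)
    moreover have "{x'. ?r \<le> card (nbhd v x' \<inter> Q E)} = UNIV - {x'. card (nbhd v x' \<inter> Q E) < ?r}"
      by auto
    ultimately show ?thesis
      using measure_pmf.prob_compl[of "{x'. card (nbhd v x' \<inter> Q E) < ?r}" \<P>]
      unfolding space_measure_pmf sets_measure_pmf by simp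
  qed
  have PA': "measure_pmf.prob \<P> A' = measure_pmf.expectation \<P>
      (\<lambda>x. 1 - measure_pmf.prob (binomial_pmf (M x) p) {..<?r})"
    unfolding A'_def M_def bin[symmetric]
    by (rule prob_resample[OF v, where R = "\<lambda>E N. ?r \<le> card (N \<inter> Q E)"])
  have pt: "\<bar>poisson_cdf ?r (c * m) - measure_pmf.prob (binomial_pmf (M x) p) {..<?r}\<bar>
      \<le> 2 * c\<^sup>2 / real n + (c / real n * (1 + real (card (nbhd v x)) * (2 * (real D + 2) ^ k))
         + c * \<bar>f x / real n - m\<bar>)" for x
  proof -
    define U where "U = {u \<in> {1..n}. \<eta> (pos v) (pos u) = 1}"
    let ?\<theta> = "\<lambda>u. \<theta>(u := \<theta> u - 1)"
    have M_le: "real (M x) \<le> real n"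
      using card_mono[of "compat v" "compat v \<inter> Q (without v x)"] card_compat[of v] by (simp add: M_def)
    have M_eq: "real (M x) = survivors D (compat v) ?\<theta> k (without v x)"
      by (simp add: M_def survivors_def Q_def Int_def)
    have G_eq: "G x = without v x \<union> {e \<in> star v. x e}"
      by (auto simp: without_def G_def star_def)
    \<comment> \<open>Restoring \<open>v\<close> adds one edge per neighbour, and each edge changes
      at most \<open>2 * (D + 2) ^ k\<close> tests; later the number of edges is averaged to at most
      \<open>c\<close>.\<close>
    have d1: "\<bar>real (M x) - survivors D (compat v) ?\<theta> k (G x)\<bar> \<le> real (card (nbhd v x)) * (2 * (real D + 2) ^ k)"
    proof -
      have "\<bar>survivors D (compat v) ?\<theta> k (without v x) - survivors D (compat v) ?\<theta> k (without v x \<union> {e \<in> star v. x e})\<bar>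
          \<le> real (card {e \<in> star v. x e}) * (2 * (real D + 2) ^ k)"
        by (intro survivors_edges) (auto simp: star_def)
      moreover have "card {e \<in> star v. x e} = card (nbhd v x)"
        using card_nbrs_G[OF v, of x] nbrs_G[OF v, of x] by (simp add: nbhd_def)
      ultimately show ?thesis unfolding M_eq G_eq[symmetric] by simp
    qed
    \<comment> \<open>\<open>compat v\<close> excludes only \<open>v\<close> from the vertices at
      compatible positions. The count \<open>f\<close> over positions depends on \<open>v\<close>
      only through \<open>pos v\<close>, so that its limit can be shared by all vertices at that
      position.\<close>
    have d2: "\<bar>survivors D (compat v) ?\<theta> k (G x) - f x\<bar> \<le> 1"
    proof -
      let ?a = "\<lambda>u. alive (G x) (trunc D (G x) (?\<theta> u)) k u"
      have "{u \<in> compat v. ?a u} \<subseteq> {u \<in> U. ?a u}" "{u \<in> U. ?a u} \<subseteq> insert v {u \<in> compat v. ?a u}"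
        by (auto simp: compat_def U_def)
      then have "card {u \<in> compat v. ?a u} \<le> card {u \<in> U. ?a u}"
        "card {u \<in> U. ?a u} \<le> card (insert v {u \<in> compat v. ?a u})"
        by (intro card_mono; auto simp: U_def)+
      moreover have "card (insert v {u \<in> compat v. ?a u}) \<le> Suc (card {u \<in> compat v. ?a u})"
        by (simp add: card_insert_if)
      ultimately show ?thesis unfolding f_def U_def[symmetric] survivors_def by linarith
    qed
    have "\<bar>poisson_cdf ?r (real (M x) * p) - measure_pmf.prob (binomial_pmf (M x) p) {..<?r}\<bar>
        \<le> 2 * real (M x) * p\<^sup>2"
      using binomial_poisson_approx[OF p_bounds] by (simp add: abs_minus_commute)
    also have "\<dots> \<le> 2 * real n * p\<^sup>2" using M_le by (intro mult_right_mono) auto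
    also have "\<dots> = 2 * c\<^sup>2 / real n" using n_pos by (simp add: p_def power2_eq_square)
    finally have a: "\<bar>poisson_cdf ?r (real (M x) * p) - measure_pmf.prob (binomial_pmf (M x) p) {..<?r}\<bar>
        \<le> 2 * c\<^sup>2 / real n" .
    have "\<bar>poisson_cdf ?r (c * m) - poisson_cdf ?r (real (M x) * p)\<bar> \<le> \<bar>c * m - real (M x) * p\<bar>"
      using m c_pos p_bounds by (intro poisson_cdf_lipschitz) auto
    also have "\<dots> = \<bar>c / real n * (real (M x) - f x) + c * (f x / real n - m)\<bar>"
      unfolding abs_minus_commute[of "c * m"] by (simp add: p_def algebra_simps diff_divide_distrib)
    also have "\<dots> \<le> c / real n * \<bar>real (M x) - f x\<bar> + c * \<bar>f x / real n - m\<bar>"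
      using c_pos by (intro order_trans[OF abs_triangle_ineq]) (simp add: abs_mult)
    also have "\<dots> \<le> c / real n * (1 + real (card (nbhd v x)) * (2 * (real D + 2) ^ k)) + c * \<bar>f x / real n - m\<bar>"
      using d1 d2 c_pos by (intro add_right_mono mult_left_mono) auto
    finally show ?thesis using a by linarith
  qed
  have "\<bar>measure_pmf.prob \<P> A' - (1 - poisson_cdf ?r (c * m))\<bar>
      = \<bar>measure_pmf.expectation \<P> (\<lambda>x. poisson_cdf ?r (c * m) - measure_pmf.prob (binomial_pmf (M x) p) {..<?r})\<bar>"
    unfolding PA' by simp
  also have "\<dots> \<le> measure_pmf.expectation \<P> (\<lambda>x. \<bar>poisson_cdf ?r (c * m) - measure_pmf.prob (binomial_pmf (M x) p) {..<?r}\<bar>)"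
    by (rule integral_abs_bound)
  also have "\<dots> \<le> measure_pmf.expectation \<P> (\<lambda>x. 2 * c\<^sup>2 / real n
      + (c / real n * (1 + real (card (nbhd v x)) * (2 * (real D + 2) ^ k)) + c * \<bar>f x / real n - m\<bar>))"
    using pt by (intro integral_mono integrable_P)
  also have "\<dots> = 2 * c\<^sup>2 / real n + (c / real n * (1 + measure_pmf.expectation \<P> (\<lambda>x. real (card (nbhd v x))) * (2 * (real D + 2) ^ k))
      + c * measure_pmf.expectation \<P> (\<lambda>x. \<bar>f x / real n - m\<bar>))"
    by simp
  also have "\<dots> \<le> 2 * c\<^sup>2 / real n + (c / real n * (1 + c * (2 * (real D + 2) ^ k))
      + c * measure_pmf.expectation \<P> (\<lambda>x. \<bar>f x / real n - m\<bar>))"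
    using expectation_degree[OF v] c_pos
    by (intro add_left_mono add_right_mono mult_left_mono mult_right_mono) auto
  finally have step2: "\<bar>measure_pmf.prob \<P> A' - (1 - poisson_cdf ?r (c * m))\<bar>
      \<le> 2 * c\<^sup>2 / real n + (c * (1 + 2 * c * (real D + 2) ^ k) / real n
      + c * measure_pmf.expectation \<P> (\<lambda>x. \<bar>f x / real n - m\<bar>))"
    by (simp add: mult_ac)
  show ?thesis using step1 step2 by linarith
qed

section \<open>Truncated versus true counts\<close>

lemma survivors_untruncated:
  assumes "x \<notin> high_degree D"
  shows "survivors D U \<theta> k (G x) = real (card {u \<in> U. alive (G x) (\<theta> u) k u})"
proof -
  have "trunc D (G x) (\<theta> u) = \<theta> u" for u
    using assms by (intro trunc_id) (simp add: high_degree_def not_less)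
  then show ?thesis by (simp add: survivors_def)
qed

lemma survivors_bounds:
  assumes "U \<subseteq> {1..n}"
  shows "0 \<le> survivors D U \<theta> k E" "survivors D U \<theta> k E \<le> real n"
proof -
  have "card {u \<in> U. alive E (trunc D E (\<theta> u)) k u} \<le> card {1..n}"
    using assms by (intro card_mono) auto
  then show "survivors D U \<theta> k E \<le> real n" by (simp add: survivors_def)
qed (simp add: survivors_def)

lemma expectation_card:
  assumes "finite U"
  shows "measure_pmf.expectation \<P> (\<lambda>x. real (card {u \<in> U. R x u})) =
         (\<Sum>u\<in>U. measure_pmf.prob \<P> {x. R x u})"
proof -
  have "real (card {u \<in> U. R x u}) = (\<Sum>u\<in>U. indicator {x. R x u} x)" for x
    using assms by (simp add: indicator_def sum.If_cases Int_def)
  then have "measure_pmf.expectation \<P> (\<lambda>x. real (card {u \<in> U. R x u}))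
      = measure_pmf.expectation \<P> (\<lambda>x. \<Sum>u\<in>U. indicator {x. R x u} x)" by (simp only:)
  also have "\<dots> = (\<Sum>u\<in>U. measure_pmf.expectation \<P> (indicator {x. R x u}))"
    by (rule Bochner_Integration.integral_sum) simp
  finally show ?thesis by simp
qed

text \<open>The two counts differ only on \<open>high_degree D\<close>, and by at most
  \<open>n\<close> there.\<close>

lemma expectation_survivors:
  assumes U: "U \<subseteq> {1..n}"
  shows "\<bar>measure_pmf.expectation \<P> (\<lambda>x. survivors D U \<theta> k (G x))
           - (\<Sum>u\<in>U. measure_pmf.prob \<P> {x. alive (G x) (\<theta> u) k u})\<bar>
         \<le> real n * (real n * exp (2 * c - real D))"
proof -
  let ?A = "\<lambda>x. real (card {u \<in> U. alive (G x) (\<theta> u) k u})"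
  have fin: "finite U" using U by (rule finite_subset) simp
  have EA: "measure_pmf.expectation \<P> ?A = (\<Sum>u\<in>U. measure_pmf.prob \<P> {x. alive (G x) (\<theta> u) k u})"
    by (rule expectation_card[OF fin, of "\<lambda>x u. alive (G x) (\<theta> u) k u"])
  have "\<bar>measure_pmf.expectation \<P> (\<lambda>x. survivors D U \<theta> k (G x)) - measure_pmf.expectation \<P> ?A\<bar>
      = \<bar>measure_pmf.expectation \<P> (\<lambda>x. survivors D U \<theta> k (G x) - ?A x)\<bar>"
    by (rule arg_cong[where f = abs], rule Bochner_Integration.integral_diff[OF integrable_P integrable_P, symmetric])
  also have "\<dots> \<le> measure_pmf.expectation \<P> (\<lambda>x. \<bar>survivors D U \<theta> k (G x) - ?A x\<bar>)"
    by (rule integral_abs_bound)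
  also have "\<dots> \<le> measure_pmf.expectation \<P> (\<lambda>x. real n * indicator (high_degree D) x)"
  proof (intro integral_mono integrable_P)
    fix x
    have "card {u \<in> U. alive (G x) (\<theta> u) k u} \<le> card {1..n}"
      using U by (intro card_mono) auto
    then have A: "0 \<le> ?A x" "?A x \<le> real n" by simp_all
    show "\<bar>survivors D U \<theta> k (G x) - ?A x\<bar> \<le> real n * indicator (high_degree D) x"
    proof (cases "x \<in> high_degree D")
      case True
      then show ?thesis
        using A survivors_bounds[OF U, of D \<theta> k "G x"] unfolding indicator_simps(1)[OF True]
        by linarith
    next
      case False
      then show ?thesis unfolding survivors_untruncated[OF False] by simp
    qed
  qed
  also have "\<dots> = real n * measure_pmf.prob \<P> (high_degree D)" by simp
  also have "\<dots> \<le> real n * (real n * exp (2 * c - real D))"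
    by (intro mult_left_mono prob_high_degree) simp
  finally show ?thesis unfolding EA .
qed

text \<open>The right-hand side of \<open>survivors_tail\<close>.\<close>

definition deviation_bound :: "nat \<Rightarrow> nat \<Rightarrow> real \<Rightarrow> real" where
  "deviation_bound D k \<epsilon> = 2 * exp (- (min 1 (\<epsilon> / (2 * c)) * \<epsilon> * real n / (8 * (real D + 2) ^ (2 * k))))"

text \<open>The tail bound in integrated form: on the exceptional event the deviation is at most
  \<open>n\<close>.\<close>

lemma survivors_mean_deviation:
  fixes D k :: nat and \<theta> :: "nat \<Rightarrow> nat \<Rightarrow> nat" and U :: "nat set"
  assumes U: "U \<subseteq> {1..n}" and \<epsilon>: "0 < \<epsilon>"
  defines "f \<equiv> \<lambda>x. survivors D U \<theta> k (G x)"
  shows "measure_pmf.expectation \<P> (\<lambda>x. \<bar>f x - measure_pmf.expectation \<P> f\<bar>)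
           \<le> real n * (\<epsilon> + deviation_bound D k \<epsilon>)"
proof -
  let ?\<mu> = "measure_pmf.expectation \<P> f"
  let ?B = "{x. \<bar>f x - ?\<mu>\<bar> > \<epsilon> * real n}"
  have f: "0 \<le> f x" "f x \<le> real n" for x
    unfolding f_def using survivors_bounds[OF U] by auto
  have \<mu>: "0 \<le> ?\<mu>" by (intro Bochner_Integration.integral_nonneg f)
  have \<mu>': "?\<mu> \<le> real n" by (intro measure_pmf.integral_le_const integrable_P AE_pmfI f)
  have "measure_pmf.expectation \<P> (\<lambda>x. \<bar>f x - ?\<mu>\<bar>)
      \<le> measure_pmf.expectation \<P> (\<lambda>x. \<epsilon> * real n + real n * indicator ?B x)"
  proof (intro integral_mono integrable_P)
    fix x
    have "0 \<le> \<epsilon> * real n" using \<epsilon> by simp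
    moreover have "\<bar>f x - ?\<mu>\<bar> \<le> real n" using f[of x] \<mu> \<mu>' by linarith
    ultimately show "\<bar>f x - ?\<mu>\<bar> \<le> \<epsilon> * real n + real n * indicator ?B x"
      by (cases "\<bar>f x - ?\<mu>\<bar> > \<epsilon> * real n") (simp_all add: indicator_def)
  qed
  also have "\<dots> = real n * (\<epsilon> + measure_pmf.prob \<P> ?B)"
    by (simp add: algebra_simps)
  also have "\<dots> \<le> real n * (\<epsilon> + deviation_bound D k \<epsilon>)"
    unfolding deviation_bound_def f_def using survivors_tail[OF U \<epsilon>]
    by (intro mult_left_mono add_left_mono) auto
  finally show ?thesis .
qed

text \<open>One \<open>\<epsilon>\<close> pays for the fluctuation of the truncated count, the other
  for the shift of the mean due to truncation.\<close>

lemma survivor_count_tail: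
  fixes D k :: nat and \<theta> :: "nat \<Rightarrow> nat"
  assumes \<epsilon>: "0 < \<epsilon>" and small: "real n * exp (2 * c - real D) \<le> \<epsilon>"
  defines "A \<equiv> \<lambda>x. real (card {u \<in> {1..n}. alive (G x) \<theta> k u})"
  shows "measure_pmf.prob \<P> {x. \<bar>A x - measure_pmf.expectation \<P> A\<bar> > 2 * \<epsilon> * real n}
           \<le> real n * exp (2 * c - real D) + deviation_bound D k \<epsilon>"
proof -
  define f where "f x = survivors D {1..n} (\<lambda>_. \<theta>) k (G x)" for x
  let ?\<mu> = "measure_pmf.expectation \<P> f"
  have EA: "\<bar>?\<mu> - measure_pmf.expectation \<P> A\<bar> \<le> \<epsilon> * real n"
  proof -
    have "\<bar>?\<mu> - measure_pmf.expectation \<P> A\<bar> \<le> real n * (real n * exp (2 * c - real D))"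
      unfolding f_def A_def expectation_card[OF finite_atLeastAtMost]
      by (rule expectation_survivors) simp
    also have "\<dots> \<le> real n * \<epsilon>" using small by (intro mult_left_mono) auto
    finally show ?thesis by (simp add: mult.commute)
  qed
  have "{x. \<bar>A x - measure_pmf.expectation \<P> A\<bar> > 2 * \<epsilon> * real n}
      \<subseteq> high_degree D \<union> {x. \<bar>f x - ?\<mu>\<bar> > \<epsilon> * real n}"
  proof
    fix x assume x: "x \<in> {x. \<bar>A x - measure_pmf.expectation \<P> A\<bar> > 2 * \<epsilon> * real n}"
    show "x \<in> high_degree D \<union> {x. \<bar>f x - ?\<mu>\<bar> > \<epsilon> * real n}"
    proof (cases "x \<in> high_degree D")
      case False
      then have "f x = A x" by (simp add: f_def A_def survivors_untruncated)
      then show ?thesis using x EA by auto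
    qed simp
  qed
  then have "measure_pmf.prob \<P> {x. \<bar>A x - measure_pmf.expectation \<P> A\<bar> > 2 * \<epsilon> * real n}
      \<le> measure_pmf.prob \<P> (high_degree D \<union> {x. \<bar>f x - ?\<mu>\<bar> > \<epsilon> * real n})"
    by (intro measure_pmf.finite_measure_mono) auto
  also have "\<dots> \<le> measure_pmf.prob \<P> (high_degree D) + measure_pmf.prob \<P> {x. \<bar>f x - ?\<mu>\<bar> > \<epsilon> * real n}"
    by (intro measure_Un_le) auto
  also have "\<dots> \<le> real n * exp (2 * c - real D) + deviation_bound D k \<epsilon>"
    unfolding deviation_bound_def f_def
    by (intro add_mono prob_high_degree survivors_tail[OF _ \<epsilon>]) simp
  finally show ?thesis .
qed

end

subsection \<open>The degree cutoff\<close>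

text \<open>The exponent is chosen so that \<open>(D + 2) ^ (2 * k)\<close> is at most of order sqrt
  n for all \<open>k \<le> l\<close>, which leaves an exponent of order sqrt n in
  \<open>deviation_bound\<close>; being a positive power of \<open>n\<close>, the cutoff still makes
  \<open>n * exp (- D)\<close> vanish.\<close>

definition cutoff :: "nat \<Rightarrow> nat \<Rightarrow> nat" where
  "cutoff l n = nat \<lfloor>real n powr (1 / (4 * (real l + 1)))\<rfloor>"

lemma cutoff_lower: "real n powr (1 / (4 * (real l + 1))) - 1 \<le> real (cutoff l n)"
  unfolding cutoff_def by linarith

lemma cutoff_power:
  assumes "1 \<le> n" "k \<le> l"
  shows "(real (cutoff l n) + 2) ^ (2 * k) \<le> 9 ^ l * sqrt (real n)"
proof -
  let ?a = "1 / (4 * (real l + 1))"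
  have one: "1 \<le> real n powr ?a" using assms(1) by (intro ge_one_powr_ge_zero) auto
  have "real (cutoff l n) \<le> real n powr ?a" unfolding cutoff_def by simp
  \<comment> \<open>The power is at least 1, so the added 2 is at most twice it; squaring the
    resulting factor 3 gives the 9.\<close>
  then have "real (cutoff l n) + 2 \<le> 3 * real n powr ?a" using one by linarith
  then have "(real (cutoff l n) + 2) ^ (2 * k) \<le> (3 * real n powr ?a) ^ (2 * k)"
    by (intro power_mono) auto
  also have "\<dots> \<le> (3 * real n powr ?a) ^ (2 * l)"
    using one assms(2) by (intro power_increasing) auto
  also have "\<dots> = 9 ^ l * (real n powr ?a) ^ (2 * l)"
    by (simp add: power_mult_distrib power_mult)
  also have "(real n powr ?a) ^ (2 * l) = real n powr (?a * real (2 * l))"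
    using assms(1) by (simp add: powr_powr flip: powr_realpow)
  also have "\<dots> \<le> real n powr (1 / 2)"
    using assms(1) by (intro powr_mono) (auto simp: field_simps)
  also have "real n powr (1 / 2) = sqrt (real n)" by (simp add: powr_half_sqrt)
  finally show ?thesis by simp
qed

lemma high_degree_limit:
  "((\<lambda>n. real n * exp (2 * c - real (cutoff l n))) \<longlongrightarrow> 0) sequentially"
proof (rule tendsto_sandwich[where f = "\<lambda>_. 0"])
  define a where "a = 1 / (4 * (real l + 1))"
  have a: "a > 0" by (simp add: a_def)
  show "((\<lambda>n. real n * exp (2 * c + 1 - real n powr a)) \<longlongrightarrow> 0) sequentially"
    using a by real_asymp
  show "\<forall>\<^sub>F n in sequentially. real n * exp (2 * c - real (cutoff l n)) \<le> real n * exp (2 * c + 1 - real n powr a)"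
    using cutoff_lower[of _ l] unfolding a_def[symmetric]
    by (intro always_eventually allI mult_left_mono) (auto simp: algebra_simps)
qed auto

lemma cutoff_power_limit:
  assumes "k \<le> l"
  shows "((\<lambda>n. (real (cutoff l n) + 2) ^ k / real n) \<longlongrightarrow> 0) sequentially"
proof (rule tendsto_sandwich[where f = "\<lambda>_. 0"])
  show "((\<lambda>n. 9 ^ l * sqrt (real n) / real n) \<longlongrightarrow> 0) sequentially" by real_asymp
  show "\<forall>\<^sub>F n in sequentially. (real (cutoff l n) + 2) ^ k / real n \<le> 9 ^ l * sqrt (real n) / real n"
    using eventually_ge_at_top[of 1]
  proof eventually_elim
    case (elim n)
    have "(real (cutoff l n) + 2) ^ k \<le> (real (cutoff l n) + 2) ^ (2 * k)"
      by (intro power_increasing) auto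
    also have "\<dots> \<le> 9 ^ l * sqrt (real n)" using elim assms by (rule cutoff_power)
    finally show ?case by (intro divide_right_mono) auto
  qed
qed auto

lemma deviation_bound_cutoff:
  assumes "erasure_graph \<eta> n pos c" "k \<le> l" "0 < \<epsilon>"
  shows "erasure_graph.deviation_bound n c (cutoff l n) k \<epsilon>
           \<le> 2 * exp (- (min 1 (\<epsilon> / (2 * c)) * \<epsilon> / (8 * 9 ^ l) * sqrt (real n)))"
proof -
  interpret erasure_graph \<eta> n pos c by fact
  let ?\<kappa> = "min 1 (\<epsilon> / (2 * c)) * \<epsilon>"
  have \<kappa>: "0 \<le> ?\<kappa>" using c_pos assms(3) by simp
  have "?\<kappa> / (8 * 9 ^ l) * sqrt (real n) = ?\<kappa> * real n / (8 * (9 ^ l * sqrt (real n)))"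
    using n_pos by (simp add: field_simps real_sqrt_mult_self)
  also have "\<dots> \<le> ?\<kappa> * real n / (8 * (real (cutoff l n) + 2) ^ (2 * k))"
    using cutoff_power[of n k l] n_pos assms(2) \<kappa>
    by (intro divide_left_mono mult_left_mono mult_pos_pos) auto
  finally show ?thesis unfolding deviation_bound_def by simp
qed

subsection \<open>Density evolution\<close>

locale product_code =
  fixes L tmax :: nat and N :: "nat set" and \<eta> :: "nat \<Rightarrow> nat \<Rightarrow> nat" and \<gamma> :: "nat pmf"
    and \<tau> :: "nat \<Rightarrow> nat pmf" and c :: real and pos :: "nat \<Rightarrow> nat \<Rightarrow> nat"
  assumes c_pos: "0 < c"
    and eta_binary: "\<And>i j. i \<in> {1..L} \<Longrightarrow> j \<in> {1..L} \<Longrightarrow> \<eta> i j \<in> {0, 1}"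
    and eta_sym: "\<And>i j. i \<in> {1..L} \<Longrightarrow> j \<in> {1..L} \<Longrightarrow> \<eta> i j = \<eta> j i"
    and gamma: "set_pmf \<gamma> \<subseteq> {1..L}"
    and tau: "\<And>i. i \<in> {1..L} \<Longrightarrow> set_pmf (\<tau> i) \<subseteq> {1..tmax}"
    and N_gt: "\<And>n. n \<in> N \<Longrightarrow> c < real n"
    and placement: "\<And>n. n \<in> N \<Longrightarrow> valid_placement L \<gamma> n (pos n)"
begin

lemma pos_range: "n \<in> N \<Longrightarrow> u \<in> {1..n} \<Longrightarrow> pos n u \<in> {1..L}"
  using placement unfolding valid_placement_def by blast

lemma graph: "n \<in> N \<Longrightarrow> erasure_graph \<eta> n (pos n) c"
proof
  assume n: "n \<in> N"
  show "0 < n" "c \<le> real n" using N_gt[OF n] c_pos by auto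
  show "0 < c" by (rule c_pos)
  show "\<eta> (pos n k) (pos n m) = \<eta> (pos n m) (pos n k)" if "k \<in> {1..n}" "m \<in> {1..n}" for k m
    using pos_range[OF n] that by (intro eta_sym)
qed

end

text \<open>Capabilities are a fixed function for each \<open>n\<close>, constrained only through
  their range and the limiting type proportions, so that exact assignments and typical realisations
  of random ones are treated together. The number \<open>l\<close> bounds the rounds and selects the
  cutoff.\<close>

locale code_sequence = product_code +
  fixes l :: nat and cap :: "nat \<Rightarrow> nat \<Rightarrow> nat"
  assumes cap_range: "\<And>n u. n \<in> N \<Longrightarrow> u \<in> {1..n} \<Longrightarrow> cap n u \<in> {1..tmax}"
    and counts: "\<And>i t. i \<in> {1..L} \<Longrightarrow> t \<in> {1..tmax} \<Longrightarrow>
      ((\<lambda>n. real (card {u \<in> {1..n}. pos n u = i \<and> cap n u = t}) / real n)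
        \<longlongrightarrow> pmf \<gamma> i * pmf (\<tau> i) t) (inf sequentially (principal N))"
begin

abbreviation "F \<equiv> inf sequentially (principal N)"
definition "S = {1..L} \<times> {1..tmax}"
definition "\<mu> = offspring_mean \<eta> \<gamma> \<tau> c"
definition w :: "vtype \<Rightarrow> real" where "w s = pmf \<gamma> (fst s) * pmf (\<tau> (fst s)) (snd s)"
definition members :: "nat \<Rightarrow> vtype \<Rightarrow> nat set" where
  "members n s = {u \<in> {1..n}. (pos n u, cap n u) = s}"
definition \<theta> :: "nat \<Rightarrow> nat \<Rightarrow> nat" where "\<theta> n u = Suc (cap n u)"
text \<open>The thresholds under which \<open>u\<close> is tested as a neighbour of a deleted
  vertex: its own is back to its capability, all others are unchanged.\<close>

definition lowered :: "nat \<Rightarrow> nat \<Rightarrow> nat \<Rightarrow> nat" where "lowered n u = (\<theta> n)(u := \<theta> n u - 1)"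
definition "law n = erasure_graph.\<P> \<eta> n (pos n) c"
definition "residual n = erasure_graph.G \<eta> n (pos n)"
definition alive_prob :: "nat \<Rightarrow> (nat \<Rightarrow> nat) \<Rightarrow> nat \<Rightarrow> nat \<Rightarrow> real" where
  "alive_prob n \<theta>' k u = measure_pmf.prob (law n) {x. alive (residual n x) \<theta>' k u}"
definition q :: "nat \<Rightarrow> vtype \<Rightarrow> real" where "q = survival S \<mu>"
text \<open>The limiting proportion of vertices that can be joined to position \<open>i\<close> and
  survive \<open>k\<close> rounds with lowered threshold; \<open>c * m k i\<close> is the Poisson
  mean in density evolution, see \<open>offspring_sum\<close>.\<close>

definition m :: "nat \<Rightarrow> nat \<Rightarrow> real" where
  "m k i = (\<Sum>s\<in>S. of_bool (\<eta> i (fst s) = 1) * w s * q k s)"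

lemma eventually_N: "\<forall>\<^sub>F n in F. n \<in> N"
  by (simp add: eventually_inf_principal)

lemma tendsto_F: "(f \<longlongrightarrow> a) sequentially \<Longrightarrow> (f \<longlongrightarrow> a) F"
  by (rule tendsto_mono[OF inf_le1])

lemma finite_S [simp]: "finite S"
  by (simp add: S_def)

lemma finite_members [simp]: "finite (members n s)"
  by (simp add: members_def)

lemma members_subset: "members n s \<subseteq> {1..n}"
  by (auto simp: members_def)

lemma type_in_S: "n \<in> N \<Longrightarrow> u \<in> {1..n} \<Longrightarrow> (pos n u, cap n u) \<in> S"
  unfolding S_def by (intro SigmaI pos_range cap_range)

lemma members_limit:
  assumes "s \<in> S"
  shows "((\<lambda>n. real (card (members n s)) / real n) \<longlongrightarrow> w s) F"
proof -
  have "members n s = {u \<in> {1..n}. pos n u = fst s \<and> cap n u = snd s}" for n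
    by (auto simp: members_def)
  then show ?thesis using counts[of "fst s" "snd s"] assms by (auto simp: w_def S_def)
qed

lemma sum_by_type:
  fixes f :: "nat \<Rightarrow> real"
  assumes "n \<in> N"
  shows "(\<Sum>u \<in> {u \<in> {1..n}. R (pos n u)}. f u) = (\<Sum>s\<in>S. of_bool (R (fst s)) * (\<Sum>u\<in>members n s. f u))"
proof -
  let ?U = "{u \<in> {1..n}. R (pos n u)}"
  have "(\<Sum>u\<in>?U. f u) = (\<Sum>s\<in>S. \<Sum>u\<in>{u \<in> ?U. (pos n u, cap n u) = s}. f u)"
    using type_in_S[OF assms] by (intro sum.group[symmetric]) auto
  also have "\<dots> = (\<Sum>s\<in>S. of_bool (R (fst s)) * (\<Sum>u\<in>members n s. f u))"
  proof (intro sum.cong refl)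
    fix s
    have "{u \<in> ?U. (pos n u, cap n u) = s} = (if R (fst s) then members n s else {})"
      by (auto simp: members_def)
    then show "(\<Sum>u\<in>{u \<in> ?U. (pos n u, cap n u) = s}. f u) = of_bool (R (fst s)) * (\<Sum>u\<in>members n s. f u)"
      by simp
  qed
  finally show ?thesis .
qed

lemma mu_nonneg: "0 \<le> \<mu> s s'"
  using c_pos by (simp add: \<mu>_def offspring_mean_nonneg)

lemma q_bounds: "0 \<le> q k s" "q k s \<le> 1"
  using survival_bounds[OF mu_nonneg] by (auto simp: q_def)

lemma m_nonneg: "0 \<le> m k i"
  unfolding m_def using q_bounds by (intro sum_nonneg mult_nonneg_nonneg) (auto simp: w_def)

lemma offspring_sum: "s \<in> S \<Longrightarrow> (\<Sum>s'\<in>S. \<mu> s s' * q k s') = c * m k (fst s)"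
  unfolding m_def sum_distrib_left
proof (intro sum.cong refl)
  fix s' assume "s \<in> S" "s' \<in> S"
  then have "\<eta> (fst s) (fst s') \<in> {0, 1}" by (intro eta_binary) (auto simp: S_def)
  then show "\<mu> s s' * q k s' = c * (of_bool (\<eta> (fst s) (fst s') = 1) * w s' * q k s')"
    by (auto simp: \<mu>_def offspring_mean_def w_def split: prod.splits)
qed

section \<open>Passage to the limit in the recursion\<close>

definition compatible_survivors :: "nat \<Rightarrow> nat \<Rightarrow> nat \<Rightarrow> (nat set \<Rightarrow> bool) \<Rightarrow> real" where
  "compatible_survivors k i n x = survivors (cutoff l n) {u \<in> {1..n}. \<eta> i (pos n u) = 1} (lowered n) k (residual n x)"

text \<open>The distance to \<open>m k i\<close> is split at the mean of the count: fluctuations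
  about it are small by concentration, and the mean converges by the induction hypothesis summed
  over types, up to the cost of truncation.\<close>

lemma compatible_survivors_limit:
  assumes "k \<le> l"
    and IH: "\<And>s. s \<in> S \<Longrightarrow> ((\<lambda>n. (\<Sum>u\<in>members n s. alive_prob n (lowered n u) k u) / real n) \<longlongrightarrow> w s * q k s) F"
  shows "((\<lambda>n. measure_pmf.expectation (law n) (\<lambda>x. \<bar>compatible_survivors k i n x / real n - m k i\<bar>)) \<longlongrightarrow> 0) F"
proof (rule tendstoI)
  fix e :: real assume e: "0 < e"
  define A where "A n = (\<Sum>s\<in>S. of_bool (\<eta> i (fst s) = 1) * ((\<Sum>u\<in>members n s. alive_prob n (lowered n u) k u) / real n))" for n
  define C where "C = min 1 (e / 2 / (2 * c)) * (e / 2) / (8 * 9 ^ l)"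
  define B where "B n = (e / 2 + 2 * exp (- (C * sqrt (real n))))
     + (real n * exp (2 * c - real (cutoff l n)) + \<bar>A n - m k i\<bar>)" for n
  have C: "0 < C" using e c_pos by (simp add: C_def)
  have "(A \<longlongrightarrow> (\<Sum>s\<in>S. of_bool (\<eta> i (fst s) = 1) * (w s * q k s))) F"
    unfolding A_def by (intro tendsto_sum tendsto_mult_left IH)
  then have A: "(A \<longlongrightarrow> m k i) F" by (simp add: m_def mult.assoc)
  have "((\<lambda>n. 2 * exp (- (C * sqrt (real n)))) \<longlongrightarrow> 0) sequentially"
    using C by real_asymp
  then have "(B \<longlongrightarrow> (e / 2 + 0) + (0 + \<bar>m k i - m k i\<bar>)) F"
    unfolding B_def
    by (intro tendsto_add tendsto_rabs tendsto_diff tendsto_const A tendsto_F[OF high_degree_limit])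
      (rule tendsto_F)
  then have "(B \<longlongrightarrow> e / 2) F" by simp
  from order_tendstoD(2)[OF this, of e] e have "\<forall>\<^sub>F n in F. B n < e" by simp
  then show "\<forall>\<^sub>F n in F. dist (measure_pmf.expectation (law n) (\<lambda>x. \<bar>compatible_survivors k i n x / real n - m k i\<bar>)) 0 < e"
    using eventually_N
  proof eventually_elim
    case (elim n)
    interpret erasure_graph \<eta> n "pos n" c by (rule graph) fact
    define U where "U = {u \<in> {1..n}. \<eta> i (pos n u) = 1}"
    have U: "U \<subseteq> {1..n}" by (auto simp: U_def)
    define f where "f x = survivors (cutoff l n) U (lowered n) k (erasure_graph.G \<eta> n (pos n) x)" for x
    have f: "compatible_survivors k i n x = f x" for x
      by (simp add: compatible_survivors_def f_def U_def residual_def)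
    let ?\<mu> = "measure_pmf.expectation \<P> f"
    have law: "law n = \<P>" by (simp add: law_def)
    have ap: "alive_prob n \<theta>' k u = measure_pmf.prob \<P> {x. alive (erasure_graph.G \<eta> n (pos n) x) \<theta>' k u}" for \<theta>' u
      by (simp add: alive_prob_def law residual_def)
    have mean: "\<bar>?\<mu> - real n * A n\<bar> \<le> real n * (real n * exp (2 * c - real (cutoff l n)))"
    proof -
      have "real n * A n = (\<Sum>s\<in>S. of_bool (\<eta> i (fst s) = 1) * (\<Sum>u\<in>members n s. alive_prob n (lowered n u) k u))"
        unfolding A_def sum_distrib_left[of "real n" _ S]
        using n_pos by (intro sum.cong refl) simp
      also have "\<dots> = (\<Sum>u\<in>U. alive_prob n (lowered n u) k u)"
        unfolding U_def by (rule sum_by_type[OF elim(2), symmetric])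
      finally show ?thesis unfolding ap f_def
        using expectation_survivors[OF U, of "cutoff l n" "lowered n" k] by simp
    qed
    have "deviation_bound (cutoff l n) k (e / 2) \<le> 2 * exp (- (C * sqrt (real n)))"
      unfolding C_def by (rule deviation_bound_cutoff[OF erasure_graph_axioms assms(1)]) (use e in simp)
    then have "measure_pmf.expectation \<P> (\<lambda>x. \<bar>f x - ?\<mu>\<bar>) \<le> real n * (e / 2 + 2 * exp (- (C * sqrt (real n))))"
      using survivors_mean_deviation[OF U, of "e / 2" "cutoff l n" "lowered n" k] e unfolding f_def
      by (meson add_left_mono half_gt_zero mult_left_mono of_nat_0_le_iff order_trans)
    moreover have "measure_pmf.expectation \<P> (\<lambda>x. \<bar>f x / real n - m k i\<bar>)
        \<le> measure_pmf.expectation \<P> (\<lambda>x. \<bar>f x - ?\<mu>\<bar> / real n + \<bar>?\<mu> / real n - m k i\<bar>)"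
    proof (intro integral_mono integrable_P)
      fix x
      have "f x / real n - m k i = (f x - ?\<mu>) / real n + (?\<mu> / real n - m k i)"
        by (simp add: diff_divide_distrib)
      then show "\<bar>f x / real n - m k i\<bar> \<le> \<bar>f x - ?\<mu>\<bar> / real n + \<bar>?\<mu> / real n - m k i\<bar>"
        by (metis abs_divide abs_of_nat abs_triangle_ineq)
    qed
    moreover have "measure_pmf.expectation \<P> (\<lambda>x. \<bar>f x - ?\<mu>\<bar> / real n + \<bar>?\<mu> / real n - m k i\<bar>)
        = measure_pmf.expectation \<P> (\<lambda>x. \<bar>f x - ?\<mu>\<bar>) / real n + \<bar>?\<mu> / real n - m k i\<bar>"
      by simp
    moreover have "\<bar>?\<mu> / real n - m k i\<bar> \<le> real n * exp (2 * c - real (cutoff l n)) + \<bar>A n - m k i\<bar>"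
    proof -
      have "?\<mu> / real n - m k i = (?\<mu> - real n * A n) / real n + (A n - m k i)"
        using n_pos by (simp add: diff_divide_distrib)
      moreover have "\<bar>(?\<mu> - real n * A n) / real n\<bar> \<le> real n * exp (2 * c - real (cutoff l n))"
        using mean n_pos by (simp add: abs_divide divide_le_eq mult.commute)
      ultimately show ?thesis by linarith
    qed
    ultimately have "measure_pmf.expectation \<P> (\<lambda>x. \<bar>f x / real n - m k i\<bar>) \<le> B n"
      using n_pos unfolding B_def by (auto simp: field_simps)
    moreover have "0 \<le> measure_pmf.expectation \<P> (\<lambda>x. \<bar>f x / real n - m k i\<bar>)"
      by (intro Bochner_Integration.integral_nonneg) simp
    ultimately show ?case using elim(1) unfolding f law by simp
  qed
qed

lemma average_limit:
  assumes "s \<in> S" "(err \<longlongrightarrow> 0) F"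
    and close: "\<And>n u. n \<in> N \<Longrightarrow> u \<in> members n s \<Longrightarrow> \<bar>g n u - Q\<bar> \<le> err n"
  shows "((\<lambda>n. (\<Sum>u\<in>members n s. g n u) / real n) \<longlongrightarrow> w s * Q) F"
proof -
  have "((\<lambda>n. (\<Sum>u\<in>members n s. g n u) / real n - real (card (members n s)) / real n * Q) \<longlongrightarrow> 0) F"
  proof (rule Lim_null_comparison)
    show "((\<lambda>n. \<bar>err n\<bar>) \<longlongrightarrow> 0) F" using assms(2) by (rule tendsto_rabs_zero)
    show "\<forall>\<^sub>F n in F. norm ((\<Sum>u\<in>members n s. g n u) / real n - real (card (members n s)) / real n * Q) \<le> \<bar>err n\<bar>"
      using eventually_N
    proof eventually_elim
      case (elim n)
      have n: "0 < real n" using N_gt[OF elim] c_pos by simp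
      have card: "card (members n s) \<le> n"
        using card_mono[OF _ members_subset, of n s] by simp
      have "\<bar>(\<Sum>u\<in>members n s. g n u) - real (card (members n s)) * Q\<bar> = \<bar>\<Sum>u\<in>members n s. g n u - Q\<bar>"
        by (simp add: sum_subtractf)
      also have "\<dots> \<le> (\<Sum>u\<in>members n s. \<bar>g n u - Q\<bar>)" by (rule sum_abs)
      also have "\<dots> \<le> (\<Sum>u\<in>members n s. \<bar>err n\<bar>)"
        using close[OF elim] by (intro sum_mono) (meson abs_ge_self order_trans)
      also have "\<dots> \<le> real n * \<bar>err n\<bar>" using card by (simp add: mult_right_mono)
      finally have "\<bar>(\<Sum>u\<in>members n s. g n u) - real (card (members n s)) * Q\<bar> \<le> real n * \<bar>err n\<bar>" .
      moreover have "(\<Sum>u\<in>members n s. g n u) / real n - real (card (members n s)) / real n * Q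
          = ((\<Sum>u\<in>members n s. g n u) - real (card (members n s)) * Q) / real n"
        by (simp add: diff_divide_distrib)
      ultimately show ?case using n by (simp add: abs_divide divide_le_eq mult.commute)
    qed
  qed
  from tendsto_add[OF this tendsto_mult_right[OF members_limit[OF assms(1)], of Q]]
  show ?thesis by simp
qed

text \<open>The bound of \<open>cavity_estimate\<close> at the chosen cutoff. It depends on the
  vertex only through its position, so it is uniform within a type.\<close>

definition cavity_error :: "nat \<Rightarrow> nat \<Rightarrow> nat \<Rightarrow> real" where
  "cavity_error k i n = real n * exp (2 * c - real (cutoff l n))
     + c\<^sup>2 * (real (cutoff l n) + 2) ^ k / real n + 2 * c\<^sup>2 / real n
     + c * (1 + 2 * c * (real (cutoff l n) + 2) ^ k) / real n
     + c * measure_pmf.expectation (law n) (\<lambda>x. \<bar>compatible_survivors k i n x / real n - m k i\<bar>)"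

lemma cavity_error_limit:
  assumes "k \<le> l"
    and IH: "\<And>s. s \<in> S \<Longrightarrow> ((\<lambda>n. (\<Sum>u\<in>members n s. alive_prob n (lowered n u) k u) / real n) \<longlongrightarrow> w s * q k s) F"
  shows "(cavity_error k i \<longlongrightarrow> 0) F"
proof -
  define D where "D n = (real (cutoff l n) + 2) ^ k / real n" for n
  define R where "R n = measure_pmf.expectation (law n) (\<lambda>x. \<bar>compatible_survivors k i n x / real n - m k i\<bar>)" for n
  have D: "(D \<longlongrightarrow> 0) F"
    unfolding D_def using assms(1) by (intro tendsto_F cutoff_power_limit)
  have inv: "((\<lambda>n. 1 / real n) \<longlongrightarrow> 0) F"
    by (intro tendsto_F) real_asymp
  have R: "(R \<longlongrightarrow> 0) F"
    unfolding R_def by (rule compatible_survivors_limit[OF assms])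
  have "((\<lambda>n. real n * exp (2 * c - real (cutoff l n)) + c\<^sup>2 * D n + 2 * c\<^sup>2 * (1 / real n)
      + (c * (1 / real n) + 2 * c * c * D n) + c * R n) \<longlongrightarrow> 0 + c\<^sup>2 * 0 + 2 * c\<^sup>2 * 0 + (c * 0 + 2 * c * c * 0) + c * 0) F"
    by (intro tendsto_add tendsto_mult_left D inv R tendsto_F[OF high_degree_limit])
  moreover have "cavity_error k i = (\<lambda>n. real n * exp (2 * c - real (cutoff l n)) + c\<^sup>2 * D n + 2 * c\<^sup>2 * (1 / real n)
      + (c * (1 / real n) + 2 * c * c * D n) + c * R n)"
    by (auto simp: cavity_error_def D_def R_def fun_eq_iff distrib_left add_divide_distrib mult_ac)
  ultimately show ?thesis by simp
qed

lemma alive_prob_estimate: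
  assumes n: "n \<in> N" and v: "v \<in> {1..n}" and \<theta>0: "\<And>u. u \<noteq> v \<Longrightarrow> \<theta>0 u = \<theta> n u"
  shows "\<bar>alive_prob n \<theta>0 (Suc k) v - (1 - poisson_cdf (\<theta>0 v) (c * m k (pos n v)))\<bar>
           \<le> cavity_error k (pos n v) n"
proof -
  interpret erasure_graph \<eta> n "pos n" c by (rule graph) fact
  show ?thesis
    using cavity_estimate[OF v \<theta>0 m_nonneg[of k "pos n v"], where D = "cutoff l n" and k = k]
    unfolding alive_prob_def cavity_error_def compatible_survivors_def lowered_def law_def residual_def .
qed

text \<open>The recursion closes because the tested vertex is allowed a threshold of its own:
  testing \<open>u\<close> with \<open>lowered n u\<close> again leads to neighbours tested with
  their own lowered thresholds, one round earlier.\<close>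

lemma lowered_limit:
  assumes "k \<le> l" "s \<in> S"
  shows "((\<lambda>n. (\<Sum>u\<in>members n s. alive_prob n (lowered n u) k u) / real n) \<longlongrightarrow> w s * q k s) F"
  using assms
proof (induction k arbitrary: s)
  case 0
  then show ?case using members_limit by (simp add: alive_prob_def q_def)
next
  case (Suc k)
  show ?case
  proof (rule average_limit[OF Suc.prems(2)])
    show "(cavity_error k (fst s) \<longlongrightarrow> 0) F"
      using Suc by (intro cavity_error_limit) auto
    fix n u assume nu: "n \<in> N" "u \<in> members n s"
    then have u: "u \<in> {1..n}" "pos n u = fst s" "cap n u = snd s" by (auto simp: members_def)
    have q: "q (Suc k) s = 1 - poisson_cdf (snd s) (c * m k (fst s))"
      using offspring_sum[OF Suc.prems(2), of k] by (simp add: q_def)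
    show "\<bar>alive_prob n (lowered n u) (Suc k) u - q (Suc k) s\<bar> \<le> cavity_error k (fst s) n"
      using alive_prob_estimate[OF nu(1) u(1), of "lowered n u" k]
      unfolding u(2) q by (simp add: lowered_def \<theta>_def u(3))
  qed
qed

text \<open>The original thresholds enter only in the last round, for the observed vertex; this
  mirrors the root, which has no parent to count on.\<close>

lemma alive_limit:
  assumes "k \<le> l"
  shows "((\<lambda>n. (\<Sum>u\<in>{1..n}. alive_prob n (\<theta> n) (Suc k) u) / real n)
     \<longlongrightarrow> (\<Sum>s\<in>S. w s * (1 - poisson_cdf (Suc (snd s)) (\<Sum>s'\<in>S. \<mu> s s' * q k s')))) F"
proof -
  have "((\<lambda>n. \<Sum>s\<in>S. (\<Sum>u\<in>members n s. alive_prob n (\<theta> n) (Suc k) u) / real n)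
     \<longlongrightarrow> (\<Sum>s\<in>S. w s * (1 - poisson_cdf (Suc (snd s)) (\<Sum>s'\<in>S. \<mu> s s' * q k s')))) F"
  proof (intro tendsto_sum)
    fix s assume s: "s \<in> S"
    show "((\<lambda>n. (\<Sum>u\<in>members n s. alive_prob n (\<theta> n) (Suc k) u) / real n)
      \<longlongrightarrow> w s * (1 - poisson_cdf (Suc (snd s)) (\<Sum>s'\<in>S. \<mu> s s' * q k s'))) F"
    proof (rule average_limit[OF s])
      show "(cavity_error k (fst s) \<longlongrightarrow> 0) F"
        using assms by (intro cavity_error_limit lowered_limit) auto
      fix n u assume nu: "n \<in> N" "u \<in> members n s"
      then have u: "u \<in> {1..n}" "pos n u = fst s" "cap n u = snd s" by (auto simp: members_def)
      show "\<bar>alive_prob n (\<theta> n) (Suc k) u - (1 - poisson_cdf (Suc (snd s)) (\<Sum>s'\<in>S. \<mu> s s' * q k s'))\<bar>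
          \<le> cavity_error k (fst s) n"
        using alive_prob_estimate[OF nu(1) u(1), of "\<theta> n" k]
        unfolding u(2) offspring_sum[OF s] by (simp add: \<theta>_def u(3))
    qed
  qed
  moreover have "\<forall>\<^sub>F n in F. (\<Sum>s\<in>S. (\<Sum>u\<in>members n s. alive_prob n (\<theta> n) (Suc k) u) / real n)
      = (\<Sum>u\<in>{1..n}. alive_prob n (\<theta> n) (Suc k) u) / real n"
    using eventually_N
  proof eventually_elim
    case (elim n)
    show ?case using sum_by_type[OF elim, where R = "\<lambda>_. True" and f = "alive_prob n (\<theta> n) (Suc k)"]
      by (simp only: sum_divide_distrib[symmetric] simp_thms Collect_mem_eq of_bool_eq(2) mult_1)
  qed
  ultimately show ?thesis by (rule Lim_transform_eventually)
qed

end

subsection \<open>Capability counts\<close>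

lemma bit_count_tail:
  assumes "finite A" "0 \<le> p" "p \<le> 1" "0 \<le> s" "s \<le> 1"
  shows "measure_pmf.prob (Pi_pmf A False (\<lambda>_. bernoulli_pmf p))
           {x. \<bar>real (card {e \<in> A. x e}) - real (card A) * p\<bar> > T}
         \<le> 2 * exp (real (card A) * s\<^sup>2 - s * T)"
proof -
  let ?P = "Pi_pmf A False (\<lambda>_. bernoulli_pmf p)"
  let ?f = "\<lambda>x. real (card {e \<in> A. x e})"
  have f: "?f x = (\<Sum>e\<in>A. of_bool (x e))" for x
    using assms(1) by (simp add: Int_def)
  have "measure_pmf.expectation ?P ?f = (\<Sum>e\<in>A. measure_pmf.expectation ?P (\<lambda>x. of_bool (x e) :: real))"
    unfolding f using assms(1) by (intro Bochner_Integration.integral_sum) simp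
  also have "\<dots> = (\<Sum>e\<in>A. p)"
  proof (intro sum.cong refl)
    fix e assume "e \<in> A"
    have "measure_pmf.expectation ?P (\<lambda>x. of_bool (x e) :: real)
        = measure_pmf.expectation (map_pmf (\<lambda>x. x e) ?P) of_bool"
      by (rule integral_map_pmf[symmetric])
    also have "map_pmf (\<lambda>x. x e) ?P = bernoulli_pmf p"
      using assms(1) \<open>e \<in> A\<close> by (simp add: Pi_pmf_component)
    finally show "measure_pmf.expectation ?P (\<lambda>x. of_bool (x e) :: real) = p"
      using assms by simp
  qed
  finally have E: "measure_pmf.expectation ?P ?f = real (card A) * p" by simp
  have "measure_pmf.prob ?P {x. \<bar>?f x - measure_pmf.expectation ?P ?f\<bar> > T}
      \<le> 2 * exp (real (card A) * (p * s\<^sup>2 * 1\<^sup>2) - s * T)"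
  proof (rule bounded_differences_tail)
    show "\<bar>?f (x(e := True)) - ?f (x(e := False))\<bar> \<le> 1" if "e \<in> A" for x e
    proof -
      have "{e' \<in> A. (x(e := True)) e'} = insert e {e' \<in> A. (x(e := False)) e'}"
        using that by auto
      moreover have "e \<notin> {e' \<in> A. (x(e := False)) e'}" by simp
      moreover have "finite {e' \<in> A. (x(e := False)) e'}" using assms(1) by simp
      ultimately show ?thesis by (simp only: card_insert_disjoint) simp
    qed
  qed (use assms in auto)
  also have "\<dots> \<le> 2 * exp (real (card A) * s\<^sup>2 - s * T)"
    using assms by (auto intro!: mult_left_mono mult_left_le_one_le)
  finally show ?thesis unfolding E .
qed

definition type_count :: "(nat \<Rightarrow> nat) \<Rightarrow> nat \<Rightarrow> nat \<Rightarrow> nat \<Rightarrow> (nat \<Rightarrow> nat) \<Rightarrow> nat" where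
  "type_count pos n i t cap = card {u \<in> {1..n}. pos u = i \<and> cap u = t}"

text \<open>The window \<open>n powr (3 / 4)\<close> is o(n), so type proportions still converge,
  and it is wide enough for the exceptional probability to be exponentially small in sqrt n.\<close>

definition typical ::
    "nat \<Rightarrow> nat \<Rightarrow> nat pmf \<Rightarrow> (nat \<Rightarrow> nat pmf) \<Rightarrow> (nat \<Rightarrow> nat) \<Rightarrow> nat \<Rightarrow> (nat \<Rightarrow> nat) set" where
  "typical L tmax \<gamma> \<tau> pos n = {cap. (\<forall>u\<in>{1..n}. cap u \<in> {1..tmax}) \<and>
     (\<forall>i\<in>{1..L}. \<forall>t\<in>{1..tmax}.
        \<bar>real (type_count pos n i t cap) - pmf \<gamma> i * pmf (\<tau> i) t * real n\<bar> \<le> real n powr (3 / 4))}"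

lemma count_tail:
  assumes n: "1 \<le> n" and t: "t \<noteq> 0"
    and card: "real (card {u \<in> {1..n}. pos u = i}) = pmf \<gamma> i * real n"
  shows "measure_pmf.prob (Pi_pmf {1..n} 0 (\<lambda>u. \<tau> (pos u)))
      {cap. \<bar>real (type_count pos n i t cap) - pmf \<gamma> i * pmf (\<tau> i) t * real n\<bar> > real n powr (3 / 4)}
    \<le> 2 * exp (- (sqrt (real n) / 4))"
proof -
  let ?I = "{u \<in> {1..n}. pos u = i}"
  let ?K = "Pi_pmf {1..n} 0 (\<lambda>u. \<tau> (pos u))"
  let ?P = "Pi_pmf ?I False (\<lambda>_. bernoulli_pmf (pmf (\<tau> i) t))"
  have bern: "map_pmf (\<lambda>x. x = t) (\<tau> i) = bernoulli_pmf (pmf (\<tau> i) t)"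
  proof (rule pmf_eqI)
    fix b
    have v: "(\<lambda>x. x = t) -` {True} = {t}" "(\<lambda>x. x = t) -` {False} = UNIV - {t}" by auto
    have "measure_pmf.prob (\<tau> i) (UNIV - {t}) = 1 - pmf (\<tau> i) t"
      using measure_pmf.prob_compl[of "{t}" "\<tau> i"] by (simp add: measure_pmf_single)
    then show "pmf (map_pmf (\<lambda>x. x = t) (\<tau> i)) b = pmf (bernoulli_pmf (pmf (\<tau> i) t)) b"
      unfolding pmf_map by (cases b) (simp_all add: v measure_pmf_single pmf_le_1)
  qed
  have "?P = Pi_pmf ?I False (\<lambda>u. map_pmf (\<lambda>x. x = t) (\<tau> (pos u)))"
    by (intro Pi_pmf_cong) (auto simp: bern)
  \<comment> \<open>Since \<open>t\<close> is nonzero, the default capability 0 is sent to the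
    default bit \<open>False\<close>.\<close>
  also have "\<dots> = map_pmf (\<lambda>h. (\<lambda>x. x = t) \<circ> h) (Pi_pmf ?I 0 (\<lambda>u. \<tau> (pos u)))"
    using t by (intro Pi_pmf_map) auto
  also have "Pi_pmf ?I 0 (\<lambda>u. \<tau> (pos u)) = map_pmf (\<lambda>f u. if u \<in> ?I then f u else 0) ?K"
    by (intro Pi_pmf_subset) auto
  finally have P: "?P = map_pmf (\<lambda>cap u. u \<in> ?I \<and> cap u = t) ?K"
    using t by (simp add: pmf.map_comp o_def if_distrib cong: if_cong) (intro map_pmf_cong refl, auto)
  \<comment> \<open>This \<open>s\<close> minimises
    \<open>n * s\<^sup>2 - s * n powr (3 / 4)\<close>: the two terms become
    \<open>sqrt n / 4\<close> and \<open>sqrt n / 2\<close>.\<close>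
  define s where "s = real n powr (- 1 / 4) / 2"
  have s: "0 \<le> s" "s \<le> 1"
    using n powr_mono[of "- 1 / 4" 0 "real n"] by (auto simp: s_def)
  have "measure_pmf.prob ?K
      {cap. \<bar>real (type_count pos n i t cap) - pmf \<gamma> i * pmf (\<tau> i) t * real n\<bar> > real n powr (3 / 4)}
      = measure_pmf.prob ?P {x. \<bar>real (card {e \<in> ?I. x e}) - real (card ?I) * pmf (\<tau> i) t\<bar> > real n powr (3 / 4)}"
  proof -
    have "{e \<in> ?I. e \<in> ?I \<and> cap e = t} = {u \<in> {1..n}. pos u = i \<and> cap u = t}" for cap by auto
    then show ?thesis
      unfolding P measure_map_pmf vimage_def mem_Collect_eq card type_count_def by (simp add: mult_ac)
  qed
  also have "\<dots> \<le> 2 * exp (real (card ?I) * s\<^sup>2 - s * real n powr (3 / 4))"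
    using s by (intro bit_count_tail) (auto simp: pmf_le_1)
  also have "real (card ?I) * s\<^sup>2 - s * real n powr (3 / 4) \<le> - (sqrt (real n) / 4)"
  proof -
    have "card ?I \<le> card {1..n}" by (intro card_mono) auto
    then have "real (card ?I) \<le> real n" by simp
    then have "real (card ?I) * s\<^sup>2 \<le> real n * s\<^sup>2" by (intro mult_right_mono) auto
    also have "\<dots> = sqrt (real n) / 4"
    proof -
      have s2: "s\<^sup>2 = real n powr (- 1 / 2) / 4"
        by (simp add: s_def power2_eq_square flip: powr_add)
      have "real n * real n powr (- 1 / 2) = real n powr (1 + - 1 / 2)"
        using n by (subst powr_add) simp
      also have "\<dots> = sqrt (real n)" by (simp add: powr_half_sqrt)
      finally have "real n * real n powr (- 1 / 2) / 4 = sqrt (real n) / 4" by (rule arg_cong)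
      then show ?thesis unfolding s2 times_divide_eq_right .
    qed
    finally have "real (card ?I) * s\<^sup>2 \<le> sqrt (real n) / 4" .
    moreover have "s * real n powr (3 / 4) = sqrt (real n) / 2"
      by (simp add: s_def powr_half_sqrt flip: powr_add)
    ultimately show ?thesis by linarith
  qed
  finally show ?thesis by simp
qed

lemma prob_typical:
  assumes n: "1 \<le> n" and valid: "valid_placement L \<gamma> n pos"
    and tau: "\<And>i. i \<in> {1..L} \<Longrightarrow> set_pmf (\<tau> i) \<subseteq> {1..tmax}"
    and K: "deterministic_caps L tmax \<gamma> \<tau> n pos K \<or> random_caps \<tau> n pos K"
  shows "measure_pmf.prob K (- typical L tmax \<gamma> \<tau> pos n) \<le> real (L * tmax) * (2 * exp (- (sqrt (real n) / 4)))"
  using K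
proof
  assume "deterministic_caps L tmax \<gamma> \<tau> n pos K"
  then obtain cap where cap: "K = return_pmf cap" "cap ` {1..n} \<subseteq> {1..tmax}"
    "\<forall>i\<in>{1..L}. \<forall>t\<in>{1..tmax}. real (type_count pos n i t cap) = pmf (\<tau> i) t * (pmf \<gamma> i * real n)"
    unfolding deterministic_caps_def type_count_def by blast
  have "cap \<in> typical L tmax \<gamma> \<tau> pos n"
    unfolding typical_def using cap(2,3) by (auto simp: image_subset_iff mult_ac)
  then show ?thesis by (simp add: cap(1))
next
  assume "random_caps \<tau> n pos K"
  then have K: "K = Pi_pmf {1..n} 0 (\<lambda>u. \<tau> (pos u))" by (simp add: random_caps_def)
  let ?B = "\<lambda>(i, t). {cap. \<bar>real (type_count pos n i t cap) - pmf \<gamma> i * pmf (\<tau> i) t * real n\<bar> > real n powr (3 / 4)}"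
  have range: "cap u \<in> {1..tmax}" if "cap \<in> set_pmf K" "u \<in> {1..n}" for cap u
  proof -
    have "cap u \<in> set_pmf (\<tau> (pos u))"
      using that unfolding K by (auto simp: set_Pi_pmf PiE_dflt_def)
    moreover have "pos u \<in> {1..L}"
      using valid imageI[OF that(2), of pos] unfolding valid_placement_def by blast
    ultimately show ?thesis using tau by blast
  qed
  have "measure_pmf.prob K (- typical L tmax \<gamma> \<tau> pos n) \<le> measure_pmf.prob K (\<Union>s\<in>{1..L} \<times> {1..tmax}. ?B s)"
  proof (rule measure_pmf.finite_measure_mono_AE)
    show "AE cap in K. cap \<in> - typical L tmax \<gamma> \<tau> pos n \<longrightarrow> cap \<in> (\<Union>s\<in>{1..L} \<times> {1..tmax}. ?B s)"
      unfolding AE_measure_pmf_iff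
    proof (intro ballI impI)
      fix cap assume "cap \<in> set_pmf K" "cap \<in> - typical L tmax \<gamma> \<tau> pos n"
      then obtain i t where "i \<in> {1..L}" "t \<in> {1..tmax}"
        "\<not> \<bar>real (type_count pos n i t cap) - pmf \<gamma> i * pmf (\<tau> i) t * real n\<bar> \<le> real n powr (3 / 4)"
        using range unfolding typical_def by blast
      then show "cap \<in> (\<Union>s\<in>{1..L} \<times> {1..tmax}. ?B s)"
        by (intro UN_I[of "(i, t)"]) auto
    qed
  qed simp
  also have "\<dots> \<le> (\<Sum>s\<in>{1..L} \<times> {1..tmax}. measure_pmf.prob K (?B s))"
    by (intro measure_pmf.finite_measure_subadditive_finite) auto
  also have "\<dots> \<le> (\<Sum>s\<in>{1..L} \<times> {1..tmax}. 2 * exp (- (sqrt (real n) / 4)))"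
  proof (intro sum_mono)
    fix s assume "s \<in> {1..L} \<times> {1..tmax}"
    then obtain i t where s: "s = (i, t)" "i \<in> {1..L}" "t \<in> {1..tmax}" by blast
    have "real (card {u \<in> {1..n}. pos u = i}) = pmf \<gamma> i * real n"
      using valid s(2) by (auto simp: valid_placement_def)
    then show "measure_pmf.prob K (?B s) \<le> 2 * exp (- (sqrt (real n) / 4))"
      unfolding s(1) prod.case K using n s(3) by (intro count_tail) auto
  qed
  also have "\<dots> = real (L * tmax) * (2 * exp (- (sqrt (real n) / 4)))" by (simp add: card_cartesian_product)
  finally show ?thesis .
qed

text \<open>The rate \<open>a / 2\<close> lies below both \<open>a\<close> and \<open>1 / 2\<close>,
  so multiplying any summand by \<open>exp (n powr (a / 2))\<close> still gives a null sequence;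
  constants and the factor \<open>n\<close> are absorbed.\<close>

lemma stretched_exponential_bound:
  fixes a b C M :: real
  assumes a: "0 < a" "a < 1" and C: "0 < C"
  shows "\<forall>\<^sub>F n in sequentially. M * exp (- (sqrt (real n) / 4)) + (real n * exp (b - real n powr a)
      + 2 * exp (- (C * sqrt (real n)))) \<le> exp (- (real n powr (a / 2)))"
proof -
  have 1: "((\<lambda>n. M * exp (- (sqrt (real n) / 4)) * exp (real n powr (a / 2))) \<longlongrightarrow> 0) sequentially"
    using a by real_asymp
  have 2: "((\<lambda>n. real n * exp (b - real n powr a) * exp (real n powr (a / 2))) \<longlongrightarrow> 0) sequentially"
    using a by real_asymp
  have 3: "((\<lambda>n. 2 * exp (- (C * sqrt (real n))) * exp (real n powr (a / 2))) \<longlongrightarrow> 0) sequentially"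
    using a C by real_asymp
  have "((\<lambda>n. (M * exp (- (sqrt (real n) / 4)) + (real n * exp (b - real n powr a)
      + 2 * exp (- (C * sqrt (real n))))) * exp (real n powr (a / 2))) \<longlongrightarrow> 0) sequentially"
    using tendsto_add[OF 1 tendsto_add[OF 2 3]] by (simp add: algebra_simps)
  from order_tendstoD(2)[OF this zero_less_one] show ?thesis
    by eventually_elim (simp add: exp_minus field_simps)
qed

subsection \<open>Failure probabilities\<close>

lemma measure_pair_pmf_section:
  "measure_pmf.prob (pair_pmf A B) X = measure_pmf.expectation A (\<lambda>a. measure_pmf.prob B {b. (a, b) \<in> X})"
  by (simp add: pair_pmf_def measure_bind_pmf map_pmf_def[symmetric] vimage_def)

lemma failure_fraction_eq:
  "failure_fraction \<eta> l n pos (cap, x) =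
     real (card {u \<in> {1..n}. alive {e \<in> code_bits \<eta> n pos. x e} (\<lambda>u. Suc (cap u)) l u}) / real n"
proof -
  let ?E = "{e \<in> code_bits \<eta> n pos. x e}"
  have "code_bits \<eta> n pos \<subseteq> Pow {1..n}" by (auto simp: code_bits_def)
  then have "finite (code_bits \<eta> n pos)" by (rule finite_subset) simp
  then have fin: "finite ?E" by simp
  have "survives cap ({1..n}, ?E) l u \<longleftrightarrow> alive ?E (\<lambda>u. Suc (cap u)) l u" if "u \<in> {1..n}" for u
    using that by (intro survives_iff_alive fin) (auto simp: code_bits_def)
  then have "(\<Sum>k = 1..n. failure \<eta> l n pos k (cap, x))
      = (\<Sum>k\<in>{1..n}. of_bool (alive ?E (\<lambda>u. Suc (cap u)) l k))"
    unfolding failure_def residual_graph_def by (intro sum.cong refl) simp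
  also have "\<dots> = real (card {u \<in> {1..n}. alive ?E (\<lambda>u. Suc (cap u)) l u})"
    by (simp add: Int_def)
  finally show ?thesis unfolding failure_fraction_def by simp
qed

context product_code
begin

definition mean_failures :: "nat \<Rightarrow> nat \<Rightarrow> (nat \<Rightarrow> nat) \<Rightarrow> real" where
  "mean_failures l n cap = (\<Sum>u\<in>{1..n}. measure_pmf.prob (erasures \<eta> (c / real n) n (pos n))
     {x. alive {e \<in> code_bits \<eta> n (pos n). x e} (\<lambda>u. Suc (cap u)) l u}) / real n"

text \<open>Uniformity over typical assignments is obtained from the limit along a single sequence:
  for each \<open>n\<close> that admits an offending assignment, one such assignment is
  chosen.\<close>

lemma mean_failures_limit:
  assumes "0 < \<epsilon>"
  shows "\<forall>\<^sub>F n in inf sequentially (principal N). \<forall>cap \<in> typical L tmax \<gamma> \<tau> (pos n) n.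
     \<bar>mean_failures (Suc k) n cap - root_survival_prob L tmax \<eta> \<gamma> \<tau> c (Suc k)\<bar> < \<epsilon>"
proof -
  let ?z = "root_survival_prob L tmax \<eta> \<gamma> \<tau> c (Suc k)"
  define bad where "bad n cap \<longleftrightarrow> cap \<in> typical L tmax \<gamma> \<tau> (pos n) n \<and>
    \<not> \<bar>mean_failures (Suc k) n cap - ?z\<bar> < \<epsilon>" for n cap
  \<comment> \<open>The offending \<open>n\<close> form the index set of a code sequence of their
    own. Its limit shows that eventually none of them offends, so \<open>N'\<close> contributes no
    large \<open>n\<close>; for a finite \<open>N'\<close> the filter is trivial and the limit is
    vacuous.\<close>
  define N' where "N' = {n \<in> N. \<exists>cap. bad n cap}"
  define cap' where "cap' n = (SOME cap. bad n cap)" for n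
  have bad: "bad n (cap' n)" if n: "n \<in> N'" for n
  proof -
    obtain cap where "bad n cap" using n by (auto simp: N'_def)
    then show ?thesis unfolding cap'_def by (rule someI[of "bad n"])
  qed
  have N'N: "N' \<subseteq> N" by (auto simp: N'_def)
  interpret cs: code_sequence L tmax N' \<eta> \<gamma> \<tau> c pos k cap'
  proof
    show "0 < c" "set_pmf \<gamma> \<subseteq> {1..L}" by (fact c_pos gamma)+
    show "\<eta> i j \<in> {0, 1}" if "i \<in> {1..L}" "j \<in> {1..L}" for i j
      using that by (rule eta_binary)
    show "\<eta> i j = \<eta> j i" if "i \<in> {1..L}" "j \<in> {1..L}" for i j
      using that by (rule eta_sym)
    show "set_pmf (\<tau> i) \<subseteq> {1..tmax}" if "i \<in> {1..L}" for i
      using that by (rule tau)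
    show "c < real n" "valid_placement L \<gamma> n (pos n)" if "n \<in> N'" for n
      using that N'N N_gt placement by blast+
    show "cap' n u \<in> {1..tmax}" if "n \<in> N'" "u \<in> {1..n}" for n u
      using bad[OF that(1)] that(2) unfolding bad_def typical_def by blast
    fix i t assume it: "i \<in> {1..L}" "t \<in> {1..tmax}"
    let ?w = "pmf \<gamma> i * pmf (\<tau> i) t"
    let ?r = "\<lambda>n. real (card {u \<in> {1..n}. pos n u = i \<and> cap' n u = t}) / real n"
    have "((\<lambda>n. ?r n - ?w) \<longlongrightarrow> 0) (inf sequentially (principal N'))"
    proof (rule Lim_null_comparison)
      have "((\<lambda>n. real n powr (- 1 / 4)) \<longlongrightarrow> 0) sequentially" by real_asymp
      then show "((\<lambda>n. real n powr (- 1 / 4)) \<longlongrightarrow> 0) (inf sequentially (principal N'))"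
        by (rule tendsto_mono[OF inf_le1])
      show "\<forall>\<^sub>F n in inf sequentially (principal N'). norm (?r n - ?w) \<le> real n powr (- 1 / 4)"
        unfolding eventually_inf_principal
      proof (intro always_eventually allI impI)
        fix n assume n: "n \<in> N'"
        have pos: "0 < real n" using N_gt[of n] n N'N c_pos by force
        have "\<bar>real (type_count (pos n) n i t (cap' n)) - ?w * real n\<bar> \<le> real n powr (3 / 4)"
          using bad[OF n] it unfolding bad_def typical_def by blast
        then have "\<bar>?r n * real n - ?w * real n\<bar> \<le> real n powr (3 / 4)"
          using pos by (simp add: type_count_def)
        moreover have "\<bar>?r n - ?w\<bar> * real n = \<bar>?r n * real n - ?w * real n\<bar>"
          unfolding left_diff_distrib[symmetric] abs_mult by simp
        ultimately have "\<bar>?r n - ?w\<bar> * real n \<le> real n powr (3 / 4)" by (simp only:)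
        also have "real n powr (3 / 4) = real n powr (- 1 / 4) * real n"
          using pos powr_add[of "real n" "- 1 / 4" 1] by simp
        finally show "norm (?r n - ?w) \<le> real n powr (- 1 / 4)" using pos by simp
      qed
    qed
    then show "(?r \<longlongrightarrow> ?w) (inf sequentially (principal N'))" by (rule LIM_zero_cancel)
  qed
  have "((\<lambda>n. mean_failures (Suc k) n (cap' n)) \<longlongrightarrow> ?z) cs.F"
  proof -
    have z: "?z = (\<Sum>s\<in>cs.S. cs.w s * (1 - poisson_cdf (Suc (snd s)) (\<Sum>s'\<in>cs.S. cs.\<mu> s s' * cs.q k s')))"
      using root_survival_prob_eq[OF gamma tau less_imp_le[OF c_pos], where \<eta> = \<eta> and l = k]
      unfolding cs.S_def cs.w_def cs.\<mu>_def cs.q_def .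
    have "mean_failures (Suc k) n (cap' n) = (\<Sum>u\<in>{1..n}. cs.alive_prob n (cs.\<theta> n) (Suc k) u) / real n" if "n \<in> N'" for n
    proof -
      interpret erasure_graph \<eta> n "pos n" c using that N'N by (intro graph) blast
      have \<theta>: "cs.\<theta> n = (\<lambda>u. Suc (cap' n u))" by (auto simp: cs.\<theta>_def)
      show ?thesis
        unfolding mean_failures_def cs.alive_prob_def \<theta> by (simp add: cs.law_def cs.residual_def \<P>_def G_def bits_def)
    qed
    then have "\<forall>\<^sub>F n in cs.F. (\<Sum>u\<in>{1..n}. cs.alive_prob n (cs.\<theta> n) (Suc k) u) / real n = mean_failures (Suc k) n (cap' n)"
      unfolding eventually_inf_principal by (intro always_eventually) auto
    then show ?thesis unfolding z by (rule Lim_transform_eventually[OF cs.alive_limit[OF order_refl]])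
  qed
  from tendstoD[OF this assms]
  have "\<forall>\<^sub>F n in sequentially. n \<in> N' \<longrightarrow> \<bar>mean_failures (Suc k) n (cap' n) - ?z\<bar> < \<epsilon>"
    unfolding eventually_inf_principal dist_real_def .
  then show ?thesis
    unfolding eventually_inf_principal
  proof eventually_elim
    case (elim n)
    then have "n \<notin> N'" using bad[of n] unfolding bad_def by blast
    then show ?case unfolding N'_def bad_def by blast
  qed
qed

lemma mean_failures_bounds: "n \<in> N \<Longrightarrow> 0 \<le> mean_failures l n cap \<and> mean_failures l n cap \<le> 1"
proof -
  assume n: "n \<in> N"
  have "0 < real n" using N_gt[OF n] c_pos by simp
  moreover have "(\<Sum>u\<in>{1..n}. measure_pmf.prob (erasures \<eta> (c / real n) n (pos n))
     {x. alive {e \<in> code_bits \<eta> n (pos n). x e} (\<lambda>u. Suc (cap u)) l u}) \<le> (\<Sum>u\<in>{1..n}. 1)"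
    by (intro sum_mono) simp
  ultimately show ?thesis
    by (simp add: mean_failures_def sum_nonneg)
qed

lemma expectation_failure_fraction:
  assumes n: "n \<in> N"
  shows "measure_pmf.expectation (code_space \<eta> c n (pos n) K) (failure_fraction \<eta> l n (pos n))
       = measure_pmf.expectation K (mean_failures l n)"
proof -
  let ?M = "code_space \<eta> c n (pos n) K" and ?P = "erasures \<eta> (c / real n) n (pos n)"
  let ?a = "\<lambda>u cap x. alive {e \<in> code_bits \<eta> n (pos n). x e} (\<lambda>u. Suc (cap u)) l u"
  have "failure_fraction \<eta> l n (pos n) = (\<lambda>\<omega>. (\<Sum>u\<in>{1..n}. indicator {(cap, x). ?a u cap x} \<omega>) / real n)"
  proof
    fix \<omega> :: "(nat \<Rightarrow> nat) \<times> (nat set \<Rightarrow> bool)"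
    obtain cap x where \<omega>: "\<omega> = (cap, x)" by force
    show "failure_fraction \<eta> l n (pos n) \<omega> = (\<Sum>u\<in>{1..n}. indicator {(cap, x). ?a u cap x} \<omega>) / real n"
      unfolding \<omega> failure_fraction_eq by (simp add: indicator_def sum.If_cases Int_def)
  qed
  then have "measure_pmf.expectation ?M (failure_fraction \<eta> l n (pos n))
      = measure_pmf.expectation ?M (\<lambda>\<omega>. \<Sum>u\<in>{1..n}. indicator {(cap, x). ?a u cap x} \<omega>) / real n"
    by simp
  also have "measure_pmf.expectation ?M (\<lambda>\<omega>. \<Sum>u\<in>{1..n}. indicator {(cap, x). ?a u cap x} \<omega>)
      = (\<Sum>u\<in>{1..n}. measure_pmf.prob ?M {(cap, x). ?a u cap x})"
    by (subst Bochner_Integration.integral_sum)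
      (auto intro!: measure_pmf.integrable_const_bound[where B = 1])
  also have "\<dots> = (\<Sum>u\<in>{1..n}. measure_pmf.expectation K (\<lambda>cap. measure_pmf.prob ?P {x. ?a u cap x}))"
    by (simp add: code_space_def measure_pair_pmf_section)
  also have "\<dots> = measure_pmf.expectation K (\<lambda>cap. \<Sum>u\<in>{1..n}. measure_pmf.prob ?P {x. ?a u cap x})"
    by (rule Bochner_Integration.integral_sum[symmetric])
      (auto intro!: measure_pmf.integrable_const_bound[where B = 1])
  also have "\<dots> / real n = measure_pmf.expectation K (mean_failures l n)"
    by (simp add: mean_failures_def[abs_def])
  finally show ?thesis .
qed

lemma fixed_caps_tail:
  assumes n: "n \<in> N" and \<epsilon>: "0 < \<epsilon>" and small: "real n * exp (2 * c - real (cutoff l n)) \<le> \<epsilon>"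
  shows "measure_pmf.prob (erasures \<eta> (c / real n) n (pos n))
      {x. \<bar>failure_fraction \<eta> l n (pos n) (cap, x) - mean_failures l n cap\<bar> > 2 * \<epsilon>}
    \<le> real n * exp (2 * c - real (cutoff l n)) + 2 * exp (- (min 1 (\<epsilon> / (2 * c)) * \<epsilon> / (8 * 9 ^ l) * sqrt (real n)))"
proof -
  interpret erasure_graph \<eta> n "pos n" c by (rule graph) fact
  define A where "A x = real (card {u \<in> {1..n}. alive (G x) (\<lambda>u. Suc (cap u)) l u})" for x
  have W: "failure_fraction \<eta> l n (pos n) (cap, x) = A x / real n" for x
    unfolding failure_fraction_eq A_def G_def bits_def ..
  have "measure_pmf.expectation \<P> A = (\<Sum>u\<in>{1..n}. measure_pmf.prob \<P> {x. alive (G x) (\<lambda>u. Suc (cap u)) l u})"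
    unfolding A_def by (rule expectation_card) simp
  then have m: "mean_failures l n cap = measure_pmf.expectation \<P> A / real n"
    unfolding mean_failures_def by (simp add: \<P>_def G_def bits_def)
  have "{x. \<bar>failure_fraction \<eta> l n (pos n) (cap, x) - mean_failures l n cap\<bar> > 2 * \<epsilon>}
      = {x. \<bar>A x - measure_pmf.expectation \<P> A\<bar> > 2 * \<epsilon> * real n}"
    unfolding W m using n_pos by (simp add: abs_divide less_divide_eq flip: diff_divide_distrib)
  also have "measure_pmf.prob \<P> \<dots> \<le> real n * exp (2 * c - real (cutoff l n)) + deviation_bound (cutoff l n) l \<epsilon>"
    unfolding A_def by (rule survivor_count_tail[OF \<epsilon> small])
  also have "deviation_bound (cutoff l n) l \<epsilon> \<le> 2 * exp (- (min 1 (\<epsilon> / (2 * c)) * \<epsilon> / (8 * 9 ^ l) * sqrt (real n)))"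
    by (rule deviation_bound_cutoff[OF erasure_graph_axioms order_refl \<epsilon>])
  finally show ?thesis by (simp add: \<P>_def)
qed

text \<open>Atypical assignments cost at most 1 each, because both \<open>z\<close> and the
  conditional means lie between 0 and 1.\<close>

lemma expectation_near:
  assumes n: "n \<in> N" and K: "deterministic_caps L tmax \<gamma> \<tau> n (pos n) K \<or> random_caps \<tau> n (pos n) K"
    and \<epsilon>: "0 \<le> \<epsilon>" and close: "\<And>cap. cap \<in> typical L tmax \<gamma> \<tau> (pos n) n \<Longrightarrow> \<bar>mean_failures l n cap - z\<bar> \<le> \<epsilon>"
    and z: "0 \<le> z" "z \<le> 1"
  shows "\<bar>measure_pmf.expectation (code_space \<eta> c n (pos n) K) (failure_fraction \<eta> l n (pos n)) - z\<bar>
      \<le> \<epsilon> + real (L * tmax) * (2 * exp (- (sqrt (real n) / 4)))"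
proof -
  let ?T = "typical L tmax \<gamma> \<tau> (pos n) n"
  have b: "0 \<le> mean_failures l n cap" "mean_failures l n cap \<le> 1" for cap
    using mean_failures_bounds[OF n] by auto
  have int: "integrable (measure_pmf K) (mean_failures l n)"
    using b by (intro measure_pmf.integrable_const_bound[where B = 1]) auto
  have int': "integrable (measure_pmf K) (\<lambda>cap. \<bar>mean_failures l n cap - z\<bar>)"
    using int by (intro Bochner_Integration.integrable_abs Bochner_Integration.integrable_diff) auto
  have "1 \<le> n" using N_gt[OF n] c_pos by (cases n) auto
  then have tail: "measure_pmf.prob K (- ?T) \<le> real (L * tmax) * (2 * exp (- (sqrt (real n) / 4)))"
    using placement[OF n] tau K by (rule prob_typical)
  have "\<bar>measure_pmf.expectation K (mean_failures l n) - z\<bar> = \<bar>measure_pmf.expectation K (\<lambda>cap. mean_failures l n cap - z)\<bar>"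
    using int by simp
  also have "\<dots> \<le> measure_pmf.expectation K (\<lambda>cap. \<bar>mean_failures l n cap - z\<bar>)"
    by (rule integral_abs_bound)
  also have "\<dots> \<le> measure_pmf.expectation K (\<lambda>cap. \<epsilon> + indicator (- ?T) cap)"
  proof (intro integral_mono int')
    show "integrable (measure_pmf K) (\<lambda>cap. \<epsilon> + indicator (- ?T) cap)"
      by (intro measure_pmf.integrable_const_bound[where B = "\<epsilon> + 1"]) (use \<epsilon> in \<open>auto simp: indicator_def\<close>)
    fix cap
    show "\<bar>mean_failures l n cap - z\<bar> \<le> \<epsilon> + indicator (- ?T) cap"
    proof (cases "cap \<in> ?T")
      case True
      then show ?thesis using close by simp
    next
      case False
      have "\<bar>mean_failures l n cap - z\<bar> \<le> 1" using b[of cap] z by linarith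
      then show ?thesis using False \<epsilon> by simp
    qed
  qed
  also have "\<dots> = \<epsilon> + measure_pmf.prob K (- ?T)"
    by (subst Bochner_Integration.integral_add)
      (auto intro!: measure_pmf.integrable_const_bound[where B = 1])
  finally show ?thesis unfolding expectation_failure_fraction[OF n] using tail by linarith
qed

end

theorem theorem3:
  fixes L tmax l :: nat and c :: real
    and \<eta> :: "nat \<Rightarrow> nat \<Rightarrow> nat" and \<gamma> :: "nat pmf" and \<tau> :: "nat \<Rightarrow> nat pmf"
    and N :: "nat set" and pos :: "nat \<Rightarrow> nat \<Rightarrow> nat" and K :: "nat \<Rightarrow> (nat \<Rightarrow> nat) pmf"
  assumes "L \<ge> 1" and "tmax \<ge> 1" and "l \<ge> 1" and "c > 0"
    and eta_binary: "\<And>i j. i \<in> {1..L} \<Longrightarrow> j \<in> {1..L} \<Longrightarrow> \<eta> i j \<in> {0, 1}"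
    and eta_sym: "\<And>i j. i \<in> {1..L} \<Longrightarrow> j \<in> {1..L} \<Longrightarrow> \<eta> i j = \<eta> j i"
    and eta_row: "\<And>i. i \<in> {1..L} \<Longrightarrow> \<exists>j\<in>{1..L}. \<eta> i j = 1"
    and eta_irreducible: "\<And>i j. i \<in> {1..L} \<Longrightarrow> j \<in> {1..L} \<Longrightarrow>
           (i, j) \<in> {(a, b). a \<in> {1..L} \<and> b \<in> {1..L} \<and> \<eta> a b = 1}\<^sup>*"
    and gamma: "set_pmf \<gamma> \<subseteq> {1..L}"
    and tau: "\<And>i. i \<in> {1..L} \<Longrightarrow> set_pmf (\<tau> i) \<subseteq> {1..tmax}"
    and N_infinite: "infinite N"
    and N_gt: "\<And>n. n \<in> N \<Longrightarrow> real n > c"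
    and placement: "\<And>n. n \<in> N \<Longrightarrow> valid_placement L \<gamma> n (pos n)"
    and capabilities: "(\<forall>n\<in>N. deterministic_caps L tmax \<gamma> \<tau> n (pos n) (K n)) \<or>
                       (\<forall>n\<in>N. random_caps \<tau> n (pos n) (K n))"
  shows "((\<lambda>n. measure_pmf.expectation (code_space \<eta> c n (pos n) (K n))
                 (failure_fraction \<eta> l n (pos n)))
           \<longlongrightarrow> root_survival_prob L tmax \<eta> \<gamma> \<tau> c l) (inf sequentially (principal N))
       \<and> (\<forall>\<epsilon>>0. \<exists>\<delta>>0. \<exists>\<beta>>0. \<exists>n0. \<forall>n\<in>N. n > n0 \<longrightarrow>
            measure_pmf.prob (code_space \<eta> c n (pos n) (K n))
              {\<omega>. \<bar>failure_fraction \<eta> l n (pos n) \<omega>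
                    - measure_pmf.expectation (code_space \<eta> c n (pos n) (K n))
                        (failure_fraction \<eta> l n (pos n))\<bar> > \<epsilon>}
              \<le> exp (- \<beta> * real n powr \<delta>))"
proof -
  interpret product_code L tmax N \<eta> \<gamma> \<tau> c pos
    by unfold_locales (use assms in auto)
  obtain k where l: "l = Suc k" using \<open>l \<ge> 1\<close> by (cases l) auto
  let ?F = "inf sequentially (principal N)"
  let ?T = "\<lambda>n. typical L tmax \<gamma> \<tau> (pos n) n"
  let ?tail = "\<lambda>n. real (L * tmax) * (2 * exp (- (sqrt (real n) / 4)))"
  define z where "z = root_survival_prob L tmax \<eta> \<gamma> \<tau> c l"
  define \<Omega> where "\<Omega> n = code_space \<eta> c n (pos n) (K n)" for n
  define W where "W n = failure_fraction \<eta> l n (pos n)" for n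
  define E where "E n = measure_pmf.expectation (\<Omega> n) (W n)" for n
  have z: "0 \<le> z" "z \<le> 1" by (simp_all add: z_def root_survival_prob_def)
  have K: "deterministic_caps L tmax \<gamma> \<tau> n (pos n) (K n) \<or> random_caps \<tau> n (pos n) (K n)" if "n \<in> N" for n
    using capabilities that by blast
  have in_N: "\<forall>\<^sub>F n in ?F. n \<in> N" by (simp add: eventually_inf_principal)
  have F: "eventually R sequentially \<Longrightarrow> eventually R ?F" for R
    using filter_leD[OF inf_le1] by blast
  have typical_mean: "\<forall>\<^sub>F n in ?F. \<forall>cap \<in> ?T n. \<bar>mean_failures l n cap - z\<bar> < \<epsilon>" if "0 < \<epsilon>" for \<epsilon>
    using mean_failures_limit[OF that, of k] by (simp add: l z_def)
  have lim: "(E \<longlongrightarrow> z) ?F"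
  proof (rule tendstoI)
    fix e :: real assume e: "0 < e"
    then have e3: "0 < e / 3" by simp
    have "(?tail \<longlongrightarrow> 0) sequentially" by real_asymp
    from order_tendstoD(2)[OF this, of "e / 3"] e have "\<forall>\<^sub>F n in sequentially. ?tail n < e / 3" by simp
    from in_N F[OF this] typical_mean[OF e3] show "\<forall>\<^sub>F n in ?F. dist (E n) z < e"
    proof eventually_elim
      case (elim n)
      have "\<bar>E n - z\<bar> \<le> e / 3 + ?tail n"
        unfolding E_def \<Omega>_def W_def using e elim(1,3) z
        by (intro expectation_near K) auto
      then show ?case using elim(2) e unfolding dist_real_def by linarith
    qed
  qed
  have conc: "\<exists>\<delta>>0. \<exists>\<beta>>0. \<exists>n0. \<forall>n\<in>N. n > n0 \<longrightarrow>
      measure_pmf.prob (\<Omega> n) {\<omega>. \<bar>W n \<omega> - E n\<bar> > \<epsilon>} \<le> exp (- \<beta> * real n powr \<delta>)" if "0 < \<epsilon>" for \<epsilon>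
  proof -
    \<comment> \<open>\<open>a\<close> is the exponent of \<open>cutoff l\<close>, and
      \<open>C\<close> is the constant of \<open>fixed_caps_tail\<close> at deviation
      \<open>\<epsilon> / 4\<close>.\<close>
    define a where "a = 1 / (4 * (real l + 1))"
    define C where "C = min 1 (\<epsilon> / 4 / (2 * c)) * (\<epsilon> / 4) / (8 * 9 ^ l)"
    have a: "0 < a" "a < 1" and C: "0 < C" using that \<open>c > 0\<close> by (auto simp: a_def C_def)
    define B where "B n = real n * exp (2 * c - real (cutoff l n)) + 2 * exp (- (C * sqrt (real n)))" for n
    have \<epsilon>: "0 < \<epsilon> / 4" using that by simp
    have small: "\<forall>\<^sub>F n in sequentially. real n * exp (2 * c - real (cutoff l n)) < \<epsilon> / 4"
      by (rule order_tendstoD(2)[OF high_degree_limit \<epsilon>])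
    have "\<forall>\<^sub>F n in ?F. \<bar>E n - z\<bar> < \<epsilon> / 4" using tendstoD[OF lim \<epsilon>] unfolding dist_real_def .
    from in_N typical_mean[OF \<epsilon>] this F[OF small]
      F[OF stretched_exponential_bound[OF a C, of "2 * real (L * tmax)" "2 * c + 1"]]
    have "\<forall>\<^sub>F n in ?F. measure_pmf.prob (\<Omega> n) {\<omega>. \<bar>W n \<omega> - E n\<bar> > \<epsilon>} \<le> exp (- 1 * real n powr (a / 2))"
    proof eventually_elim
      case (elim n)
      let ?P = "erasures \<eta> (c / real n) n (pos n)"
      have "measure_pmf.prob (\<Omega> n) {\<omega>. \<bar>W n \<omega> - E n\<bar> > \<epsilon>}
          = measure_pmf.expectation (K n) (\<lambda>cap. measure_pmf.prob ?P {x. \<bar>W n (cap, x) - E n\<bar> > \<epsilon>})"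
        by (simp add: \<Omega>_def code_space_def measure_pair_pmf_section)
      also have "\<dots> \<le> measure_pmf.expectation (K n) (\<lambda>cap. indicator (- ?T n) cap + B n)"
      proof (intro integral_mono)
        show "integrable (measure_pmf (K n)) (\<lambda>cap. measure_pmf.prob ?P {x. \<bar>W n (cap, x) - E n\<bar> > \<epsilon>})"
          by (intro measure_pmf.integrable_const_bound[where B = 1]) auto
        show "integrable (measure_pmf (K n)) (\<lambda>cap. indicator (- ?T n) cap + B n)"
          by (intro Bochner_Integration.integrable_add measure_pmf.integrable_const_bound[where B = 1 and f = "indicator _"])
            auto
        fix cap
        have B0: "0 \<le> B n" by (simp add: B_def)
        show "measure_pmf.prob ?P {x. \<bar>W n (cap, x) - E n\<bar> > \<epsilon>} \<le> indicator (- ?T n) cap + B n"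
        proof (cases "cap \<in> ?T n")
          case True
          then have near: "\<bar>mean_failures l n cap - z\<bar> < \<epsilon> / 4" using elim(2) by blast
          \<comment> \<open>\<open>E n\<close> and the conditional mean are each within
            \<open>\<epsilon> / 4\<close> of \<open>z\<close>, which leaves
            \<open>\<epsilon> / 2\<close> for the fluctuation at fixed capabilities. Comparing both
            with \<open>z\<close> disposes of the randomness of the conditional mean.\<close>
          have "\<bar>W n (cap, x) - mean_failures l n cap\<bar> > 2 * (\<epsilon> / 4)" if "\<bar>W n (cap, x) - E n\<bar> > \<epsilon>" for x
            using that near elim(3) by linarith
          then have "{x. \<bar>W n (cap, x) - E n\<bar> > \<epsilon>} \<subseteq> {x. \<bar>W n (cap, x) - mean_failures l n cap\<bar> > 2 * (\<epsilon> / 4)}"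
            by blast
          then have "measure_pmf.prob ?P {x. \<bar>W n (cap, x) - E n\<bar> > \<epsilon>}
              \<le> measure_pmf.prob ?P {x. \<bar>W n (cap, x) - mean_failures l n cap\<bar> > 2 * (\<epsilon> / 4)}"
            by (intro measure_pmf.finite_measure_mono) auto
          also have "\<dots> \<le> B n"
            unfolding W_def B_def C_def using elim(1) \<epsilon> less_imp_le[OF elim(4)] by (rule fixed_caps_tail)
          finally show ?thesis using True by simp
        next
          case False
          have "measure_pmf.prob ?P {x. \<bar>W n (cap, x) - E n\<bar> > \<epsilon>} \<le> 1" by simp
          moreover have "indicator (- ?T n) cap = (1 :: real)" using False by simp
          ultimately show ?thesis using B0 by linarith
        qed
      qed
      also have "\<dots> = measure_pmf.prob (K n) (- ?T n) + B n"
        by (subst Bochner_Integration.integral_add)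
          (auto intro!: measure_pmf.integrable_const_bound[where B = 1 and f = "indicator _"])
      also have "\<dots> \<le> ?tail n + (real n * exp (2 * c + 1 - real n powr a) + 2 * exp (- (C * sqrt (real n))))"
      proof (intro add_mono)
        have "1 \<le> n" using N_gt[OF elim(1)] \<open>c > 0\<close> by (cases n) auto
        then show "measure_pmf.prob (K n) (- ?T n) \<le> ?tail n"
          using placement[OF elim(1)] tau K[OF elim(1)] by (rule prob_typical)
        show "B n \<le> real n * exp (2 * c + 1 - real n powr a) + 2 * exp (- (C * sqrt (real n)))"
          using cutoff_lower[of n l] unfolding B_def a_def
          by (intro add_right_mono mult_left_mono) auto
      qed
      also have "\<dots> \<le> exp (- 1 * real n powr (a / 2))"
        using elim(5) by (simp add: mult_ac)
      finally show ?case .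
    qed
    then obtain n0 where "\<And>n. n \<ge> n0 \<Longrightarrow> n \<in> N \<Longrightarrow>
        measure_pmf.prob (\<Omega> n) {\<omega>. \<bar>W n \<omega> - E n\<bar> > \<epsilon>} \<le> exp (- 1 * real n powr (a / 2))"
      unfolding eventually_inf_principal eventually_sequentially by blast
    \<comment> \<open>Halving the exponent \<open>a\<close> has absorbed all constants, so
      \<open>\<beta> = 1\<close> suffices and \<open>\<delta> = 1 / (8 * (l + 1))\<close> does not
      depend on \<open>\<epsilon>\<close>.\<close>
    then show ?thesis
      using a by (intro exI[of _ "a / 2"] exI[of _ 1] exI[of _ n0] conjI) auto
  qed
  show ?thesis
    using lim conc unfolding E_def[abs_def] W_def \<Omega>_def z_def by blast
qed

end
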